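(* Let $G$ be a connected reductive algebraic group over an algebraically closed field of characteristic $\ell>0$, and let $F$ be a Steinberg endomorphism of $G$. Let $A\le G^F$ be a finite subgroup, let $w\in C_G(A)/C_G(A)^\circ$, and let $A_w={}^gA\le G^F$, where $g\in G$ is chosen with $g^{-1}F(g)C_G(A)^\circ=w$. If $\dot w\in C_G(A)$ is any lift of $w$, then $$(C_G(A_w)^\circ)^F\cong (C_G(A)^\circ)^{\dot wF}.$$ Furthermore, up to isomorphism, $(C_G(A)^\circ)^{\dot wF}$ is independent of the choice of $\dot w$. If $w$ acts as an inner automorphism of $C_G(A)^\circ$, then $(C_G(A_w)^\circ)^F\cong (C_G(A)^\circ)^F$.
   Context: A Steinberg endomorphism of a linear algebraic group $G$ is an endomorphism $F:G\to G$ some power of which is a Frobenius morphism with respect to some $\mathbb F_q$-structure. $X^\sigma$ denotes the fixed points of a map $\sigma:X\to X$. $H^\circ$ is the identity component of $H$; ${}^gA=gAg^{-1}$. $\dot wF$ denotes the map $x\mapsto \dot wF(x)\dot w^{-1}$. That $w$ acts as an inner automorphism of $C_G(A)^\circ$ means that conjugation by a (equivalently any) lift of $w$ to $C_G(A)$ induces an inner automorphism of $C_G(A)^\circ$. The existence of $g$ follows from the Lang–Steinberg theorem, and $A_w$ is determined up to $G^F$-conjugacy by $w$. *)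

theory Defs
  imports
    "HOL-Algebra.Generated_Groups"
    "HOL-Analysis.Abstract_Topological_Spaces"
    "HOL-Computational_Algebra.Polynomial"
begin

section \<open>Affine varieties\<close>

text \<open>
  Points of affine \<open>n\<close>-space are the extensional functions on \<open>{..<n}\<close>. Polynomials enter only
  through the functions they define, which loses nothing over an infinite field.
\<close>

definition affine_space :: "nat \<Rightarrow> (nat \<Rightarrow> 'k::field) set" where
  "affine_space n = ({..<n} \<rightarrow>\<^sub>E UNIV)"

inductive_set poly_funs :: "nat \<Rightarrow> ((nat \<Rightarrow> 'k::field) \<Rightarrow> 'k) set" for n :: nat where
  const: "(\<lambda>v. c) \<in> poly_funs n"
| coord: "i < n \<Longrightarrow> (\<lambda>v. v i) \<in> poly_funs n"
| add: "p \<in> poly_funs n \<Longrightarrow> r \<in> poly_funs n \<Longrightarrow> (\<lambda>v. p v + r v) \<in> poly_funs n"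
| mult: "p \<in> poly_funs n \<Longrightarrow> r \<in> poly_funs n \<Longrightarrow> (\<lambda>v. p v * r v) \<in> poly_funs n"

definition algebraic_set :: "nat \<Rightarrow> (nat \<Rightarrow> 'k::field) set \<Rightarrow> bool" where
  "algebraic_set n S \<longleftrightarrow>
     (\<exists>P \<subseteq> poly_funs n. S = {v \<in> affine_space n. \<forall>p \<in> P. p v = 0})"

text \<open>
  An affine variety (possibly reducible) is a set \<open>X\<close> with an algebra \<open>R\<close> of \<open>k\<close>-valued functions,
  the regular functions, such that \<open>(X, R)\<close> is isomorphic to an algebraic set in some affine space
  with its polynomial functions. The embedding is not part of the structure. Regular functions are
  extensional on \<open>X\<close>, so that equality in \<open>R\<close> is equality of functions on \<open>X\<close>.
\<close>

definition affine_variety :: "'g set \<Rightarrow> ('g \<Rightarrow> 'k::field) set \<Rightarrow> bool" where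
  "affine_variety X R \<longleftrightarrow>
     (\<exists>n \<phi>. inj_on \<phi> X \<and> algebraic_set n (\<phi> ` X) \<and>
        R = {restrict (\<lambda>x. p (\<phi> x)) X | p. p \<in> poly_funs n})"

definition regular_map ::
    "'g set \<Rightarrow> ('g \<Rightarrow> 'k::field) set \<Rightarrow> 'h set \<Rightarrow> ('h \<Rightarrow> 'k) set \<Rightarrow> ('g \<Rightarrow> 'h) \<Rightarrow> bool" where
  "regular_map X R Y S \<phi> \<longleftrightarrow>
     \<phi> \<in> X \<rightarrow> Y \<and> (\<forall>f \<in> S. restrict (\<lambda>x. f (\<phi> x)) X \<in> R)"

text \<open>The algebra of the product variety is the tensor product of the two algebras.\<close>

definition prod_regular ::
    "'g set \<Rightarrow> ('g \<Rightarrow> 'k::field) set \<Rightarrow> 'h set \<Rightarrow> ('h \<Rightarrow> 'k) set \<Rightarrow> ('g \<times> 'h \<Rightarrow> 'k) set" where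
  "prod_regular X R Y S =
     {restrict (\<lambda>(x, y). \<Sum>i<r. f i x * g i y) (X \<times> Y) | (r::nat) f g.
        (\<forall>i<r. f i \<in> R) \<and> (\<forall>i<r. g i \<in> S)}"

definition zariski :: "'g set \<Rightarrow> ('g \<Rightarrow> 'k::field) set \<Rightarrow> 'g topology" where
  "zariski X R = topology (\<lambda>U. \<exists>S \<subseteq> R. U = X - {x \<in> X. \<forall>f \<in> S. f x = 0})"

lemma affine_variety_mult:
  assumes "affine_variety X R" "f \<in> R" "g \<in> R"
  shows "restrict (\<lambda>x. f x * g x) X \<in> R"
proof -
  obtain n \<phi> where R: "R = {restrict (\<lambda>x. p (\<phi> x)) X | p. p \<in> poly_funs n}"
    using assms(1) unfolding affine_variety_def by blast
  obtain p r where "p \<in> poly_funs n" "f = restrict (\<lambda>x. p (\<phi> x)) X"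
    "r \<in> poly_funs n" "g = restrict (\<lambda>x. r (\<phi> x)) X"
    using assms(2,3) unfolding R by blast
  then have "restrict (\<lambda>x. f x * g x) X = restrict (\<lambda>x. (\<lambda>v. p v * r v) (\<phi> x)) X"
    and "(\<lambda>v. p v * r v) \<in> poly_funs n"
    by (auto intro: poly_funs.mult)
  then show ?thesis
    unfolding R by (intro CollectI exI[of _ "\<lambda>v. p v * r v"]) simp
qed

lemma affine_variety_one:
  assumes "affine_variety X R"
  shows "restrict (\<lambda>x. 1) X \<in> R"
proof -
  obtain n \<phi> where R: "R = {restrict (\<lambda>x. p (\<phi> x)) X | p. p \<in> poly_funs n}"
    using assms(1) unfolding affine_variety_def by blast
  have "(\<lambda>v. 1) \<in> poly_funs n"
    by (rule poly_funs.const)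
  then show ?thesis
    unfolding R by (intro CollectI exI[of _ "\<lambda>v. 1"]) simp
qed

lemma openin_zariski:
  assumes "affine_variety X R"
  shows "openin (zariski X R) U \<longleftrightarrow> (\<exists>S \<subseteq> R. U = X - {x \<in> X. \<forall>f \<in> S. f x = 0})"
proof -
  let ?P = "\<lambda>U. \<exists>S \<subseteq> R. U = X - {x \<in> X. \<forall>f \<in> S. f x = 0}"
  have inter: "?P (U \<inter> V)" if U: "?P U" and V: "?P V" for U V
  proof -
    obtain S T where S: "S \<subseteq> R" "U = X - {x \<in> X. \<forall>f \<in> S. f x = 0}"
      and T: "T \<subseteq> R" "V = X - {x \<in> X. \<forall>f \<in> T. f x = 0}"
      using U V by blast
    let ?ST = "{restrict (\<lambda>x. f x * g x) X | f g. f \<in> S \<and> g \<in> T}"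
    have "?ST \<subseteq> R"
      using S(1) T(1) affine_variety_mult[OF assms] by blast
    moreover have "U \<inter> V = X - {x \<in> X. \<forall>h \<in> ?ST. h x = 0}"
    proof (intro Set.set_eqI iffI)
      fix x assume "x \<in> U \<inter> V"
      then obtain f g where fg: "x \<in> X" "f \<in> S" "f x \<noteq> 0" "g \<in> T" "g x \<noteq> 0"
        unfolding S(2) T(2) by blast
      then have "restrict (\<lambda>x. f x * g x) X \<in> ?ST" "restrict (\<lambda>x. f x * g x) X x \<noteq> 0"
        by auto
      then show "x \<in> X - {x \<in> X. \<forall>h \<in> ?ST. h x = 0}"
        using fg(1) by blast
    next
      fix x assume x: "x \<in> X - {x \<in> X. \<forall>h \<in> ?ST. h x = 0}"
      then obtain h where "x \<in> X" "h \<in> ?ST" "h x \<noteq> 0"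
        by blast
      then obtain f g where "x \<in> X" "f \<in> S" "g \<in> T" "f x \<noteq> 0" "g x \<noteq> 0"
        by auto
      then show "x \<in> U \<inter> V"
        unfolding S(2) T(2) by blast
    qed
    ultimately show ?thesis by (intro exI[of _ ?ST] conjI)
  qed
  have union: "?P (\<Union>\<K>)" if K: "\<forall>U \<in> \<K>. ?P U" for \<K>
  proof -
    obtain s where s: "\<And>U. U \<in> \<K> \<Longrightarrow> s U \<subseteq> R \<and> U = X - {x \<in> X. \<forall>f \<in> s U. f x = 0}"
      using bchoice[OF K] by (elim exE) (rule that, erule bspec)
    have mem: "x \<in> U \<longleftrightarrow> x \<in> X \<and> (\<exists>f \<in> s U. f x \<noteq> 0)" if "U \<in> \<K>" for x U
    proof -
      have "U = X - {x \<in> X. \<forall>f \<in> s U. f x = 0}"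
        using s[OF that] by (rule conjunct2)
      from eqset_imp_iff[OF this, of x] show ?thesis
        by blast
    qed
    have "\<Union>\<K> = X - {x \<in> X. \<forall>f \<in> \<Union>(s ` \<K>). f x = 0}"
      by (rule Set.set_eqI) (simp add: mem, blast)
    moreover have "\<Union>(s ` \<K>) \<subseteq> R"
    proof (rule UN_least)
      show "s U \<subseteq> R" if "U \<in> \<K>" for U
        using s[OF that] by (rule conjunct1)
    qed
    ultimately show ?thesis by (intro exI[of _ "\<Union>(s ` \<K>)"] conjI)
  qed
  have "istopology ?P"
    unfolding istopology_def by (intro conjI allI impI inter union)
  then show ?thesis
    unfolding zariski_def by (rule fun_cong[OF topology_inverse'])
qed

lemma topspace_zariski:
  fixes R :: "('g \<Rightarrow> 'k::field) set"
  assumes "affine_variety X R"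
  shows "topspace (zariski X R) = X"
proof (rule subset_antisym)
  have "\<exists>S \<subseteq> R. topspace (zariski X R) = X - {x \<in> X. \<forall>f \<in> S. f x = 0}"
    using openin_topspace[of "zariski X R"] unfolding openin_zariski[OF assms] .
  then show "topspace (zariski X R) \<subseteq> X"
    by (elim exE conjE) (erule ssubst, rule Diff_subset)
  have "X = X - {x \<in> X. \<forall>f \<in> {restrict (\<lambda>x. 1::'k) X}. f x = 0}"
    by auto
  moreover have "{restrict (\<lambda>x. 1) X} \<subseteq> R"
    using affine_variety_one[OF assms] by simp
  ultimately have "openin (zariski X R) X"
    unfolding openin_zariski[OF assms] by (intro exI[of _ "{restrict (\<lambda>x. 1) X}"] conjI)
  then show "X \<subseteq> topspace (zariski X R)"
    by (rule openin_subset)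
qed

lemma closedin_zariski:
  fixes R :: "('g \<Rightarrow> 'k::field) set"
  assumes "affine_variety X R"
  shows "closedin (zariski X R) C \<longleftrightarrow> (\<exists>S \<subseteq> R. C = {x \<in> X. \<forall>f \<in> S. f x = 0})"
proof -
  have "(C \<subseteq> X \<and> X - C = X - Z) \<longleftrightarrow> C = Z" if "Z \<subseteq> X" for Z
    using that by (metis double_diff subset_refl)
  then have eq: "(C \<subseteq> X \<and> X - C = X - {x \<in> X. \<forall>f \<in> S. f x = 0}) \<longleftrightarrow>
      C = {x \<in> X. \<forall>f \<in> S. f x = 0}" for S :: "('g \<Rightarrow> 'k) set"
    by (simp add: Collect_restrict)
  show ?thesis
    unfolding closedin_def topspace_zariski[OF assms] openin_zariski[OF assms]
      ex_simps(2)[symmetric] eq[symmetric] by (simp only: conj_left_commute)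
qed


section \<open>Linear algebraic groups\<close>

record ('g, 'k) alg_group = "'g monoid" +
  regular :: "('g \<Rightarrow> 'k) set"

locale linear_algebraic_group = group G
  for G :: "('g, 'k::field) alg_group" (structure) +
  assumes variety: "affine_variety (carrier G) (regular G)"
    and regular_mult:
      "regular_map (carrier G \<times> carrier G)
         (prod_regular (carrier G) (regular G) (carrier G) (regular G))
         (carrier G) (regular G) (\<lambda>(x, y). x \<otimes> y)"
    and regular_inv:
      "regular_map (carrier G) (regular G) (carrier G) (regular G) (\<lambda>x. inv x)"

abbreviation group_zariski :: "('g, 'k::field) alg_group \<Rightarrow> 'g topology" where
  "group_zariski G \<equiv> zariski (carrier G) (regular G)"

text \<open>
  For a closed subgroup, the Zariski topology is the subspace topology, so \<open>H\<degree>\<close> is the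
  component of \<open>1\<close> in the subspace \<open>H\<close>.
\<close>

definition identity_component :: "('g, 'k::field) alg_group \<Rightarrow> 'g set \<Rightarrow> 'g set" where
  "identity_component G H =
     connected_component_of_set (subtopology (group_zariski G) H) \<one>\<^bsub>G\<^esub>"

text \<open>
  An element \<open>u\<close> is unipotent if the right translation \<open>\<rho>\<^sub>u f = (x \<mapsto> f (x u))\<close> of the algebra of
  regular functions is locally unipotent, i.e. if \<open>\<rho>\<^sub>u - 1\<close> is locally nilpotent.
\<close>

definition translation_minus_id ::
    "('g, 'k::field) alg_group \<Rightarrow> 'g \<Rightarrow> ('g \<Rightarrow> 'k) \<Rightarrow> ('g \<Rightarrow> 'k)" where
  "translation_minus_id G u f = restrict (\<lambda>x. f (x \<otimes>\<^bsub>G\<^esub> u) - f x) (carrier G)"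

definition unipotent_element :: "('g, 'k::field) alg_group \<Rightarrow> 'g \<Rightarrow> bool" where
  "unipotent_element G u \<longleftrightarrow>
     u \<in> carrier G \<and>
     (\<forall>f \<in> regular G. \<exists>N. \<forall>x \<in> carrier G. (translation_minus_id G u ^^ N) f x = 0)"

text \<open>
  The unipotent radical is the largest closed connected normal unipotent subgroup. Its existence is
  a theorem; the subgroup generated by all these subgroups is defined in any case and equals it.
\<close>

definition unipotent_radical :: "('g, 'k::field) alg_group \<Rightarrow> 'g set" where
  "unipotent_radical G =
     generate G (\<Union>{U. U \<lhd> G \<and> closedin (group_zariski G) U \<and>
       connectedin (group_zariski G) U \<and> (\<forall>u \<in> U. unipotent_element G u)})"

definition connected_reductive_group :: "('g, 'k::field) alg_group \<Rightarrow> bool" where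
  "connected_reductive_group G \<longleftrightarrow>
     linear_algebraic_group G \<and> connected_space (group_zariski G) \<and>
     unipotent_radical G = {\<one>\<^bsub>G\<^esub>}"


section \<open>Frobenius morphisms and Steinberg endomorphisms\<close>

text \<open>
  An \<open>\<bbbF>\<^sub>q\<close>-structure on an affine variety with algebra \<open>R\<close> is an \<open>\<bbbF>\<^sub>q\<close>-subalgebra \<open>R0\<close> of \<open>R\<close> such
  that the canonical map \<open>k \<otimes> R0 \<rightarrow> R\<close>, with the tensor product over \<open>\<bbbF>\<^sub>q\<close>, is bijective: \<open>R0\<close>
  spans \<open>R\<close> over \<open>k\<close>, and families in \<open>R0\<close> that are independent over \<open>\<bbbF>\<^sub>q\<close> are so over \<open>k\<close>.
\<close>

definition Fq :: "nat \<Rightarrow> 'k::field set" where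
  "Fq q = {c. c ^ q = c}"

definition independent_over ::
    "'k::field set \<Rightarrow> 'g set \<Rightarrow> nat \<Rightarrow> (nat \<Rightarrow> 'g \<Rightarrow> 'k) \<Rightarrow> bool" where
  "independent_over K X r a \<longleftrightarrow>
     (\<forall>c. (\<forall>i<r. c i \<in> K) \<and> (\<forall>x \<in> X. (\<Sum>i<r. c i * a i x) = 0) \<longrightarrow> (\<forall>i<r. c i = 0))"

definition Fq_structure ::
    "nat \<Rightarrow> 'g set \<Rightarrow> ('g \<Rightarrow> 'k::field) set \<Rightarrow> ('g \<Rightarrow> 'k) set \<Rightarrow> bool" where
  "Fq_structure q X R R0 \<longleftrightarrow>
     R0 \<subseteq> R \<and>
     (\<forall>c \<in> Fq q. restrict (\<lambda>x. c) X \<in> R0) \<and>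
     (\<forall>f \<in> R0. \<forall>g \<in> R0. restrict (\<lambda>x. f x + g x) X \<in> R0) \<and>
     (\<forall>f \<in> R0. \<forall>g \<in> R0. restrict (\<lambda>x. f x * g x) X \<in> R0) \<and>
     (\<forall>f \<in> R. \<exists>r a c. (\<forall>i<r. a i \<in> R0) \<and> (\<forall>x \<in> X. f x = (\<Sum>i<(r::nat). c i * a i x))) \<and>
     (\<forall>r a. (\<forall>i<r. a i \<in> R0) \<and> independent_over (Fq q) X r a \<longrightarrow> independent_over UNIV X r a)"

definition frobenius_morphism ::
    "nat \<Rightarrow> 'g set \<Rightarrow> ('g \<Rightarrow> 'k::field) set \<Rightarrow> ('g \<Rightarrow> 'k) set \<Rightarrow> ('g \<Rightarrow> 'g) \<Rightarrow> bool" where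
  "frobenius_morphism q X R R0 \<phi> \<longleftrightarrow>
     regular_map X R X R \<phi> \<and> (\<forall>f \<in> R0. \<forall>x \<in> X. f (\<phi> x) = f x ^ q)"

text \<open>
  A group homomorphism that is the Frobenius morphism for an \<open>\<bbbF>\<^sub>q\<close>-structure of the variety forces
  multiplication and inversion to be defined over \<open>\<bbbF>\<^sub>q\<close>, so no compatibility of the structure with
  the group law has to be imposed.
\<close>

definition steinberg_endomorphism ::
    "('g, 'k::field) alg_group \<Rightarrow> ('g \<Rightarrow> 'g) \<Rightarrow> bool" where
  "steinberg_endomorphism G F \<longleftrightarrow>
     F \<in> hom G G \<and>
     regular_map (carrier G) (regular G) (carrier G) (regular G) F \<and>
     (\<exists>m\<ge>1. \<exists>e\<ge>1. \<exists>R0. Fq_structure (CHAR('k) ^ e) (carrier G) (regular G) R0 \<and>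
        frobenius_morphism (CHAR('k) ^ e) (carrier G) (regular G) R0 (F ^^ m))"


section \<open>Fixed points, centralizers and twisted maps\<close>

definition fixed_points :: "'g set \<Rightarrow> ('g \<Rightarrow> 'g) \<Rightarrow> 'g set" where
  "fixed_points X \<sigma> = {x \<in> X. \<sigma> x = x}"

definition centralizer :: "('g, 'b) monoid_scheme \<Rightarrow> 'g set \<Rightarrow> 'g set" where
  "centralizer G A = {x \<in> carrier G. \<forall>a \<in> A. x \<otimes>\<^bsub>G\<^esub> a = a \<otimes>\<^bsub>G\<^esub> x}"

definition conjugate :: "('g, 'b) monoid_scheme \<Rightarrow> 'g \<Rightarrow> 'g \<Rightarrow> 'g" where
  "conjugate G g x = g \<otimes>\<^bsub>G\<^esub> x \<otimes>\<^bsub>G\<^esub> inv\<^bsub>G\<^esub> g"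

abbreviation centralizer_component :: "('g, 'k::field) alg_group \<Rightarrow> 'g set \<Rightarrow> 'g set" where
  "centralizer_component G A \<equiv> identity_component G (centralizer G A)"

text \<open>
  Elements of \<open>C\<^sub>G(A) / C\<^sub>G(A)\<degree>\<close> are cosets; the lifts of \<open>w\<close> are the elements of \<open>w\<close>.
\<close>

definition component_group :: "('g, 'k::field) alg_group \<Rightarrow> 'g set \<Rightarrow> 'g set monoid" where
  "component_group G A =
     G\<lparr>carrier := centralizer G A\<rparr> Mod centralizer_component G A"

definition acts_as_inner :: "('g, 'k::field) alg_group \<Rightarrow> 'g set \<Rightarrow> 'g set \<Rightarrow> bool" where
  "acts_as_inner G A w \<longleftrightarrow>
     (\<exists>wd \<in> w. \<exists>c \<in> centralizer_component G A.
        \<forall>x \<in> centralizer_component G A. conjugate G wd x = conjugate G c x)"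

text \<open>\<open>(C\<^sub>G(A)\<degree>)\<^sup>\<sigma>\<close> as a group.\<close>

definition fixed_group ::
    "('g, 'k::field) alg_group \<Rightarrow> 'g set \<Rightarrow> ('g \<Rightarrow> 'g) \<Rightarrow> ('g, 'k) alg_group" where
  "fixed_group G A \<sigma> = G\<lparr>carrier := fixed_points (centralizer_component G A) \<sigma>\<rparr>"

end

theory Submission
  imports Defs "HOL-Library.Function_Algebras"
begin

text \<open>
  Let \<open>H = C\<^sub>G(A)\<degree>\<close>. For \<open>n = g\<inverse> F(g)\<close> one has \<open>F(g x g\<inverse>) = g (n F(x) n\<inverse>) g\<inverse>\<close>, so conjugation by \<open>g\<close>
  carries the fixed points of \<open>nF\<close> on \<open>H\<close> to those of \<open>F\<close> on \<open>C\<^sub>G(A\<^sub>w)\<degree> = g H g\<inverse>\<close>; here \<open>n\<close> is one lift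
  of \<open>w\<close>. Two lifts of \<open>w\<close> differ by a factor \<open>h \<in> H\<close>. If \<open>h = a\<inverse> \<sigma>(a)\<close> with \<open>a \<in> H\<close>, where \<open>\<sigma>\<close> is the
  twisted endomorphism for one of the lifts, then conjugation by \<open>a\<close> identifies the two groups of
  fixed points. If \<open>w\<close> acts on \<open>H\<close> as an element \<open>c \<in> H\<close>, then \<open>wF\<close> agrees on \<open>H\<close> with \<open>cF\<close>, a twist of
  \<open>F\<close> by an element of \<open>H\<close>, and the same argument applies. What has to be shown is therefore the
  Lang-Steinberg theorem: the map \<open>\<beta>(a) = a\<inverse> \<sigma>(a)\<close> of the connected group \<open>H\<close> to itself is surjective.

  The proof of that theorem works with the coordinate ring \<open>T\<close> of \<open>H\<close> and the pullback \<open>\<theta>\<close> along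
  \<open>\<beta>\<close>. First, \<open>T\<close> is a finite module over \<open>\<theta> T\<close> (\<open>lang_map_finite\<close>): from \<open>\<sigma>(a) = a \<beta>(a)\<close> it follows that
  the iterates of \<open>\<sigma>\<close> have the form \<open>a c(\<beta>(a))\<close>; as some of these iterates are Frobenius morphisms up to
  conjugation, large \<open>q\<close>-powers of generators of \<open>T\<close> are combinations over \<open>\<theta> T\<close> of functions of
  bounded degree. Second, \<open>\<theta>\<close> is injective (\<open>finite_endo_injective\<close>), since \<open>T\<close> is a noetherian domain and
  the kernels of the powers of \<open>\<theta>\<close> would otherwise be an infinite strictly increasing chain of primes.
  That \<open>T\<close> is noetherian is Hilbert's basis theorem (\<open>noetherian_adjoin\<close>); that it is a domain expresses
  that a connected closed subgroup is irreducible (\<open>coord_domain\<close>). Third, a character of \<open>T\<close> can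
  be lifted along a finite injective \<open>\<theta>\<close> (\<open>extend_character\<close>), and characters of \<open>T\<close> are points of \<open>H\<close>
  (\<open>residue_point\<close>). Lifting the evaluation at \<open>b\<close> gives a point \<open>a\<close> with \<open>\<beta>(a) = b\<close>.
\<close>

section \<open>Subrings, ideals and finite modules\<close>

definition unital_subring :: "'a::comm_ring_1 set \<Rightarrow> bool" where
  "unital_subring S \<longleftrightarrow> 1 \<in> S \<and> (\<forall>a\<in>S. \<forall>b\<in>S. a - b \<in> S) \<and> (\<forall>a\<in>S. \<forall>b\<in>S. a * b \<in> S)"

definition ideal_in :: "'a::comm_ring_1 set \<Rightarrow> 'a set \<Rightarrow> bool" where
  "ideal_in S I \<longleftrightarrow> I \<subseteq> S \<and> 0 \<in> I \<and> (\<forall>a\<in>I. \<forall>b\<in>I. a + b \<in> I) \<and> (\<forall>s\<in>S. \<forall>a\<in>I. s * a \<in> I)"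

text \<open>
  Modulo \<open>P\<close>, these are the combinations of elements of \<open>M\<close> with coefficients in \<open>S\<close>. The set \<open>S\<close> is
  a subring or an ideal of coefficients; \<open>P\<close> is an ideal that is factored out.
\<close>

inductive_set rspan :: "'a::comm_ring_1 set \<Rightarrow> 'a set \<Rightarrow> 'a set \<Rightarrow> 'a set"
  for S P M :: "'a set" where
  base: "p \<in> P \<Longrightarrow> p \<in> rspan S P M"
| step: "v \<in> rspan S P M \<Longrightarrow> s \<in> S \<Longrightarrow> m \<in> M \<Longrightarrow> s * m + v \<in> rspan S P M"

lemma subring_diff: "unital_subring S \<Longrightarrow> a \<in> S \<Longrightarrow> b \<in> S \<Longrightarrow> a - b \<in> S"
  and subring_mult: "unital_subring S \<Longrightarrow> a \<in> S \<Longrightarrow> b \<in> S \<Longrightarrow> a * b \<in> S"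
  and subring_one: "unital_subring S \<Longrightarrow> 1 \<in> S"
  by (auto simp: unital_subring_def)

lemma subring_zero: "unital_subring S \<Longrightarrow> 0 \<in> S"
  using subring_diff[of S 1 1] subring_one[of S] by simp

lemma subring_uminus: "unital_subring S \<Longrightarrow> a \<in> S \<Longrightarrow> - a \<in> S"
  using subring_diff[of S 0 a] subring_zero[of S] by simp

lemma subring_add: "unital_subring S \<Longrightarrow> a \<in> S \<Longrightarrow> b \<in> S \<Longrightarrow> a + b \<in> S"
  using subring_diff[of S a "- b"] subring_uminus[of S b] by simp

lemma subring_sum: "unital_subring S \<Longrightarrow> (\<And>i. i \<in> I \<Longrightarrow> f i \<in> S) \<Longrightarrow> sum f I \<in> S"
  by (induction I rule: infinite_finite_induct) (auto intro: subring_add subring_zero)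

lemma subring_power: "unital_subring S \<Longrightarrow> a \<in> S \<Longrightarrow> a ^ n \<in> S"
  by (induction n) (auto intro: subring_mult subring_one)

lemma subring_prod_list: "unital_subring S \<Longrightarrow> set l \<subseteq> S \<Longrightarrow> prod_list l \<in> S"
  by (induction l) (auto intro: subring_mult subring_one)

lemmas subring_intros = subring_diff subring_mult subring_one subring_zero subring_uminus
  subring_add subring_sum subring_power

lemma ideal_subset: "ideal_in S I \<Longrightarrow> a \<in> I \<Longrightarrow> a \<in> S"
  and ideal_zero: "ideal_in S I \<Longrightarrow> 0 \<in> I"
  and ideal_add: "ideal_in S I \<Longrightarrow> a \<in> I \<Longrightarrow> b \<in> I \<Longrightarrow> a + b \<in> I"
  and ideal_mult: "ideal_in S I \<Longrightarrow> s \<in> S \<Longrightarrow> a \<in> I \<Longrightarrow> s * a \<in> I"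
  by (auto simp: ideal_in_def)

lemma ideal_diff:
  assumes "unital_subring S" "ideal_in S I" "a \<in> I" "b \<in> I"
  shows "a - b \<in> I"
proof -
  have "(- 1) * b \<in> I"
    using assms by (intro ideal_mult[OF assms(2)] subring_intros)
  then show ?thesis
    using ideal_add[OF assms(2) assms(3)] by force
qed

lemma ideal_sum: "ideal_in S I \<Longrightarrow> (\<And>i. i \<in> J \<Longrightarrow> f i \<in> I) \<Longrightarrow> sum f J \<in> I"
  by (induction J rule: infinite_finite_induct) (auto intro: ideal_add ideal_zero)

lemma rspan_mono:
  assumes "v \<in> rspan S P M" "S \<subseteq> S'" "P \<subseteq> P'" "M \<subseteq> M'"
  shows "v \<in> rspan S' P' M'"
  using assms by (induction rule: rspan.induct) (auto intro: rspan.intros)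

lemma rspan_add:
  assumes "\<And>a b. a \<in> P \<Longrightarrow> b \<in> P \<Longrightarrow> a + b \<in> P" "v \<in> rspan S P M" "w \<in> rspan S P M"
  shows "v + w \<in> rspan S P M"
  using assms(2)
proof (induction rule: rspan.induct)
  case (base p)
  from assms(3) show ?case
  proof (induction rule: rspan.induct)
    case (base p')
    then show ?case using assms(1) \<open>p \<in> P\<close> by (blast intro: rspan.base)
  next
    case (step v s m)
    then have "s * m + (p + v) \<in> rspan S P M" by (intro rspan.step)
    then show ?case by (simp add: algebra_simps)
  qed
next
  case (step v s m)
  then have "s * m + (v + w) \<in> rspan S P M" by (intro rspan.step)
  then show ?case by (simp add: algebra_simps)
qed

lemma rspan_scale:
  assumes "\<And>p. p \<in> P \<Longrightarrow> c * p \<in> P'" "\<And>s. s \<in> S \<Longrightarrow> c * s \<in> S'" "v \<in> rspan S P M"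
  shows "c * v \<in> rspan S' P' M"
  using assms(3)
proof (induction rule: rspan.induct)
  case (base p)
  then show ?case using assms by (blast intro: rspan.base)
next
  case (step v s m)
  then have "(c * s) * m + c * v \<in> rspan S' P' M"
    using assms by (intro rspan.step)
  then show ?case by (simp add: algebra_simps)
qed

lemma rspan_ideal_scale:
  assumes "unital_subring S" "ideal_in S I" "c \<in> S" "v \<in> rspan I {0} M"
  shows "c * v \<in> rspan I {0} M"
  by (rule rspan_scale[OF _ _ assms(4)]) (use assms in \<open>auto intro: ideal_mult\<close>)

lemma rspan_insertE:
  assumes "v \<in> rspan S P (insert m M)" "0 \<in> S" "\<And>a b. a \<in> S \<Longrightarrow> b \<in> S \<Longrightarrow> a + b \<in> S"
  obtains a where "a \<in> S" "v - a * m \<in> rspan S P M"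
proof -
  have "\<exists>a\<in>S. v - a * m \<in> rspan S P M"
    using assms(1)
  proof (induction rule: rspan.induct)
    case (base p)
    then show ?case using assms(2) by (auto intro!: bexI[of _ 0] rspan.base)
  next
    case (step v s m')
    then obtain a where a: "a \<in> S" "v - a * m \<in> rspan S P M" by blast
    show ?case
    proof (cases "m' = m")
      case True
      then have "s * m' + v - (s + a) * m = v - a * m" by (simp add: algebra_simps)
      then show ?thesis using a assms(3) step by (metis)
    next
      case False
      then have "s * m' + (v - a * m) \<in> rspan S P M"
        using step a by (intro rspan.step) auto
      then show ?thesis using a by (auto intro!: bexI[of _ a] simp: algebra_simps)
    qed
  qed
  then show ?thesis using that by blast
qed

lemma rspan_subset:
  assumes "P \<subseteq> I" "\<And>s m. s \<in> S \<Longrightarrow> m \<in> M \<Longrightarrow> s * m \<in> I" "\<And>a b. a \<in> I \<Longrightarrow> b \<in> I \<Longrightarrow> a + b \<in> I"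
  shows "rspan S P M \<subseteq> I"
proof
  fix v assume "v \<in> rspan S P M"
  then show "v \<in> I" by (induction rule: rspan.induct) (use assms in auto)
qed

lemma rspan_empty: "rspan S P {} = P"
  by (auto intro: rspan.base elim: rspan.cases)

text \<open>
  Steinitz exchange: eliminating one generator at a time with a pivot outside \<open>P\<close>. Working modulo
  \<open>P\<close> gives linear dependence over the domain \<open>S / (S \<inter> P)\<close>.
\<close>

lemma rspan_dependent:
  assumes S: "unital_subring S" and P: "ideal_in T P" and T: "unital_subring T" "S \<subseteq> T" "M \<subseteq> T"
    and prime: "\<And>a b. a \<in> S \<Longrightarrow> b \<in> S \<Longrightarrow> a * b \<in> P \<Longrightarrow> a \<in> P \<or> b \<in> P"
    and "1 \<notin> P" "finite M" "finite J" "card M < card J"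
    and "\<And>j. j \<in> J \<Longrightarrow> v j \<in> rspan S P M"
  shows "\<exists>c. (\<forall>j\<in>J. c j \<in> S) \<and> (\<exists>j\<in>J. c j \<notin> P) \<and> (\<Sum>j\<in>J. c j * v j) \<in> P"
  using assms(8-) T(3)
proof (induction M arbitrary: J v rule: finite_induct)
  case empty
  have "(\<Sum>j\<in>J. 1 * v j) \<in> P"
    using empty by (intro ideal_sum[OF P]) (simp add: rspan_empty)
  moreover have "J \<noteq> {}" using empty by auto
  ultimately show ?case
    using \<open>1 \<notin> P\<close> subring_one[OF S] by (intro exI[of _ "\<lambda>_. 1"]) auto
next
  case (insert m M)
  have add: "a \<in> P \<Longrightarrow> b \<in> P \<Longrightarrow> a + b \<in> P" for a b
    using ideal_add[OF P] .
  have "\<exists>a. a \<in> S \<and> v j - a * m \<in> rspan S P M" if "j \<in> J" for j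
    using insert.prems(3)[OF that] by (rule rspan_insertE) (auto intro: subring_intros S)
  then obtain a where a: "\<And>j. j \<in> J \<Longrightarrow> a j \<in> S" "\<And>j. j \<in> J \<Longrightarrow> v j - a j * m \<in> rspan S P M"
    by metis
  show ?case
  proof (cases "\<forall>j\<in>J. a j \<in> P")
    case True
    have "v j \<in> rspan S P M" if "j \<in> J" for j
    proof -
      have "m * a j \<in> P" using True that insert.prems by (intro ideal_mult[OF P]) auto
      then have "a j * m + (v j - a j * m) \<in> rspan S P M"
        by (intro rspan_add add a(2)[OF that] rspan.base) (simp_all add: mult.commute)
      then show ?thesis by simp
    qed
    then show ?thesis
      using insert by (intro insert.IH) auto
  next
    case False
    then obtain j0 where j0: "j0 \<in> J" "a j0 \<notin> P" by blast
    let ?J = "J - {j0}"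
    let ?v = "\<lambda>j. a j0 * v j - a j * v j0"
    have "?v j \<in> rspan S P M" if "j \<in> J" for j
    proof -
      have sc: "c * w \<in> rspan S P M" if "c \<in> S" "w \<in> rspan S P M" for c w
        using that T by (intro rspan_scale[of P c P S S])
          (auto intro: subring_mult[OF S] ideal_mult[OF P])
      have "a j0 * (v j - a j * m) + (- a j) * (v j0 - a j0 * m) \<in> rspan S P M"
        using a j0 that by (intro rspan_add add sc) (auto intro: subring_intros S)
      then show ?thesis by (simp add: algebra_simps)
    qed
    moreover have "card M < card ?J"
      using insert j0 by (simp add: card_Diff_singleton)
    ultimately obtain c where c: "\<forall>j\<in>?J. c j \<in> S" "\<exists>j\<in>?J. c j \<notin> P" "(\<Sum>j\<in>?J. c j * ?v j) \<in> P"
      using insert.IH[of ?J ?v] insert.prems by auto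
    \<comment> \<open>The coefficients of the \<open>v j\<close> once the definition of \<open>?v j\<close> is substituted into \<open>c(3)\<close>.\<close>
    define c' where "c' j = (if j = j0 then - (\<Sum>j\<in>?J. c j * a j) else c j * a j0)" for j
    have "(\<Sum>j\<in>J. c' j * v j) = c' j0 * v j0 + (\<Sum>j\<in>?J. c' j * v j)"
      using insert.prems j0 by (simp add: sum.remove)
    also have "(\<Sum>j\<in>?J. c' j * v j) = (\<Sum>j\<in>?J. c j * a j0 * v j)"
      by (intro sum.cong) (auto simp: c'_def)
    also have "c' j0 * v j0 + \<dots> = (\<Sum>j\<in>?J. c j * ?v j)"
      by (simp add: c'_def sum_distrib_right sum_distrib_left sum_subtractf algebra_simps)
    finally have "(\<Sum>j\<in>J. c' j * v j) \<in> P" using c(3) by simp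
    moreover have "\<forall>j\<in>J. c' j \<in> S"
      using c(1) a j0 by (auto simp: c'_def intro!: subring_intros S)
    moreover have "\<exists>j\<in>J. c' j \<notin> P"
    proof -
      obtain j where j: "j \<in> ?J" "c j \<notin> P" using c(2) by blast
      then have "c j * a j0 \<notin> P" using prime[of "c j" "a j0"] c(1) a j0 by blast
      then show ?thesis using j by (auto simp: c'_def intro!: bexI[of _ j])
    qed
    ultimately show ?thesis by blast
  qed
qed

text \<open>
  Nakayama's lemma, by eliminating generators. The multiplier \<open>s\<close> records the denominators that
  one would otherwise invert in the localization at \<open>I\<close>.
\<close>

lemma nakayama:
  assumes S: "unital_subring S" and I: "ideal_in S I"
    and prime: "\<And>a b. a \<in> S \<Longrightarrow> b \<in> S \<Longrightarrow> a * b \<in> I \<Longrightarrow> a \<in> I \<or> b \<in> I"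
    and "finite M" "s \<in> S" "s \<notin> I" "\<And>m. m \<in> M \<Longrightarrow> s * m \<in> rspan I {0} M"
  shows "\<exists>u\<in>S. u \<notin> I \<and> (\<forall>m\<in>M. u * m = 0)"
  using assms(4-)
proof (induction M arbitrary: s rule: finite_induct)
  case empty
  then show ?case by auto
next
  case (insert m M)
  have add: "a \<in> {0} \<Longrightarrow> b \<in> {0} \<Longrightarrow> a + b \<in> {0}" for a b :: 'a by simp
  have decomp: "\<exists>a\<in>I. s * m' - a * m \<in> rspan I {0} M" if "m' \<in> insert m M" for m'
    using insert.prems(3)[OF that] by (rule rspan_insertE) (auto intro: ideal_zero[OF I] ideal_add[OF I])
  obtain a where a: "a \<in> I" "s * m - a * m \<in> rspan I {0} M"
    using decomp[of m] by auto
  define s' where "s' = s - a"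
  have s': "s' \<in> S" "s' \<notin> I" "s' * m \<in> rspan I {0} M"
    unfolding s'_def using a insert.prems ideal_subset[OF I] ideal_add[OF I, of "s - a" a]
    by (auto intro: subring_diff[OF S] simp: algebra_simps)
  have "\<exists>u\<in>S. u \<notin> I \<and> (\<forall>m\<in>M. u * m = 0)"
  proof (rule insert.IH)
    show "s * s' \<in> S" using s' insert.prems by (intro subring_mult[OF S])
    show "s * s' \<notin> I" using prime s' insert.prems by blast
    fix m' assume "m' \<in> M"
    then obtain b where b: "b \<in> I" "s * m' - b * m \<in> rspan I {0} M"
      using decomp by blast
    have "b * (s' * m) + s' * (s * m' - b * m) \<in> rspan I {0} M"
      by (rule rspan_add[OF add]) (use b s' ideal_subset[OF I] in \<open>auto intro!: rspan_ideal_scale[OF S I]\<close>)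
    then show "s * s' * m' \<in> rspan I {0} M" by (simp add: algebra_simps)
  qed
  then obtain u where u: "u \<in> S" "u \<notin> I" "\<And>m. m \<in> M \<Longrightarrow> u * m = 0" by blast
  have kill: "u * w = 0" if "w \<in> rspan I {0} M" for w
    using that by (induction rule: rspan.induct) (auto simp: distrib_left u(3) mult.left_commute[of u])
  have "u * s' * m' = 0" if "m' \<in> insert m M" for m'
  proof (cases "m' = m")
    case True
    then show ?thesis using kill[OF s'(3)] by (simp add: mult.assoc)
  next
    case False
    then show ?thesis using u(3)[of m'] that by (simp add: mult.commute[of u] mult.assoc)
  qed
  moreover have "u * s' \<in> S" "u * s' \<notin> I"
    using prime u s' by (auto intro: subring_mult[OF S])
  ultimately show ?case by blast
qed

section \<open>Hilbert's basis theorem\<close>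

text \<open>
  The ascending chain condition, which is the form in which the property is used: for kernels of
  iterated endomorphisms and for annihilators.
\<close>

definition noetherian :: "'a::comm_ring_1 set \<Rightarrow> bool" where
  "noetherian S \<longleftrightarrow> (\<forall>I::nat \<Rightarrow> 'a set. (\<forall>i. ideal_in S (I i)) \<and> (\<forall>i. I i \<subseteq> I (Suc i)) \<longrightarrow>
     (\<exists>N. \<forall>j\<ge>N. I j = I N))"

text \<open>
  The subring generated by \<open>S\<close> and \<open>t\<close>, as the set of values at \<open>t\<close> of the polynomials over \<open>S\<close>.
\<close>

definition adjoin :: "'a::comm_ring_1 set \<Rightarrow> 'a \<Rightarrow> 'a set" where
  "adjoin S t = {poly p t | p. \<forall>i. coeff p i \<in> S}"

definition lead_ideal :: "'a::comm_ring_1 set \<Rightarrow> 'a \<Rightarrow> 'a set \<Rightarrow> nat \<Rightarrow> 'a set" where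
  "lead_ideal S t I d =
     {coeff p d | p. (\<forall>i. coeff p i \<in> S) \<and> degree p \<le> d \<and> poly p t \<in> I}"

lemma ideal_lead_ideal:
  assumes S: "unital_subring S" and I: "ideal_in (adjoin S t) I"
  shows "ideal_in S (lead_ideal S t I d)"
  unfolding ideal_in_def
proof (intro conjI ballI)
  show "lead_ideal S t I d \<subseteq> S" by (auto simp: lead_ideal_def)
  show "0 \<in> lead_ideal S t I d"
    unfolding lead_ideal_def using ideal_zero[OF I] subring_zero[OF S] by (auto intro!: exI[of _ 0])
  fix a b assume "a \<in> lead_ideal S t I d" "b \<in> lead_ideal S t I d"
  then obtain p q where "a = coeff p d" "\<forall>i. coeff p i \<in> S" "degree p \<le> d" "poly p t \<in> I"
    "b = coeff q d" "\<forall>i. coeff q i \<in> S" "degree q \<le> d" "poly q t \<in> I"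
    unfolding lead_ideal_def by blast
  then show "a + b \<in> lead_ideal S t I d"
    unfolding lead_ideal_def
    by (intro CollectI exI[of _ "p + q"]) (auto intro: degree_add_le subring_add[OF S] ideal_add[OF I])
next
  fix s a assume s: "s \<in> S" "a \<in> lead_ideal S t I d"
  then obtain p where p: "a = coeff p d" "\<forall>i. coeff p i \<in> S" "degree p \<le> d" "poly p t \<in> I"
    unfolding lead_ideal_def by blast
  have "s \<in> adjoin S t"
    unfolding adjoin_def using s subring_zero[OF S]
    by (intro CollectI exI[of _ "[:s:]"]) (auto simp: coeff_pCons split: nat.splits)
  with p s show "s * a \<in> lead_ideal S t I d"
    unfolding lead_ideal_def
    by (intro CollectI exI[of _ "smult s p"])
      (auto intro: subring_mult[OF S] ideal_mult[OF I] order.trans[OF degree_smult_le])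
qed

lemma lead_ideal_mono: "I \<subseteq> I' \<Longrightarrow> lead_ideal S t I d \<subseteq> lead_ideal S t I' d"
  unfolding lead_ideal_def by blast

lemma lead_ideal_Suc:
  assumes S: "unital_subring S" and I: "ideal_in (adjoin S t) I"
  shows "lead_ideal S t I d \<subseteq> lead_ideal S t I (Suc d)"
proof
  fix a assume "a \<in> lead_ideal S t I d"
  then obtain p where p: "a = coeff p d" "\<forall>i. coeff p i \<in> S" "degree p \<le> d" "poly p t \<in> I"
    unfolding lead_ideal_def by blast
  have "t \<in> adjoin S t"
    unfolding adjoin_def using subring_zero[OF S] subring_one[OF S]
    by (intro CollectI exI[of _ "[:0, 1:]"]) (auto simp: coeff_pCons split: nat.splits)
  with p show "a \<in> lead_ideal S t I (Suc d)"
    unfolding lead_ideal_def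
    using subring_zero[OF S]
    by (intro CollectI exI[of _ "pCons 0 p"])
      (auto intro!: ideal_mult[OF I] simp: coeff_pCons degree_pCons_eq_if split: nat.splits)
qed

text \<open>
  Subtracting an element of \<open>I\<close> with the same leading coefficient lowers the degree, so an ideal
  is determined by its leading coefficients within any larger ideal.
\<close>

lemma lead_ideal_inj:
  assumes S: "unital_subring S" and T: "unital_subring (adjoin S t)"
    and I: "ideal_in (adjoin S t) I" and I': "ideal_in (adjoin S t) I'"
    and "I \<subseteq> I'" and eq: "\<And>d. lead_ideal S t I d = lead_ideal S t I' d"
  shows "I = I'"
proof -
  have "poly p t \<in> I" if "degree p \<le> d" "\<forall>i. coeff p i \<in> S" "poly p t \<in> I'" for p d
    using that
  proof (induction d arbitrary: p)
    case (0 p)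
    then have "coeff p 0 \<in> lead_ideal S t I 0" unfolding eq by (auto simp: lead_ideal_def)
    then obtain q where q: "coeff p 0 = coeff q 0" "degree q \<le> 0" "poly q t \<in> I"
      unfolding lead_ideal_def by blast
    then have "p = q" using 0 by (metis bot_nat_0.extremum_uniqueI degree_eq_zeroE coeff_pCons_0)
    then show ?case using q by simp
  next
    case (Suc d p)
    then have "coeff p (Suc d) \<in> lead_ideal S t I (Suc d)" unfolding eq by (auto simp: lead_ideal_def)
    then obtain q where q: "coeff p (Suc d) = coeff q (Suc d)" "degree q \<le> Suc d" "poly q t \<in> I"
      "\<forall>i. coeff q i \<in> S"
      unfolding lead_ideal_def by blast
    have "degree (p - q) \<le> d"
    proof (rule degree_le, intro allI impI)
      fix i assume "d < i"
      then have "i = Suc d \<or> Suc d < i" by linarith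
      then show "coeff (p - q) i = 0"
        using q Suc.prems by (auto simp: coeff_eq_0)
    qed
    moreover have "\<forall>i. coeff (p - q) i \<in> S" using q Suc.prems by (auto intro: subring_diff[OF S])
    moreover have "poly (p - q) t \<in> I'"
      using Suc.prems q assms(5) by (auto intro!: ideal_diff[OF T I'])
    ultimately have "poly (p - q) t \<in> I" by (rule Suc.IH)
    then show ?case using ideal_add[OF I _ q(3)] by fastforce
  qed
  then have "I' \<subseteq> I" using ideal_subset[OF I'] unfolding adjoin_def by blast
  then show ?thesis using assms(5) by blast
qed

text \<open>
  The leading coefficient ideals increase with the degree and along the chain. The diagonal sequence
  becomes stationary, which leaves finitely many degrees, each stationary on its own.
\<close>

lemma noetherian_adjoin:
  assumes S: "unital_subring S" and T: "unital_subring (adjoin S t)" and noeth: "noetherian S"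
  shows "noetherian (adjoin S t)"
  unfolding noetherian_def
proof (intro allI impI, elim conjE)
  fix I :: "nat \<Rightarrow> 'a set"
  assume I: "\<forall>i. ideal_in (adjoin S t) (I i)" and inc: "\<forall>i. I i \<subseteq> I (Suc i)"
  have stab: "\<exists>N. \<forall>j\<ge>N. L j = L N" if "\<And>i. ideal_in S (L i)" "\<And>i. L i \<subseteq> L (Suc i)" for L
    using noeth that unfolding noetherian_def by blast
  let ?L = "\<lambda>d j. lead_ideal S t (I j) d"
  have mono: "?L d j \<subseteq> ?L d' j'" if "d \<le> d'" "j \<le> j'" for d d' j j'
  proof -
    have "?L d j \<subseteq> ?L d' j"
      by (rule lift_Suc_mono_le[of "\<lambda>d. ?L d j", OF _ that(1)])
        (rule lead_ideal_Suc[OF S I[rule_format]])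
    moreover have "I j \<subseteq> I j'"
      by (rule lift_Suc_mono_le[of I, OF inc[rule_format] that(2)])
    ultimately show ?thesis using lead_ideal_mono by blast
  qed
  \<comment> \<open>Beyond the point where the diagonal is stationary, both indices are irrelevant.\<close>
  have "\<exists>N. \<forall>j\<ge>N. ?L j j = ?L N N"
    by (rule stab) (use ideal_lead_ideal[OF S] I mono in auto)
  then obtain N where N: "\<And>j. j \<ge> N \<Longrightarrow> ?L j j = ?L N N" by blast
  have big: "?L d j = ?L N N" if "d \<ge> N" "j \<ge> N" for d j
    using mono[of N d N j] mono[of d "max d j" j "max d j"] N[of "max d j"] that by auto
  have "\<exists>N'. \<forall>j\<ge>N'. ?L d j = ?L d N'" for d
    by (rule stab) (use ideal_lead_ideal[OF S] I mono in auto)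
  then obtain K where K: "\<And>d j. j \<ge> K d \<Longrightarrow> ?L d j = ?L d (K d)" by metis
  define N' where "N' = Max (insert N (K ` {..<N}))"
  have N': "N \<le> N'" "\<And>d. d < N \<Longrightarrow> K d \<le> N'"
    unfolding N'_def by (auto intro!: Max_ge)
  have eqL: "?L d j = ?L d N'" if "j \<ge> N'" for d j
  proof (cases "d < N")
    case True
    then show ?thesis using K[of d j] K[of d N'] N'(2)[of d] that by auto
  next
    case False
    then show ?thesis using big[of d j] big[of d N'] N' that by auto
  qed
  have "I j = I N'" if "j \<ge> N'" for j
  proof -
    have "I N' \<subseteq> I j" by (rule lift_Suc_mono_le[of I, OF inc[rule_format] that])
    then show ?thesis
      using lead_ideal_inj[OF S T, of "I N'" "I j"] I eqL[OF that] by simp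
  qed
  then show "\<exists>N. \<forall>j\<ge>N. I j = I N" by blast
qed

section \<open>Finite ring endomorphisms\<close>

definition subring_endo :: "'a::comm_ring_1 set \<Rightarrow> ('a \<Rightarrow> 'a) \<Rightarrow> bool" where
  "subring_endo T \<theta> \<longleftrightarrow> \<theta> \<in> T \<rightarrow> T \<and> \<theta> 1 = 1 \<and>
     (\<forall>a\<in>T. \<forall>b\<in>T. \<theta> (a - b) = \<theta> a - \<theta> b \<and> \<theta> (a * b) = \<theta> a * \<theta> b)"

lemma subring_endoD:
  assumes "subring_endo T \<theta>"
  shows "a \<in> T \<Longrightarrow> \<theta> a \<in> T" "\<theta> 1 = 1"
    "a \<in> T \<Longrightarrow> b \<in> T \<Longrightarrow> \<theta> (a - b) = \<theta> a - \<theta> b"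
    "a \<in> T \<Longrightarrow> b \<in> T \<Longrightarrow> \<theta> (a * b) = \<theta> a * \<theta> b"
  using assms by (simp_all add: subring_endo_def Pi_iff)

lemma subring_endo_zero:
  assumes "unital_subring T" "subring_endo T \<theta>"
  shows "\<theta> 0 = 0"
  using subring_endoD(3)[OF assms(2) subring_one[OF assms(1)] subring_one[OF assms(1)]] by simp

lemma subring_endo_add:
  assumes "unital_subring T" "subring_endo T \<theta>" "a \<in> T" "b \<in> T"
  shows "\<theta> (a + b) = \<theta> a + \<theta> b"
proof -
  have "\<theta> (a - (0 - b)) = \<theta> a - (\<theta> 0 - \<theta> b)"
    using assms by (simp only: subring_endoD(3)[OF assms(2)] subring_intros)
  then show ?thesis by (simp add: subring_endo_zero[OF assms(1,2)])
qed

lemma subring_endo_image: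
  assumes T: "unital_subring T" and "subring_endo T \<theta>"
  shows "unital_subring (\<theta> ` T)"
  unfolding unital_subring_def
proof (intro conjI ballI)
  note D = subring_endoD[OF assms(2)]
  show "1 \<in> \<theta> ` T" using subring_one[OF T] D(2) by force
  fix a b assume "a \<in> \<theta> ` T" "b \<in> \<theta> ` T"
  then obtain x y where "x \<in> T" "y \<in> T" "a = \<theta> x" "b = \<theta> y" by blast
  then show "a - b \<in> \<theta> ` T" "a * b \<in> \<theta> ` T"
    using D(3,4) subring_diff[OF T] subring_mult[OF T] by (auto simp flip: D(3,4))
qed

lemma subring_endo_funpow:
  assumes "subring_endo T \<theta>"
  shows "subring_endo T (\<theta> ^^ n)"
  using assms by (induction n) (auto simp: subring_endo_def Pi_iff)

text \<open>
  The kernels of the powers of \<open>\<theta>\<close> form an increasing chain of prime ideals, stationary by the chain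
  condition. At its last strict step, two primes, one properly inside the other, would lie over the
  same prime of \<open>\<theta> T\<close>; this is excluded by the algebraicity of \<open>T\<close> over \<open>\<theta> T\<close>. So there is no strict
  step at all. The argument stands in for the comparison of dimensions that is usual here.
\<close>

lemma finite_endo_injective:
  fixes T :: "'a::comm_ring_1 set"
  assumes T: "unital_subring T" and noeth: "noetherian T"
    and domain: "\<And>a b. a \<in> T \<Longrightarrow> b \<in> T \<Longrightarrow> a * b = 0 \<Longrightarrow> a = 0 \<or> b = 0"
    and \<theta>: "subring_endo T \<theta>" and M: "finite M" "M \<subseteq> T" "T \<subseteq> rspan (\<theta> ` T) {0} M"
    and a: "a \<in> T" "\<theta> a = 0"
  shows "a = 0"
proof -
  define P where "P i = {a \<in> T. (\<theta> ^^ i) a = 0}" for i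
  note pow = subring_endo_funpow[OF \<theta>]
  have ideal: "ideal_in T (P i)" for i
    unfolding ideal_in_def P_def using subring_endo_zero[OF T pow] subring_endo_add[OF T pow]
    by (auto simp: subring_endoD(4)[OF pow] intro: subring_intros T)
  have inc: "P i \<subseteq> P (Suc i)" for i
    unfolding P_def using subring_endo_zero[OF T \<theta>] by auto
  have shift: "\<theta> x \<in> P i \<longleftrightarrow> x \<in> P (Suc i)" if "x \<in> T" for x i
    unfolding P_def using that subring_endoD(1)[OF \<theta>] by (simp add: funpow_swap1)
  have prime: "x \<in> P i \<or> y \<in> P i" if "x \<in> T" "y \<in> T" "x * y \<in> P i" for x y i
    using that domain[of "(\<theta> ^^ i) x" "(\<theta> ^^ i) y"] subring_endoD(1,4)[OF pow]
    unfolding P_def by auto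
  have "\<exists>N. \<forall>j\<ge>N. P j = P N"
    using noeth ideal inc unfolding noetherian_def by blast
  then have ex: "\<exists>N. P (Suc N) = P N" by (metis le_SucI order_refl)
  define N where "N = (LEAST N. P (Suc N) = P N)"
  have N: "P (Suc N) = P N" using LeastI_ex[OF ex] unfolding N_def .
  show ?thesis
  proof (cases N)
    case 0
    have "a \<in> P (Suc 0)" using a by (simp add: P_def)
    then have "a \<in> P 0" using N 0 by simp
    then show ?thesis by (simp add: P_def)
  next
    case (Suc j)
    have "P (Suc j) \<noteq> P j"
      using not_less_Least[of j "\<lambda>N. P (Suc N) = P N"] Suc unfolding N_def by simp
    then obtain u where u: "u \<in> P (Suc j)" "u \<notin> P j" using inc by blast
    have uT: "u \<in> T" using u by (simp add: P_def)
    have ST: "\<theta> ` T \<subseteq> T" using subring_endoD(1)[OF \<theta>] by (rule image_subsetI)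
    \<comment> \<open>A relation over \<open>\<theta> T\<close> satisfied by \<open>u\<close> modulo \<open>P j\<close> has its constant term in
       \<open>P (Suc j)\<close>, so in \<open>P j\<close> because the kernels are stationary; dividing by \<open>u\<close> and
       repeating, all its coefficients vanish modulo \<open>P j\<close>.\<close>
    have transc: "\<forall>l<n. c l \<in> P j"
      if "\<forall>l<n. c l \<in> \<theta> ` T" "(\<Sum>l<n. c l * u ^ l) \<in> P j" for n c
      using that
    proof (induction n arbitrary: c)
      case 0
      then show ?case by simp
    next
      case (Suc n)
      let ?r = "\<Sum>l<n. c (Suc l) * u ^ l"
      have cT: "c l \<in> T" if "l < Suc n" for l
        using Suc.prems(1) that ST by blast
      have rT: "?r \<in> T" using cT uT by (auto intro!: subring_intros T)
      have split: "(\<Sum>l<Suc n. c l * u ^ l) = c 0 + u * ?r"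
        by (subst sum.lessThan_Suc_shift) (simp add: sum_distrib_left algebra_simps)
      have "u * ?r \<in> P (Suc j)"
        using ideal_mult[OF ideal rT u(1)] by (simp add: mult.commute)
      then have "(c 0 + u * ?r) - u * ?r \<in> P (Suc j)"
        using Suc.prems(2) inc unfolding split by (intro ideal_diff[OF T ideal]) auto
      then have "c 0 \<in> P (Suc j)" by simp
      moreover obtain d where "d \<in> T" "c 0 = \<theta> d" using Suc.prems(1) by auto
      ultimately have c0: "c 0 \<in> P j"
        using shift[of d] N \<open>N = Suc j\<close> by simp
      have "(c 0 + u * ?r) - c 0 \<in> P j"
        using Suc.prems(2) c0 unfolding split by (intro ideal_diff[OF T ideal]) auto
      then have "u * ?r \<in> P j" by simp
      then have "?r \<in> P j" using prime[OF uT rT] u(2) by blast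
      then have "\<forall>l<n. c (Suc l) \<in> P j" using Suc.prems(1) by (intro Suc.IH) auto
      then show ?case using c0 by (auto simp: less_Suc_eq_0_disj)
    qed
    have one: "1 \<notin> P j"
      using u uT ideal_mult[OF ideal[of j], of u 1] by auto
    have "\<exists>c. (\<forall>l\<in>{..<Suc (card M)}. c l \<in> \<theta> ` T) \<and> (\<exists>l\<in>{..<Suc (card M)}. c l \<notin> P j) \<and>
        (\<Sum>l\<in>{..<Suc (card M)}. c l * u ^ l) \<in> P j"
    proof (rule rspan_dependent[OF subring_endo_image[OF T \<theta>] ideal T _ M(2) _ one M(1)])
      show "\<theta> ` T \<subseteq> T" by (rule ST)
      then show "x \<in> P j \<or> y \<in> P j" if "x \<in> \<theta> ` T" "y \<in> \<theta> ` T" "x * y \<in> P j" for x y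
        using prime that by blast
      show "u ^ l \<in> rspan (\<theta> ` T) (P j) M" for l
        using M(3) subring_power[OF T uT, of l] ideal_zero[OF ideal]
        by (blast intro: rspan_mono)
    qed simp_all
    then obtain c where "\<forall>l<Suc (card M). c l \<in> \<theta> ` T" "\<exists>l<Suc (card M). c l \<notin> P j"
      "(\<Sum>l<Suc (card M). c l * u ^ l) \<in> P j"
      by (auto simp: lessThan_iff)
    then show ?thesis using transc by blast
  qed
qed

lemma ideal_chain_Union:
  assumes "C \<noteq> {}" "subset.chain {I. ideal_in T I \<and> J \<subseteq> I \<and> 1 \<notin> I} C"
  shows "ideal_in T (\<Union>C) \<and> J \<subseteq> \<Union>C \<and> 1 \<notin> \<Union>C"
proof -
  have C: "\<And>I. I \<in> C \<Longrightarrow> ideal_in T I \<and> J \<subseteq> I \<and> 1 \<notin> I"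
    and chain: "\<And>I I'. I \<in> C \<Longrightarrow> I' \<in> C \<Longrightarrow> I \<subseteq> I' \<or> I' \<subseteq> I"
    using assms(2) by (auto simp: subset.chain_def)
  have "a + b \<in> \<Union>C" if ab: "a \<in> \<Union>C" "b \<in> \<Union>C" for a b
  proof -
    obtain I I' where "I \<in> C" "a \<in> I" "I' \<in> C" "b \<in> I'" using ab by blast
    then show ?thesis using chain[of I I'] C ideal_add by (metis UnionI subsetD)
  qed
  moreover have "s * a \<in> \<Union>C" if sa: "s \<in> T" "a \<in> \<Union>C" for s a
  proof -
    obtain I where "I \<in> C" "a \<in> I" using sa by blast
    then show ?thesis using C[of I] ideal_mult[of T I s a] sa(1) by blast
  qed
  moreover obtain I0 where "I0 \<in> C" using assms(1) by blast
  then have "0 \<in> \<Union>C" "J \<subseteq> \<Union>C" using C[of I0] ideal_zero by blast+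
  moreover have "\<Union>C \<subseteq> T" "1 \<notin> \<Union>C" using C ideal_subset by blast+
  ultimately show ?thesis unfolding ideal_in_def by blast
qed

lemma exists_maximal_ideal:
  assumes T: "unital_subring T" and "ideal_in T J" "1 \<notin> J"
  obtains m where "ideal_in T m" "J \<subseteq> m" "1 \<notin> m"
    "\<And>a. a \<in> T \<Longrightarrow> a \<notin> m \<Longrightarrow> \<exists>r\<in>T. 1 - a * r \<in> m"
proof -
  let ?A = "{I. ideal_in T I \<and> J \<subseteq> I \<and> 1 \<notin> I}"
  have "\<exists>m\<in>?A. \<forall>X\<in>?A. m \<subseteq> X \<longrightarrow> X = m"
  proof (rule subset_Zorn_nonempty)
    show "?A \<noteq> {}" using assms by blast
    show "\<Union>C \<in> ?A" if "C \<noteq> {}" "subset.chain ?A C" for C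
      using ideal_chain_Union[OF that] by simp
  qed
  then obtain m where "m \<in> ?A" and maxA: "\<forall>X\<in>?A. m \<subseteq> X \<longrightarrow> X = m"
    by (rule bexE)
  then have m: "ideal_in T m" "J \<subseteq> m" "1 \<notin> m" by simp_all
  have max: "X = m" if "ideal_in T X" "J \<subseteq> X" "1 \<notin> X" "m \<subseteq> X" for X
    using maxA that by simp
  have "\<exists>r\<in>T. 1 - a * r \<in> m" if a: "a \<in> T" "a \<notin> m" for a
  proof (rule ccontr)
    assume neg: "\<not> ?thesis"
    let ?X = "{b + a * r | b r. b \<in> m \<and> r \<in> T}"
    have "ideal_in T ?X"
      unfolding ideal_in_def
    proof (intro conjI ballI)
      show "?X \<subseteq> T" using a ideal_subset[OF m(1)] by (auto intro!: subring_intros T)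
      show "0 \<in> ?X" using ideal_zero[OF m(1)] subring_zero[OF T] by force
      fix x y assume "x \<in> ?X" "y \<in> ?X"
      then obtain b r b' r' where "x = b + a * r" "y = b' + a * r'" "b \<in> m" "r \<in> T" "b' \<in> m" "r' \<in> T"
        by blast
      then show "x + y \<in> ?X"
        by (intro CollectI exI[of _ "b + b'"] exI[of _ "r + r'"])
          (auto simp: algebra_simps intro: ideal_add[OF m(1)] subring_add[OF T])
    next
      fix s x assume "s \<in> T" "x \<in> ?X"
      then obtain b r where "x = b + a * r" "b \<in> m" "r \<in> T" by blast
      moreover have "s * (b + a * r) = s * b + a * (s * r)" by (simp add: algebra_simps)
      ultimately show "s * x \<in> ?X" using \<open>s \<in> T\<close> ideal_mult[OF m(1)] subring_mult[OF T] by blast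
    qed
    moreover have mX: "m \<subseteq> ?X" using subring_zero[OF T] by force
    moreover have "1 \<notin> ?X"
    proof
      assume "1 \<in> ?X"
      then obtain b r where "1 = b + a * r" "b \<in> m" "r \<in> T" by blast
      moreover from this have "1 - a * r = b" by (metis add_diff_cancel_right')
      ultimately show False using neg by blast
    qed
    ultimately have "?X = m" using max m(2) by blast
    moreover have "a \<in> ?X" using ideal_zero[OF m(1)] subring_one[OF T] by force
    ultimately show False using a by simp
  qed
  then show ?thesis using that m by blast
qed

text \<open>
  The structure of an algebra over \<open>'k\<close> on a ring: a ring homomorphism from the field.
\<close>

definition scalar_embedding :: "('k::field \<Rightarrow> 'a::comm_ring_1) \<Rightarrow> bool" where
  "scalar_embedding \<iota> \<longleftrightarrow> \<iota> 1 = 1 \<and> (\<forall>a b. \<iota> (a - b) = \<iota> a - \<iota> b \<and> \<iota> (a * b) = \<iota> a * \<iota> b)"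

lemma scalar_embedding_zero: "scalar_embedding \<iota> \<Longrightarrow> \<iota> 0 = 0"
  unfolding scalar_embedding_def by (metis cancel_comm_monoid_add_class.diff_cancel)

lemma scalar_embedding_add:
  assumes "scalar_embedding \<iota>"
  shows "\<iota> (a + b) = \<iota> a + \<iota> b"
proof -
  have "\<iota> (a + b - b) = \<iota> (a + b) - \<iota> b" using assms unfolding scalar_embedding_def by blast
  then show ?thesis by (simp add: algebra_simps)
qed

lemma scalar_mem_maximal_ideal:
  assumes "scalar_embedding \<iota>" "ideal_in T m" "1 \<notin> m" "range \<iota> \<subseteq> T" "\<iota> c \<in> m"
  shows "c = 0"
proof (rule ccontr)
  assume "c \<noteq> 0"
  then have "\<iota> (inverse c) * \<iota> c = 1"
    using assms(1) unfolding scalar_embedding_def by (metis left_inverse)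
  then show False using ideal_mult[OF assms(2), of "\<iota> (inverse c)" "\<iota> c"] assms by auto
qed

definition poly_scalar :: "('k::field \<Rightarrow> 'a::comm_ring_1) \<Rightarrow> 'k poly \<Rightarrow> 'a \<Rightarrow> 'a" where
  "poly_scalar \<iota> p t = poly (map_poly \<iota> p) t"

lemma poly_scalar_pCons:
  assumes "scalar_embedding \<iota>"
  shows "poly_scalar \<iota> (pCons c p) t = \<iota> c + t * poly_scalar \<iota> p t"
  unfolding poly_scalar_def
  by (subst map_poly_pCons) (auto simp: scalar_embedding_zero[OF assms])

lemma poly_scalar_0: "poly_scalar \<iota> 0 t = 0"
  by (simp add: poly_scalar_def)

text \<open>
  Modulo a prime ideal, an element that satisfies a polynomial over an algebraically closed field is
  one of the roots of this polynomial.
\<close>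

lemma residue_field_algebraic:
  fixes \<iota> :: "'k::alg_closed_field \<Rightarrow> 'a::comm_ring_1"
  assumes T: "unital_subring T" and \<iota>: "scalar_embedding \<iota>" "range \<iota> \<subseteq> T"
    and m: "ideal_in T m" "1 \<notin> m"
    and prime: "\<And>a b. a \<in> T \<Longrightarrow> b \<in> T \<Longrightarrow> a * b \<in> m \<Longrightarrow> a \<in> m \<or> b \<in> m"
    and t: "t \<in> T"
  shows "p \<noteq> 0 \<Longrightarrow> poly_scalar \<iota> p t \<in> m \<Longrightarrow> \<exists>c. t - \<iota> c \<in> m"
proof (induction "degree p" arbitrary: p)
  case 0
  then obtain c where c: "p = [:c:]" by (metis degree_eq_zeroE)
  then have "\<iota> c \<in> m"
    using 0 by (simp add: poly_scalar_pCons[OF \<iota>(1)] poly_scalar_0)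
  then show ?case using scalar_mem_maximal_ideal[OF \<iota>(1) m \<iota>(2)] 0 c by auto
next
  case (Suc n p)
  then obtain z where "poly p z = 0" using alg_closed_imp_poly_has_root[of p] by auto
  then obtain q where q: "p = [:-z, 1:] * q" by (metis dvdE poly_eq_0_iff_dvd)
  have psT: "poly_scalar \<iota> r t \<in> T" for r
    by (induction r)
      (use \<iota> t in \<open>auto simp: poly_scalar_pCons[OF \<iota>(1)] poly_scalar_0 intro!: subring_intros T\<close>)
  have add: "poly_scalar \<iota> (r + s) t = poly_scalar \<iota> r t + poly_scalar \<iota> s t" for r s
    by (induction r s rule: poly_induct2)
      (auto simp: poly_scalar_pCons[OF \<iota>(1)] scalar_embedding_add[OF \<iota>(1)] algebra_simps
        poly_scalar_0)
  have sm: "poly_scalar \<iota> (smult c r) t = \<iota> c * poly_scalar \<iota> r t" for c r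
  proof (induction r)
    case 0
    then show ?case by (simp add: poly_scalar_0)
  next
    case (pCons a r)
    then show ?case using \<iota>(1)
      by (simp add: poly_scalar_pCons[OF \<iota>(1)] algebra_simps)
        (simp add: scalar_embedding_def)
  qed
  have "p = pCons 0 q + smult (- z) q" using q by simp
  then have "poly_scalar \<iota> p t = t * poly_scalar \<iota> q t + \<iota> (- z) * poly_scalar \<iota> q t"
    by (simp only: add sm poly_scalar_pCons[OF \<iota>(1)] scalar_embedding_zero[OF \<iota>(1)]) simp
  also have "\<iota> (- z) = - \<iota> z"
    using \<iota>(1) scalar_embedding_zero[OF \<iota>(1)] unfolding scalar_embedding_def by (metis diff_0)
  finally have eq: "poly_scalar \<iota> p t = (t - \<iota> z) * poly_scalar \<iota> q t"
    by (simp add: algebra_simps)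
  have "t - \<iota> z \<in> T" using t \<iota>(2) by (auto intro!: subring_intros T)
  then have "t - \<iota> z \<in> m \<or> poly_scalar \<iota> q t \<in> m"
    using prime psT Suc.prems(2) unfolding eq by blast
  moreover have "q \<noteq> 0" using q Suc.prems by auto
  moreover have "n = degree q"
    using Suc.hyps(2) \<open>q \<noteq> 0\<close> by (auto simp: q degree_mult_eq simp del: mult_pCons_left)
  ultimately show ?case using Suc.hyps(1) by blast
qed

text \<open>
  A character \<open>\<kappa>\<close> of \<open>T\<close>, carried over to \<open>\<theta> T\<close> through the injective \<open>\<theta>\<close>, extends to \<open>T\<close>. Its kernel
  \<open>K\<close> generates a proper ideal of \<open>T\<close> by Nakayama's lemma, because \<open>T\<close> is finite over \<open>\<theta> T\<close>. The
  residue field of a maximal ideal \<open>m\<close> above it is finite over the algebraically closed field, hence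
  equal to it. The extension is recorded through its kernel \<open>m\<close>.
\<close>

lemma extend_character:
  fixes \<iota> :: "'k::alg_closed_field \<Rightarrow> 'a::comm_ring_1"
  assumes T: "unital_subring T" and \<iota>: "scalar_embedding \<iota>" "range \<iota> \<subseteq> T"
    and \<theta>: "subring_endo T \<theta>" "\<And>c. \<theta> (\<iota> c) = \<iota> c" and inj: "\<And>a. a \<in> T \<Longrightarrow> \<theta> a = 0 \<Longrightarrow> a = 0"
    and M: "finite M" "M \<subseteq> T" "T \<subseteq> rspan (\<theta> ` T) {0} M"
    and \<kappa>: "\<kappa> 1 = 1" "\<And>c. \<kappa> (\<iota> c) = c"
      "\<And>a b. a \<in> T \<Longrightarrow> b \<in> T \<Longrightarrow> \<kappa> (a - b) = \<kappa> a - \<kappa> b"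
      "\<And>a b. a \<in> T \<Longrightarrow> b \<in> T \<Longrightarrow> \<kappa> (a * b) = \<kappa> a * \<kappa> b"
  obtains m where "ideal_in T m" "1 \<notin> m" "\<And>a. a \<in> T \<Longrightarrow> \<exists>c. a - \<iota> c \<in> m"
    "\<And>a. a \<in> T \<Longrightarrow> \<theta> a - \<iota> (\<kappa> a) \<in> m"
proof -
  let ?S = "\<theta> ` T"
  define K where "K = {\<theta> a | a. a \<in> T \<and> \<kappa> a = 0}"
  have \<iota>T: "\<iota> c \<in> T" for c by (rule subsetD[OF \<iota>(2) rangeI])
  have S: "unital_subring ?S" by (rule subring_endo_image[OF T \<theta>(1)])
  have ST: "?S \<subseteq> T" using subring_endoD(1)[OF \<theta>(1)] by (rule image_subsetI)
  have \<theta>inj: "a = b" if "a \<in> T" "b \<in> T" "\<theta> a = \<theta> b" for a b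
    using inj[OF subring_diff[OF T that(1,2)]] that(3) subring_endoD(3)[OF \<theta>(1) that(1,2)] by simp
  have K_iff: "\<theta> a \<in> K \<longleftrightarrow> \<kappa> a = 0" if "a \<in> T" for a
    unfolding K_def using that \<theta>inj by blast
  have \<kappa>0: "\<kappa> 0 = 0" using \<kappa>(3)[of 1 1] subring_one[OF T] by simp
  have \<kappa>add: "\<kappa> (a + b) = \<kappa> a + \<kappa> b" if "a \<in> T" "b \<in> T" for a b
    using \<kappa>(3)[of "a + b" b] that subring_add[OF T] by (simp add: algebra_simps)
  have K: "ideal_in ?S K"
    unfolding ideal_in_def
  proof (intro conjI ballI)
    show "K \<subseteq> ?S" by (auto simp: K_def)
    show "0 \<in> K" using K_iff[of 0] \<kappa>0 subring_zero[OF T] subring_endo_zero[OF T \<theta>(1)] by simp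
    fix x y assume "x \<in> K" "y \<in> K"
    then obtain a b where "a \<in> T" "b \<in> T" "x = \<theta> a" "y = \<theta> b" "\<kappa> a = 0" "\<kappa> b = 0"
      by (auto simp: K_def)
    then show "x + y \<in> K"
      using K_iff[of "a + b"] \<kappa>add subring_add[OF T] subring_endo_add[OF T \<theta>(1)] by simp
  next
    fix s x assume "s \<in> ?S" "x \<in> K"
    then obtain a b where "a \<in> T" "b \<in> T" "x = \<theta> a" "s = \<theta> b" "\<kappa> a = 0"
      by (auto simp: K_def)
    then show "s * x \<in> K"
      using K_iff[of "b * a"] \<kappa>(4) subring_mult[OF T] subring_endoD(4)[OF \<theta>(1)] by simp
  qed
  have Kprime: "x \<in> K \<or> y \<in> K" if xy: "x \<in> ?S" "y \<in> ?S" "x * y \<in> K" for x y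
  proof -
    obtain a b where ab: "a \<in> T" "b \<in> T" "x = \<theta> a" "y = \<theta> b" using xy by blast
    have "\<theta> (a * b) \<in> K" using xy(3) ab subring_endoD(4)[OF \<theta>(1), of a b] by simp
    then have "\<kappa> a * \<kappa> b = 0"
      using K_iff[of "a * b"] \<kappa>(4)[of a b] ab subring_mult[OF T, of a b] by simp
    then show ?thesis using K_iff ab by auto
  qed
  have oneK: "1 \<notin> K"
    using K_iff[of 1] \<kappa>(1) subring_one[OF T] subring_endoD(2)[OF \<theta>(1)] by simp
  define J where "J = rspan T {0} K"
  have add0: "a \<in> {0} \<Longrightarrow> b \<in> {0} \<Longrightarrow> a + b \<in> {0}" for a b :: 'a by simp
  have KT: "K \<subseteq> T" using ideal_subset[OF K] ST by blast
  have J: "ideal_in T J"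
    unfolding ideal_in_def
  proof (intro conjI ballI)
    show "J \<subseteq> T" unfolding J_def
      by (rule rspan_subset) (use KT in \<open>auto intro: subring_intros T\<close>)
    show "0 \<in> J" unfolding J_def by (rule rspan.base) simp
    show "a + b \<in> J" if "a \<in> J" "b \<in> J" for a b
      using that unfolding J_def by (intro rspan_add add0)
    show "s * a \<in> J" if "s \<in> T" "a \<in> J" for s a
      using that unfolding J_def by (intro rspan_scale[of "{0}" s "{0}" T T]) (auto intro: subring_mult[OF T])
  qed
  have JM: "J \<subseteq> rspan K {0} M"
    unfolding J_def
  proof (rule rspan_subset)
    show "{0} \<subseteq> rspan K {0} M" by (auto intro: rspan.base)
    show "a + b \<in> rspan K {0} M" if "a \<in> rspan K {0} M" "b \<in> rspan K {0} M" for a b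
      using that by (intro rspan_add add0)
    fix s x assume sx: "s \<in> T" "x \<in> K"
    then have "s \<in> rspan ?S {0} M" using M(3) by blast
    then have "x * s \<in> rspan K {0} M"
      using sx by (intro rspan_scale[of "{0}" x "{0}" ?S K]) (auto intro: ideal_mult[OF K] simp: mult.commute)
    then show "s * x \<in> rspan K {0} M" by (simp add: mult.commute)
  qed
  have oneJ: "1 \<notin> J"
  proof
    assume 1: "1 \<in> J"
    have "\<exists>u\<in>?S. u \<notin> K \<and> (\<forall>m\<in>M. u * m = 0)"
    proof (rule nakayama[OF S K Kprime M(1) subring_one[OF S] oneK])
      fix m assume "m \<in> M"
      then have "m * 1 \<in> J" using M(2) 1 by (intro ideal_mult[OF J]) auto
      then show "1 * m \<in> rspan K {0} M" using JM by auto
    qed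
    then obtain u where u: "u \<in> ?S" "u \<notin> K" "\<And>m. m \<in> M \<Longrightarrow> u * m = 0" by blast
    have "u * w = 0" if "w \<in> rspan ?S {0} M" for w
      using that by (induction rule: rspan.induct) (auto simp: distrib_left u(3) mult.left_commute[of u])
    then have "u * 1 = 0" using M(3) subring_one[OF T] by blast
    then show False using u(2) ideal_zero[OF K] by simp
  qed
  obtain m where m: "ideal_in T m" "J \<subseteq> m" "1 \<notin> m"
    and max: "\<And>a. a \<in> T \<Longrightarrow> a \<notin> m \<Longrightarrow> \<exists>r\<in>T. 1 - a * r \<in> m"
    using exists_maximal_ideal[OF T J oneJ] by blast
  have mprime: "a \<in> m \<or> b \<in> m" if ab: "a \<in> T" "b \<in> T" "a * b \<in> m" for a b
  proof (rule ccontr)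
    assume neg: "\<not> ?thesis"
    then obtain r where r: "r \<in> T" "1 - a * r \<in> m" using max[OF ab(1)] by blast
    have "b * (1 - a * r) + r * (a * b) \<in> m"
      by (rule ideal_add[OF m(1) ideal_mult[OF m(1) ab(2) r(2)] ideal_mult[OF m(1) r(1) ab(3)]])
    moreover have "b * (1 - a * r) + r * (a * b) = b" by (simp add: algebra_simps)
    ultimately have "b \<in> m" by simp
    then show False using neg by simp
  qed
  have Km: "\<theta> a - \<iota> (\<kappa> a) \<in> m" if "a \<in> T" for a
  proof -
    have "\<theta> a - \<iota> (\<kappa> a) = \<theta> (a - \<iota> (\<kappa> a))"
      using \<theta>(2) subring_endoD(3)[OF \<theta>(1) that \<iota>T] by simp
    also have "\<dots> \<in> K"
      using K_iff[of "a - \<iota> (\<kappa> a)"] that \<iota>T \<kappa> subring_diff[OF T] by simp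
    finally have x: "\<theta> a - \<iota> (\<kappa> a) \<in> K" .
    have "1 * (\<theta> a - \<iota> (\<kappa> a)) + 0 \<in> J"
      unfolding J_def using subring_one[OF T] x by (intro rspan.intros) auto
    then show ?thesis using m(2) by auto
  qed
  have addm: "a \<in> m \<Longrightarrow> b \<in> m \<Longrightarrow> a + b \<in> m" for a b using ideal_add[OF m(1)] .
  have span: "v \<in> rspan (range \<iota>) m M" if "v \<in> T" for v
  proof -
    have "v \<in> rspan ?S {0} M" using M(3) that by blast
    then show ?thesis
    proof (induction rule: rspan.induct)
      case (base p)
      then show ?case using ideal_zero[OF m(1)] by (auto intro: rspan.base)
    next
      case (step v s x)
      then obtain a where a: "a \<in> T" "s = \<theta> a" by blast
      have "\<iota> (\<kappa> a) * x + v \<in> rspan (range \<iota>) m M"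
        using step by (intro rspan.step) auto
      moreover have "x * (\<theta> a - \<iota> (\<kappa> a)) \<in> m"
        using Km[OF a(1)] M(2) step by (intro ideal_mult[OF m(1)]) auto
      ultimately have "(\<iota> (\<kappa> a) * x + v) + x * (\<theta> a - \<iota> (\<kappa> a)) \<in> rspan (range \<iota>) m M"
        using rspan_add[OF addm _ rspan.base] by metis
      then show ?case using a by (simp add: algebra_simps)
    qed
  qed
  have \<iota>sub: "unital_subring (range \<iota>)"
    unfolding unital_subring_def
  proof (intro conjI ballI)
    show "1 \<in> range \<iota>" using \<iota>(1) unfolding scalar_embedding_def by (metis rangeI)
    fix a b assume "a \<in> range \<iota>" "b \<in> range \<iota>"
    then obtain x y where "a = \<iota> x" "b = \<iota> y" by blast
    then have "a - b = \<iota> (x - y)" "a * b = \<iota> (x * y)"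
      using \<iota>(1) unfolding scalar_embedding_def by simp_all
    then show "a - b \<in> range \<iota>" "a * b \<in> range \<iota>" by simp_all
  qed
  have "\<exists>c. t - \<iota> c \<in> m" if t: "t \<in> T" for t
  proof -
    let ?J = "{..<Suc (card M)}"
    have "\<exists>c. (\<forall>l\<in>?J. c l \<in> range \<iota>) \<and> (\<exists>l\<in>?J. c l \<notin> m) \<and> (\<Sum>l\<in>?J. c l * t ^ l) \<in> m"
    proof (rule rspan_dependent[OF \<iota>sub m(1) T \<iota>(2) M(2) _ m(3) M(1)])
      show "x \<in> m \<or> y \<in> m" if "x \<in> range \<iota>" "y \<in> range \<iota>" "x * y \<in> m" for x y
        using mprime that \<iota>T by blast
      show "t ^ l \<in> rspan (range \<iota>) m M" for l
        by (rule span) (rule subring_power[OF T t])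
    qed simp_all
    then obtain c where c: "\<And>l. l \<in> ?J \<Longrightarrow> c l \<in> range \<iota>" "\<exists>l\<in>?J. c l \<notin> m"
      "(\<Sum>l\<in>?J. c l * t ^ l) \<in> m"
      by blast
    then have "\<forall>l. \<exists>d. l \<in> ?J \<longrightarrow> c l = \<iota> d" by blast
    then obtain d where d: "\<And>l. l \<in> ?J \<Longrightarrow> c l = \<iota> (d l)" by metis
    define p where "p = (\<Sum>l\<in>?J. monom (d l) l)"
    have coeff: "coeff p l = (if l \<in> ?J then d l else 0)" for l
      unfolding p_def by (simp add: coeff_sum del: sum.lessThan_Suc)
    obtain l where l: "l \<in> ?J" "c l \<notin> m" using c(2) by blast
    have "d l \<noteq> 0" using l d scalar_embedding_zero[OF \<iota>(1)] ideal_zero[OF m(1)] by auto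
    then have "p \<noteq> 0" using coeff[of l] l by auto
    moreover have "poly_scalar \<iota> p t \<in> m"
    proof -
      have cm: "coeff (map_poly \<iota> p) l = (if l \<in> ?J then c l else 0)" for l
        by (subst coeff_map_poly) (use coeff d scalar_embedding_zero[OF \<iota>(1)] in auto)
      then have "degree (map_poly \<iota> p) \<le> card M"
        by (intro degree_le) auto
      then have "poly_scalar \<iota> p t = (\<Sum>l\<le>card M. coeff (map_poly \<iota> p) l * t ^ l)"
        unfolding poly_scalar_def poly_altdef
        by (intro sum.mono_neutral_left) (auto simp: coeff_eq_0)
      also have "\<dots> = (\<Sum>l\<in>?J. c l * t ^ l)"
        by (intro sum.cong) (auto simp: cm)
      finally show ?thesis using c(3) by simp
    qed
    ultimately show ?thesis
      using residue_field_algebraic[OF T \<iota> m(1,3) mprime t] by blast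
  qed
  then show ?thesis using that[OF m(1,3)] Km by blast
qed

section \<open>Regular functions and the Zariski topology\<close>

lemma affine_variety_const:
  assumes "affine_variety X R"
  shows "restrict (\<lambda>x. c) X \<in> R"
proof -
  obtain n \<phi> where R: "R = {restrict (\<lambda>x. p (\<phi> x)) X | p. p \<in> poly_funs n}"
    using assms(1) unfolding affine_variety_def by blast
  show ?thesis
    unfolding R by (intro CollectI exI[of _ "\<lambda>v. c"]) (simp add: poly_funs.const)
qed

lemma affine_variety_add:
  assumes "affine_variety X R" "f \<in> R" "g \<in> R"
  shows "restrict (\<lambda>x. f x + g x) X \<in> R"
proof -
  obtain n \<phi> where R: "R = {restrict (\<lambda>x. p (\<phi> x)) X | p. p \<in> poly_funs n}"
    using assms(1) unfolding affine_variety_def by blast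
  obtain p r where "p \<in> poly_funs n" "f = restrict (\<lambda>x. p (\<phi> x)) X"
    "r \<in> poly_funs n" "g = restrict (\<lambda>x. r (\<phi> x)) X"
    using assms(2,3) unfolding R by blast
  then have "restrict (\<lambda>x. f x + g x) X = restrict (\<lambda>x. (\<lambda>v. p v + r v) (\<phi> x)) X"
    and "(\<lambda>v. p v + r v) \<in> poly_funs n"
    by (auto intro: poly_funs.add)
  then show ?thesis
    unfolding R by (intro CollectI exI[of _ "\<lambda>v. p v + r v"]) simp
qed

lemma affine_variety_separates:
  assumes "affine_variety X R" "x \<in> X" "y \<in> X" "\<And>f. f \<in> R \<Longrightarrow> f x = f y"
  shows "x = y"
proof -
  obtain n \<phi> where inj: "inj_on \<phi> X" and alg: "algebraic_set n (\<phi> ` X)"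
    and R: "R = {restrict (\<lambda>x. p (\<phi> x)) X | p. p \<in> poly_funs n}"
    using assms(1) unfolding affine_variety_def by blast
  have "\<phi> ` X \<subseteq> affine_space n" using alg unfolding algebraic_set_def by auto
  then have ext: "\<phi> x \<in> affine_space n" "\<phi> y \<in> affine_space n" using assms by auto
  have "\<phi> x i = \<phi> y i" for i
  proof (cases "i < n")
    case True
    then have "restrict (\<lambda>x. \<phi> x i) X \<in> R" unfolding R
      by (intro CollectI exI[of _ "\<lambda>v. v i"]) (auto intro: poly_funs.coord)
    then show ?thesis using assms(4)[of "restrict (\<lambda>x. \<phi> x i) X"] assms(2,3) by simp
  next
    case False
    then show ?thesis using ext unfolding affine_space_def by (auto simp: PiE_def extensional_def)
  qed
  then have "\<phi> x = \<phi> y" by blast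
  then show ?thesis using inj assms(2,3) by (auto dest: inj_onD)
qed

definition regular_on :: "('g \<Rightarrow> 'k::field) set \<Rightarrow> 'g set \<Rightarrow> ('g \<Rightarrow> 'k) \<Rightarrow> bool" where
  "regular_on R Y f \<longleftrightarrow> (\<exists>g\<in>R. \<forall>x\<in>Y. f x = g x)"

text \<open>
  Regularity on \<open>Y\<close> is agreement with a regular function on \<open>X\<close>, which is the induced structure when
  \<open>Y\<close> is closed. This allows morphisms on a subgroup without turning it into a variety of its own.
\<close>

definition morphism_on :: "'g set \<Rightarrow> ('g \<Rightarrow> 'k::field) set \<Rightarrow> 'g set \<Rightarrow> ('g \<Rightarrow> 'g) \<Rightarrow> bool" where
  "morphism_on X R Y \<phi> \<longleftrightarrow> \<phi> ` Y \<subseteq> X \<and> (\<forall>f\<in>R. regular_on R Y (\<lambda>x. f (\<phi> x)))"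

lemma regular_on_self: "f \<in> R \<Longrightarrow> regular_on R Y f"
  by (auto simp: regular_on_def)

lemma regular_on_cong: "(\<And>x. x \<in> Y \<Longrightarrow> f x = g x) \<Longrightarrow> regular_on R Y f \<longleftrightarrow> regular_on R Y g"
  by (auto simp: regular_on_def)

context
  fixes X :: "'g set" and R :: "('g \<Rightarrow> 'k::field) set" and Y
  assumes var: "affine_variety X R" and YX: "Y \<subseteq> X"
begin

lemma regular_on_const: "regular_on R Y (\<lambda>x. c)"
  using affine_variety_const[OF var, of c] YX unfolding regular_on_def
  by (intro bexI[of _ "restrict (\<lambda>x. c) X"]) auto

lemma regular_on_add:
  assumes "regular_on R Y f" "regular_on R Y g"
  shows "regular_on R Y (\<lambda>x. f x + g x)"
proof -
  obtain f' g' where "f' \<in> R" "g' \<in> R" "\<forall>x\<in>Y. f x = f' x" "\<forall>x\<in>Y. g x = g' x"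
    using assms unfolding regular_on_def by blast
  then show ?thesis
    using affine_variety_add[OF var] YX unfolding regular_on_def
    by (intro bexI[of _ "restrict (\<lambda>x. f' x + g' x) X"]) auto
qed

lemma regular_on_mult:
  assumes "regular_on R Y f" "regular_on R Y g"
  shows "regular_on R Y (\<lambda>x. f x * g x)"
proof -
  obtain f' g' where "f' \<in> R" "g' \<in> R" "\<forall>x\<in>Y. f x = f' x" "\<forall>x\<in>Y. g x = g' x"
    using assms unfolding regular_on_def by blast
  then show ?thesis
    using affine_variety_mult[OF var] YX unfolding regular_on_def
    by (intro bexI[of _ "restrict (\<lambda>x. f' x * g' x) X"]) auto
qed

lemma regular_on_diff:
  assumes "regular_on R Y f" "regular_on R Y g"
  shows "regular_on R Y (\<lambda>x. f x - g x)"
  using regular_on_add[OF assms(1) regular_on_mult[OF regular_on_const[of "- 1"] assms(2)]] by simp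

lemma regular_on_sum:
  assumes "\<And>i. i \<in> I \<Longrightarrow> regular_on R Y (f i)"
  shows "regular_on R Y (\<lambda>x. \<Sum>i\<in>I. f i x)"
  using assms
  by (induction I rule: infinite_finite_induct) (auto intro: regular_on_const regular_on_add)

lemma morphism_on_id: "morphism_on X R Y (\<lambda>x. x)"
  using YX regular_on_self unfolding morphism_on_def by blast

lemma morphism_on_const: "c \<in> X \<Longrightarrow> morphism_on X R Y (\<lambda>x. c)"
  using regular_on_const unfolding morphism_on_def by auto

end

lemma regular_map_iff_morphism_on:
  assumes "affine_variety X R"
  shows "regular_map X R X R \<phi> \<longleftrightarrow> morphism_on X R X \<phi>"
proof -
  have ext: "\<exists>p. g = restrict p X" if "g \<in> R" for g
    using assms that unfolding affine_variety_def by blast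
  have "restrict (\<lambda>x. f (\<phi> x)) X \<in> R \<longleftrightarrow> regular_on R X (\<lambda>x. f (\<phi> x))" for f
  proof
    assume "regular_on R X (\<lambda>x. f (\<phi> x))"
    then obtain g where g: "g \<in> R" "\<forall>x\<in>X. f (\<phi> x) = g x" unfolding regular_on_def by blast
    then have "restrict (\<lambda>x. f (\<phi> x)) X = g" using ext[OF g(1)] by (auto simp: restrict_def fun_eq_iff)
    then show "restrict (\<lambda>x. f (\<phi> x)) X \<in> R" using g by simp
  next
    assume "restrict (\<lambda>x. f (\<phi> x)) X \<in> R"
    then show "regular_on R X (\<lambda>x. f (\<phi> x))"
      unfolding regular_on_def by (rule bexI[rotated]) simp
  qed
  then show ?thesis unfolding regular_map_def morphism_on_def by blast
qed

lemma morphism_on_compose: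
  assumes "morphism_on X R Y \<phi>" "morphism_on X R Z \<psi>" "\<phi> ` Y \<subseteq> Z"
  shows "morphism_on X R Y (\<lambda>x. \<psi> (\<phi> x))"
  unfolding morphism_on_def
proof (intro conjI ballI)
  show "(\<lambda>x. \<psi> (\<phi> x)) ` Y \<subseteq> X" using assms unfolding morphism_on_def by blast
  fix f assume "f \<in> R"
  then obtain g where g: "g \<in> R" "\<forall>x\<in>Z. f (\<psi> x) = g x"
    using assms(2) unfolding morphism_on_def regular_on_def by blast
  obtain h where "h \<in> R" "\<forall>x\<in>Y. g (\<phi> x) = h x"
    using assms(1) g(1) unfolding morphism_on_def regular_on_def by blast
  then show "regular_on R Y (\<lambda>x. f (\<psi> (\<phi> x)))"
    unfolding regular_on_def using g(2) assms(3) by (intro bexI[of _ h]) auto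
qed

lemma regular_on_subset: "regular_on R Y f \<Longrightarrow> Z \<subseteq> Y \<Longrightarrow> regular_on R Z f"
  unfolding regular_on_def by (elim bexE) (rule bexI, auto)

lemma morphism_on_subset: "morphism_on X R Y \<phi> \<Longrightarrow> Z \<subseteq> Y \<Longrightarrow> morphism_on X R Z \<phi>"
  unfolding morphism_on_def by (auto intro: regular_on_subset)

lemma continuous_map_morphism:
  assumes var: "affine_variety X R" and \<phi>: "morphism_on X R X \<phi>"
  shows "continuous_map (zariski X R) (zariski X R) \<phi>"
  unfolding continuous_map_closedin topspace_zariski[OF var]
proof (intro conjI allI impI)
  show "\<phi> \<in> X \<rightarrow> X" using \<phi> unfolding morphism_on_def by blast
  fix C assume "closedin (zariski X R) C"
  then obtain S where S: "S \<subseteq> R" "C = {x \<in> X. \<forall>f \<in> S. f x = 0}"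
    unfolding closedin_zariski[OF var] by blast
  have "restrict (\<lambda>x. f (\<phi> x)) X \<in> R" if "f \<in> R" for f
    using \<phi> that unfolding regular_map_iff_morphism_on[OF var, symmetric] regular_map_def by blast
  then have "(\<lambda>f. restrict (\<lambda>x. f (\<phi> x)) X) ` S \<subseteq> R" using S(1) by blast
  moreover have "{x \<in> X. \<phi> x \<in> C} = {x \<in> X. \<forall>f \<in> (\<lambda>f. restrict (\<lambda>x. f (\<phi> x)) X) ` S. f x = 0}"
    using \<phi> unfolding S(2) morphism_on_def by auto
  ultimately show "closedin (zariski X R) {x \<in> X. \<phi> x \<in> C}"
    unfolding closedin_zariski[OF var] by blast
qed

section \<open>Linear algebraic groups and their identity components\<close>

context linear_algebraic_group
begin

abbreviation morph :: "'g set \<Rightarrow> ('g \<Rightarrow> 'g) \<Rightarrow> bool" where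
  "morph Y \<phi> \<equiv> morphism_on (carrier G) (regular G) Y \<phi>"

lemma comultiplication:
  assumes "f \<in> regular G"
  obtains r u v where "\<forall>i<(r::nat). u i \<in> regular G" "\<forall>i<r. v i \<in> regular G"
    "\<forall>x\<in>carrier G. \<forall>y\<in>carrier G. f (x \<otimes> y) = (\<Sum>i<r. u i x * v i y)"
proof -
  let ?h = "restrict (\<lambda>p. f ((\<lambda>(x, y). x \<otimes> y) p)) (carrier G \<times> carrier G)"
  have "?h \<in> prod_regular (carrier G) (regular G) (carrier G) (regular G)"
    using regular_mult assms unfolding regular_map_def by blast
  then obtain r u v where eq: "?h = restrict (\<lambda>(x, y). \<Sum>i<(r::nat). u i x * v i y) (carrier G \<times> carrier G)"
    and uv: "\<forall>i<r. u i \<in> regular G" "\<forall>i<r. v i \<in> regular G"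
    unfolding prod_regular_def by blast
  have "f (x \<otimes> y) = (\<Sum>i<r. u i x * v i y)" if "x \<in> carrier G" "y \<in> carrier G" for x y
    using fun_cong[OF eq, of "(x, y)"] that by simp
  then have "\<forall>x\<in>carrier G. \<forall>y\<in>carrier G. f (x \<otimes> y) = (\<Sum>i<r. u i x * v i y)" by simp
  then show ?thesis by (rule that[OF uv])
qed

lemma morph_mult:
  assumes Y: "Y \<subseteq> carrier G" and "morph Y \<phi>" "morph Y \<psi>"
  shows "morph Y (\<lambda>x. \<phi> x \<otimes> \<psi> x)"
  unfolding morphism_on_def
proof (intro conjI ballI)
  have mem: "\<phi> x \<in> carrier G" "\<psi> x \<in> carrier G" if "x \<in> Y" for x
    using assms that unfolding morphism_on_def by auto
  then show "(\<lambda>x. \<phi> x \<otimes> \<psi> x) ` Y \<subseteq> carrier G" by auto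
  fix f assume "f \<in> regular G"
  then obtain r u v where uv: "\<forall>i<(r::nat). u i \<in> regular G" "\<forall>i<r. v i \<in> regular G"
    and f: "\<forall>x\<in>carrier G. \<forall>y\<in>carrier G. f (x \<otimes> y) = (\<Sum>i<r. u i x * v i y)"
    by (rule comultiplication)
  have "regular_on (regular G) Y (\<lambda>x. \<Sum>i<r. u i (\<phi> x) * v i (\<psi> x))"
    using assms(2,3) uv unfolding morphism_on_def
    by (intro regular_on_sum[OF variety Y] regular_on_mult[OF variety Y]) auto
  then show "regular_on (regular G) Y (\<lambda>x. f (\<phi> x \<otimes> \<psi> x))"
    by (rule iffD1[OF regular_on_cong, rotated]) (simp add: f mem)
qed

lemma morph_inv: "Y \<subseteq> carrier G \<Longrightarrow> morph Y \<phi> \<Longrightarrow> morph Y (\<lambda>x. inv (\<phi> x))"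
  using regular_inv unfolding regular_map_iff_morphism_on[OF variety]
  by (rule morphism_on_compose[rotated]) (auto simp: morphism_on_def)

lemmas morph_intros = morph_mult morph_inv morphism_on_id[OF variety] morphism_on_const[OF variety]

lemma connected_image:
  assumes "morph (carrier G) \<phi>" "connectedin (group_zariski G) S"
  shows "connectedin (group_zariski G) (\<phi> ` S)"
  using connectedin_continuous_map_image[OF continuous_map_morphism[OF variety assms(1)] assms(2)] .

lemma morph_conjugate: "g \<in> carrier G \<Longrightarrow> Y \<subseteq> carrier G \<Longrightarrow> morph Y (conjugate G g)"
  unfolding conjugate_def by (intro morph_intros) auto

lemma identity_component_connected:
  assumes "C \<subseteq> carrier G"
  shows "connectedin (group_zariski G) (identity_component G C)"
  using connectedin_connected_component_of[of "subtopology (group_zariski G) C" \<one>]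
  unfolding identity_component_def connectedin_subtopology by simp

lemma identity_component_subset:
  assumes "C \<subseteq> carrier G"
  shows "identity_component G C \<subseteq> C"
  using connected_component_of_subset_topspace[of "subtopology (group_zariski G) C" \<one>]
  unfolding identity_component_def by auto

lemma one_identity_component:
  assumes "C \<subseteq> carrier G" "\<one> \<in> C"
  shows "\<one> \<in> identity_component G C"
  using assms unfolding identity_component_def
  by (simp add: connected_component_of_refl topspace_zariski[OF variety])

lemma identity_component_maximal:
  assumes "S \<subseteq> C" "connectedin (group_zariski G) S" "x \<in> S" "x \<in> identity_component G C"
  shows "S \<subseteq> identity_component G C"
proof -
  let ?X = "subtopology (group_zariski G) C"
  have S: "connectedin ?X S" using assms unfolding connectedin_subtopology by simp
  have eq: "connected_component_of_set ?X x = connected_component_of_set ?X \<one>"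
    using assms(4) unfolding identity_component_def
    by (metis connected_component_of_equiv mem_Collect_eq)
  show ?thesis
    using connected_component_of_maximal[OF S assms(3)] unfolding identity_component_def eq .
qed

text \<open>
  The image of a component is connected, so one common point suffices to place it in the target
  component. Stability of the identity component under translation by its own elements,
  under conjugation and under \<open>F\<close> are all instances.
\<close>

lemma identity_component_image:
  assumes C: "C \<subseteq> carrier G" "C' \<subseteq> carrier G" and \<phi>: "morph (carrier G) \<phi>" "\<phi> ` C \<subseteq> C'"
    and x: "x \<in> identity_component G C" "\<phi> x \<in> identity_component G C'"
  shows "\<phi> ` identity_component G C \<subseteq> identity_component G C'"
  using identity_component_maximal[OF _ connected_image[OF \<phi>(1) identity_component_connected[OF C(1)]] _ x(2)]
    x(1) \<phi>(2) identity_component_subset[OF C(1)] by blast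

lemma identity_component_subgroup:
  assumes "subgroup C G"
  shows "subgroup (identity_component G C) G"
proof -
  note C = subgroup.subset[OF assms]
  note sub = identity_component_subset[OF C]
  have one: "\<one> \<in> identity_component G C"
    using one_identity_component[OF C subgroup.one_closed[OF assms]] .
  have *: "inv a \<otimes> b \<in> identity_component G C"
    if ab: "a \<in> identity_component G C" "b \<in> identity_component G C" for a b
  proof -
    have aC: "a \<in> C" "a \<in> carrier G" using ab sub C by auto
    have "(\<lambda>x. inv a \<otimes> x) ` identity_component G C \<subseteq> identity_component G C"
    proof (rule identity_component_image[OF C C _ _ ab(1)])
      show "morph (carrier G) (\<lambda>x. inv a \<otimes> x)" using aC by (intro morph_intros) auto
      show "(\<lambda>x. inv a \<otimes> x) ` C \<subseteq> C"
        using aC subgroup.m_closed[OF assms] subgroup.m_inv_closed[OF assms] by blast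
      show "inv a \<otimes> a \<in> identity_component G C" using aC one by simp
    qed
    then show ?thesis using ab by blast
  qed
  have inv: "inv a \<in> identity_component G C" if "a \<in> identity_component G C" for a
    using *[OF that one] that sub C by auto
  show ?thesis
  proof (rule subgroupI)
    show "identity_component G C \<subseteq> carrier G" using sub C by blast
    show "identity_component G C \<noteq> {}" using one by blast
    show "inv a \<in> identity_component G C" if "a \<in> identity_component G C" for a by (rule inv[OF that])
    show "a \<otimes> b \<in> identity_component G C"
      if "a \<in> identity_component G C" "b \<in> identity_component G C" for a b
      using *[OF inv[OF that(1)] that(2)] that sub C by (metis inv_inv subsetD)
  qed
qed

lemma identity_component_closed:
  assumes "closedin (group_zariski G) C"
  shows "closedin (group_zariski G) (identity_component G C)"
  using closedin_trans_full[OF closedin_connected_component_of assms]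
  unfolding identity_component_def .

lemma centralizer_subgroup:
  assumes "A \<subseteq> carrier G"
  shows "subgroup (centralizer G A) G"
proof (rule subgroupI)
  show "centralizer G A \<subseteq> carrier G" unfolding centralizer_def by auto
  have "\<one> \<in> centralizer G A" using assms unfolding centralizer_def by auto
  then show "centralizer G A \<noteq> {}" by blast
  fix a assume a: "a \<in> centralizer G A"
  have "inv a \<otimes> x = x \<otimes> inv a" if x: "x \<in> A" for x
  proof -
    have mem: "a \<in> carrier G" "x \<in> carrier G" and comm: "a \<otimes> x = x \<otimes> a"
      using a x assms unfolding centralizer_def by auto
    have "inv a \<otimes> x = inv a \<otimes> (x \<otimes> a) \<otimes> inv a" using mem by (simp add: m_assoc)
    also have "\<dots> = x \<otimes> inv a" using mem by (simp add: m_assoc[symmetric] flip: comm)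
    finally show ?thesis .
  qed
  then show "inv a \<in> centralizer G A" using a unfolding centralizer_def by auto
  fix b assume b: "b \<in> centralizer G A"
  have "a \<otimes> b \<otimes> x = x \<otimes> (a \<otimes> b)" if x: "x \<in> A" for x
  proof -
    have "a \<in> carrier G" "b \<in> carrier G" "x \<in> carrier G" "a \<otimes> x = x \<otimes> a" "b \<otimes> x = x \<otimes> b"
      using a b x assms unfolding centralizer_def by auto
    then show ?thesis by (metis m_assoc)
  qed
  then show "a \<otimes> b \<in> centralizer G A" using a b unfolding centralizer_def by auto
qed

text \<open>
  The condition \<open>x a = a x\<close> can be tested on regular functions, since these separate points.
\<close>

lemma centralizer_closed:
  assumes "A \<subseteq> carrier G"
  shows "closedin (group_zariski G) (centralizer G A)"
proof -
  let ?S = "{restrict (\<lambda>x. f (x \<otimes> a) - f (a \<otimes> x)) (carrier G) | f a. f \<in> regular G \<and> a \<in> A}"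
  have "?S \<subseteq> regular G"
  proof clarify
    fix f a assume fa: "f \<in> regular G" "a \<in> A"
    then have a: "a \<in> carrier G" using assms by blast
    have "morph (carrier G) (\<lambda>x. x \<otimes> a)" "morph (carrier G) (\<lambda>x. a \<otimes> x)"
      using a by (auto intro!: morph_intros)
    then have "regular_on (regular G) (carrier G) (\<lambda>x. f (x \<otimes> a) - f (a \<otimes> x))"
      using fa unfolding morphism_on_def by (intro regular_on_diff[OF variety]) auto
    then obtain g where g: "g \<in> regular G" "\<forall>x\<in>carrier G. f (x \<otimes> a) - f (a \<otimes> x) = g x"
      unfolding regular_on_def by blast
    moreover obtain p where "g = restrict p (carrier G)"
      using g variety unfolding affine_variety_def by blast
    ultimately have "restrict (\<lambda>x. f (x \<otimes> a) - f (a \<otimes> x)) (carrier G) = g"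
      by (auto simp: restrict_def fun_eq_iff)
    then show "restrict (\<lambda>x. f (x \<otimes> a) - f (a \<otimes> x)) (carrier G) \<in> regular G" using g by simp
  qed
  moreover have "centralizer G A = {x \<in> carrier G. \<forall>h \<in> ?S. h x = 0}"
  proof (intro Set.set_eqI iffI)
    fix x assume "x \<in> centralizer G A"
    then show "x \<in> {x \<in> carrier G. \<forall>h \<in> ?S. h x = 0}" unfolding centralizer_def by auto
  next
    fix x assume x: "x \<in> {x \<in> carrier G. \<forall>h \<in> ?S. h x = 0}"
    have "x \<otimes> a = a \<otimes> x" if a: "a \<in> A" for a
    proof (rule affine_variety_separates[OF variety])
      show "x \<otimes> a \<in> carrier G" "a \<otimes> x \<in> carrier G" using x a assms by auto
      fix f assume "f \<in> regular G"
      then have "restrict (\<lambda>x. f (x \<otimes> a) - f (a \<otimes> x)) (carrier G) \<in> ?S" using a by blast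
      then have "restrict (\<lambda>x. f (x \<otimes> a) - f (a \<otimes> x)) (carrier G) x = 0" using x by blast
      then show "f (x \<otimes> a) = f (a \<otimes> x)" using x by simp
    qed
    then show "x \<in> centralizer G A" using x unfolding centralizer_def by auto
  qed
  ultimately show ?thesis unfolding closedin_zariski[OF variety] by blast
qed

end

section \<open>Rings of polynomial functions\<close>

lemma noetherian_field:
  fixes \<iota> :: "'k::field \<Rightarrow> 'a::comm_ring_1"
  assumes "scalar_embedding \<iota>"
  shows "noetherian (range \<iota>)"
  unfolding noetherian_def
proof (intro allI impI, elim conjE)
  fix I :: "nat \<Rightarrow> 'a set"
  assume I: "\<forall>i. ideal_in (range \<iota>) (I i)" and inc: "\<forall>i. I i \<subseteq> I (Suc i)"
  have triv: "I i = {0} \<or> I i = range \<iota>" for i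
  proof (cases "1 \<in> I i")
    case True
    have "s \<in> I i" if "s \<in> range \<iota>" for s
      using ideal_mult[OF I[rule_format] that True] by simp
    then show ?thesis using ideal_subset[OF I[rule_format]] by blast
  next
    case False
    have "x = 0" if x: "x \<in> I i" for x
    proof -
      obtain c where c: "x = \<iota> c" using ideal_subset[OF I[rule_format] x] by blast
      then have "c = 0"
        using scalar_mem_maximal_ideal[OF assms I[rule_format] False order_refl] x by simp
      then show ?thesis using c scalar_embedding_zero[OF assms] by simp
    qed
    then show ?thesis using ideal_zero[OF I[rule_format]] by blast
  qed
  have mono: "I i \<subseteq> I j" if "i \<le> j" for i j
    by (rule lift_Suc_mono_le[of I, OF inc[rule_format] that])
  show "\<exists>N. \<forall>j\<ge>N. I j = I N"
  proof (cases "\<exists>N. I N = range \<iota>")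
    case True
    then obtain N where N: "I N = range \<iota>" by blast
    have "I j = I N" if "j \<ge> N" for j
      using mono[OF that] N ideal_subset[OF I[rule_format], of _ j] by blast
    then show ?thesis by blast
  next
    case False
    then have "I j = I 0" for j using triv by metis
    then show ?thesis by blast
  qed
qed

lemma sum_fun_apply: "(\<Sum>i\<in>I. f i) x = (\<Sum>i\<in>I. f i x)" for f :: "'i \<Rightarrow> 'b \<Rightarrow> 'c::comm_monoid_add"
  by (induction I rule: infinite_finite_induct) auto

lemma power_fun_apply: "(f ^ n) x = f x ^ n" for f :: "'b \<Rightarrow> 'c::comm_ring_1"
  by (induction n) auto

definition poly_funs_at :: "('g \<Rightarrow> nat \<Rightarrow> 'k::field) \<Rightarrow> nat \<Rightarrow> ('g \<Rightarrow> 'k) set" where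
  "poly_funs_at \<psi> n = {\<lambda>x. p (\<psi> x) | p. p \<in> poly_funs n}"

lemma poly_funs_at_induct [consumes 1, case_names const coord add mult]:
  assumes "f \<in> poly_funs_at \<psi> n"
    and "\<And>c. P (\<lambda>_. c)" "\<And>i. i < n \<Longrightarrow> P (\<lambda>x. \<psi> x i)"
    and "\<And>f g. f \<in> poly_funs_at \<psi> n \<Longrightarrow> g \<in> poly_funs_at \<psi> n \<Longrightarrow> P f \<Longrightarrow> P g \<Longrightarrow> P (f + g)"
    and "\<And>f g. f \<in> poly_funs_at \<psi> n \<Longrightarrow> g \<in> poly_funs_at \<psi> n \<Longrightarrow> P f \<Longrightarrow> P g \<Longrightarrow> P (f * g)"
  shows "P f"
proof -
  obtain p where p: "p \<in> poly_funs n" "f = (\<lambda>x. p (\<psi> x))"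
    using assms(1) unfolding poly_funs_at_def by blast
  have mem: "(\<lambda>x. q (\<psi> x)) \<in> poly_funs_at \<psi> n" if "q \<in> poly_funs n" for q
    using that unfolding poly_funs_at_def by blast
  from p(1) have "P (\<lambda>x. p (\<psi> x))"
  proof (induction rule: poly_funs.induct)
    case (add p r)
    then show ?case using assms(4)[OF mem mem, of p r] by (simp add: plus_fun_def)
  next
    case (mult p r)
    then show ?case using assms(5)[OF mem mem, of p r] by (simp add: times_fun_def)
  qed (use assms in auto)
  then show ?thesis using p by simp
qed

lemma poly_funs_at_intros:
  "(\<lambda>_. c) \<in> poly_funs_at \<psi> n"
  "i < n \<Longrightarrow> (\<lambda>x. \<psi> x i) \<in> poly_funs_at \<psi> n"
  "f \<in> poly_funs_at \<psi> n \<Longrightarrow> g \<in> poly_funs_at \<psi> n \<Longrightarrow> f + g \<in> poly_funs_at \<psi> n"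
  "f \<in> poly_funs_at \<psi> n \<Longrightarrow> g \<in> poly_funs_at \<psi> n \<Longrightarrow> f * g \<in> poly_funs_at \<psi> n"
proof -
  show "(\<lambda>_. c) \<in> poly_funs_at \<psi> n"
    unfolding poly_funs_at_def by (intro CollectI exI[of _ "\<lambda>_. c"]) (simp add: poly_funs.const)
  show "(\<lambda>x. \<psi> x i) \<in> poly_funs_at \<psi> n" if "i < n"
    unfolding poly_funs_at_def
    by (intro CollectI exI[of _ "\<lambda>v. v i"]) (simp add: poly_funs.coord that)
  assume "f \<in> poly_funs_at \<psi> n" "g \<in> poly_funs_at \<psi> n"
  then obtain p r where "p \<in> poly_funs n" "f = (\<lambda>x. p (\<psi> x))" "r \<in> poly_funs n" "g = (\<lambda>x. r (\<psi> x))"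
    unfolding poly_funs_at_def by blast
  then have "f + g = (\<lambda>x. (\<lambda>v. p v + r v) (\<psi> x))" "(\<lambda>v. p v + r v) \<in> poly_funs n"
    "f * g = (\<lambda>x. (\<lambda>v. p v * r v) (\<psi> x))" "(\<lambda>v. p v * r v) \<in> poly_funs n"
    by (simp_all add: plus_fun_def times_fun_def poly_funs.add poly_funs.mult)
  note eqs = this
  show "f + g \<in> poly_funs_at \<psi> n"
    unfolding poly_funs_at_def by (intro CollectI exI[of _ "\<lambda>v. p v + r v"] conjI eqs)
  show "f * g \<in> poly_funs_at \<psi> n"
    unfolding poly_funs_at_def by (intro CollectI exI[of _ "\<lambda>v. p v * r v"] conjI eqs)
qed

lemma poly_funs_at_subring: "unital_subring (poly_funs_at \<psi> n)"
  unfolding unital_subring_def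
proof (intro conjI ballI)
  show "1 \<in> poly_funs_at \<psi> n" using poly_funs_at_intros(1)[of 1] by (simp add: one_fun_def)
  fix f g assume fg: "f \<in> poly_funs_at \<psi> n" "g \<in> poly_funs_at \<psi> n"
  show "f * g \<in> poly_funs_at \<psi> n" using poly_funs_at_intros(4)[OF fg] .
  have "f + (\<lambda>_. - 1) * g \<in> poly_funs_at \<psi> n"
    by (intro poly_funs_at_intros fg)
  moreover have "f + (\<lambda>_. - 1) * g = f - g" by (auto simp: fun_eq_iff)
  ultimately show "f - g \<in> poly_funs_at \<psi> n" by simp
qed

lemma scalar_embedding_const: "scalar_embedding (\<lambda>c::'k::field. (\<lambda>_::'g. c))"
  unfolding scalar_embedding_def by (auto simp: fun_eq_iff)

lemma poly_funs_at_mono: "m \<le> n \<Longrightarrow> poly_funs_at \<psi> m \<subseteq> poly_funs_at \<psi> n"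
proof
  fix f assume "m \<le> n" "f \<in> poly_funs_at \<psi> m"
  from this(2) show "f \<in> poly_funs_at \<psi> n"
  proof (induction rule: poly_funs_at_induct)
    case (coord i)
    then show ?case using \<open>m \<le> n\<close> by (intro poly_funs_at_intros) simp
  qed (rule poly_funs_at_intros; assumption)+
qed

lemma poly_funs_at_Suc: "poly_funs_at \<psi> (Suc n) = adjoin (poly_funs_at \<psi> n) (\<lambda>x. \<psi> x n)"
proof (rule subset_antisym)
  let ?S = "poly_funs_at \<psi> n" and ?t = "\<lambda>x. \<psi> x n"
  note S = poly_funs_at_subring[of \<psi> n]
  have base: "f \<in> adjoin ?S ?t" if "f \<in> ?S" for f
    unfolding adjoin_def
    by (intro CollectI exI[of _ "[:f:]"]) (use that subring_zero[OF S] in \<open>auto simp: coeff_pCons split: nat.splits\<close>)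
  show "poly_funs_at \<psi> (Suc n) \<subseteq> adjoin ?S ?t"
  proof
    fix f assume "f \<in> poly_funs_at \<psi> (Suc n)"
    then show "f \<in> adjoin ?S ?t"
    proof (induction rule: poly_funs_at_induct)
      case (const c)
      then show ?case by (intro base poly_funs_at_intros)
    next
      case (coord i)
      show ?case
      proof (cases "i = n")
        case True
        then show ?thesis unfolding adjoin_def
          by (intro CollectI exI[of _ "[:0, 1:]"])
            (use subring_zero[OF S] subring_one[OF S] in \<open>auto simp: coeff_pCons split: nat.splits\<close>)
      next
        case False
        then show ?thesis using coord by (intro base poly_funs_at_intros) auto
      qed
    next
      case (add f g)
      then obtain p q where "f = poly p ?t" "g = poly q ?t" "\<forall>i. coeff p i \<in> ?S" "\<forall>i. coeff q i \<in> ?S"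
        unfolding adjoin_def by auto
      then show ?case unfolding adjoin_def
        by (intro CollectI exI[of _ "p + q"]) (auto intro: subring_add[OF S])
    next
      case (mult f g)
      then obtain p q where "f = poly p ?t" "g = poly q ?t" "\<forall>i. coeff p i \<in> ?S" "\<forall>i. coeff q i \<in> ?S"
        unfolding adjoin_def by auto
      then show ?case unfolding adjoin_def
        by (intro CollectI exI[of _ "p * q"])
          (auto intro!: subring_sum[OF S] subring_mult[OF S] simp: coeff_mult)
    qed
  qed
  show "adjoin ?S ?t \<subseteq> poly_funs_at \<psi> (Suc n)"
  proof
    fix f assume "f \<in> adjoin ?S ?t"
    then obtain p where p: "f = poly p ?t" "\<forall>i. coeff p i \<in> ?S" unfolding adjoin_def by blast
    have "?t \<in> poly_funs_at \<psi> (Suc n)" by (rule poly_funs_at_intros) simp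
    moreover have "coeff p i \<in> poly_funs_at \<psi> (Suc n)" for i
      using p(2) poly_funs_at_mono[of n "Suc n" \<psi>] by auto
    ultimately show "f \<in> poly_funs_at \<psi> (Suc n)"
      unfolding p(1) poly_altdef
      by (intro subring_sum[OF poly_funs_at_subring] subring_mult[OF poly_funs_at_subring]
          subring_power[OF poly_funs_at_subring])
  qed
qed

lemma poly_funs_at_noetherian: "noetherian (poly_funs_at \<psi> n)"
proof (induction n)
  case 0
  have "f \<in> range (\<lambda>c _. c)" if "f \<in> poly_funs_at \<psi> 0" for f
    using that
  proof (induction rule: poly_funs_at_induct)
    case (add f g)
    then obtain c d where "f = (\<lambda>_. c)" "g = (\<lambda>_. d)" by blast
    then have "f + g = (\<lambda>_. c + d)" by (simp add: plus_fun_def)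
    then show ?case by blast
  next
    case (mult f g)
    then obtain c d where "f = (\<lambda>_. c)" "g = (\<lambda>_. d)" by blast
    then have "f * g = (\<lambda>_. c * d)" by (simp add: times_fun_def)
    then show ?case by blast
  qed auto
  then have "poly_funs_at \<psi> 0 = range (\<lambda>c _. c)" using poly_funs_at_intros(1) by blast
  then show ?case using noetherian_field[OF scalar_embedding_const] by metis
next
  case (Suc n)
  then show ?case
    using noetherian_adjoin[OF poly_funs_at_subring] poly_funs_at_subring[of \<psi> "Suc n"]
    unfolding poly_funs_at_Suc by blast
qed

text \<open>
  A maximal annihilator of a nonzero element is prime. Otherwise each nonzero element would have a
  multiple with a strictly larger annihilator.
\<close>

lemma exists_prime_annihilator:
  fixes T :: "'a::comm_ring_1 set"
  assumes T: "unital_subring T" and noeth: "noetherian T"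
  obtains f where "f \<in> T" "f \<noteq> 0"
    "\<And>a b. a \<in> T \<Longrightarrow> b \<in> T \<Longrightarrow> f * a \<noteq> 0 \<Longrightarrow> f * b \<noteq> 0 \<Longrightarrow> f * (a * b) \<noteq> 0"
proof (rule ccontr)
  assume neg: "\<not> thesis"
  note nt = that
  define Ann where "Ann f = {a \<in> T. f * a = 0}" for f
  have step: "\<exists>g. (g \<in> T \<and> g \<noteq> 0) \<and> Ann f \<subset> Ann g" if f: "f \<in> T \<and> f \<noteq> 0" for f
  proof -
    have "\<exists>a b. a \<in> T \<and> b \<in> T \<and> f * a \<noteq> 0 \<and> f * b \<noteq> 0 \<and> f * (a * b) = 0"
    proof (rule ccontr)
      assume "\<not> ?thesis"
      then have thesis using f by (intro nt[of f]) auto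
      then show False using neg by blast
    qed
    then obtain a b where ab: "a \<in> T" "b \<in> T" "f * a \<noteq> 0" "f * b \<noteq> 0" "f * (a * b) = 0"
      by blast
    have "Ann f \<subseteq> Ann (f * a)" unfolding Ann_def by (auto simp: mult.assoc mult.left_commute[of _ a])
    moreover have "b \<in> Ann (f * a)" "b \<notin> Ann f" using ab unfolding Ann_def by (auto simp: mult.assoc)
    ultimately show ?thesis using ab f by (intro exI[of _ "f * a"]) (auto intro: subring_mult[OF T])
  qed
  obtain h where h: "\<And>n::nat. h n \<in> T \<and> h n \<noteq> 0" "\<And>n. Ann (h n) \<subset> Ann (h (Suc n))"
  proof -
    have "\<exists>h. \<forall>n::nat. (h n \<in> T \<and> h n \<noteq> 0) \<and> Ann (h n) \<subset> Ann (h (Suc n))"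
      by (rule dependent_nat_choice) (use subring_one[OF T] step in auto)
    then show ?thesis using that by blast
  qed
  have "ideal_in T (Ann (h n))" for n
    unfolding ideal_in_def Ann_def
    by (auto simp: distrib_left mult.left_commute intro: subring_zero[OF T] subring_add[OF T] subring_mult[OF T])
  then obtain N where N: "\<forall>j\<ge>N. Ann (h j) = Ann (h N)"
    using noeth[unfolded noetherian_def, rule_format, of "\<lambda>n. Ann (h n)"] h(2) by blast
  have "Ann (h (Suc N)) = Ann (h N)" by (rule N[rule_format]) simp
  then show False using h(2)[of N] by blast
qed

section \<open>The coordinate ring of a closed subgroup\<close>

locale closed_subgroup = linear_algebraic_group G
  for G :: "('g, 'k::field) alg_group" (structure) +
  fixes H :: "'g set"
  assumes subgroup: "subgroup H G"
    and closed: "closedin (group_zariski G) H"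
begin

text \<open>
  Precomposition with the retraction onto \<open>H\<close> identifies functions on \<open>H\<close> with certain functions on the
  whole type. The coordinate ring of \<open>H\<close> becomes a subring of the ring of all functions, in
  which a function that vanishes on \<open>H\<close> is equal to zero.
\<close>

definition ret :: "'g \<Rightarrow> 'g" where
  "ret x = (if x \<in> H then x else \<one>)"

definition coord_ring :: "('g \<Rightarrow> 'k) set" where
  "coord_ring = {\<lambda>x. f (ret x) | f. f \<in> regular G}"

lemma H_carrier: "H \<subseteq> carrier G"
  using subgroup.subset[OF subgroup] .

lemma ret_mem: "ret x \<in> H"
  unfolding ret_def using subgroup.one_closed[OF subgroup] by auto

lemma ret_id: "x \<in> H \<Longrightarrow> ret x = x"
  by (simp add: ret_def)

lemma coord_ring_ret: "f \<in> coord_ring \<Longrightarrow> f (ret x) = f x"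
  unfolding coord_ring_def by (auto simp: ret_id ret_mem)

lemma coord_ring_nonzero:
  assumes "f \<in> coord_ring" "f \<noteq> 0"
  obtains x where "x \<in> H" "f x \<noteq> 0"
proof -
  obtain x where "f x \<noteq> 0" using assms(2) by (auto simp: fun_eq_iff)
  then show ?thesis using that[of "ret x"] ret_mem coord_ring_ret[OF assms(1)] by simp
qed

lemma regular_on_coord_ring: "regular_on (regular G) H f \<longleftrightarrow> (\<lambda>x. f (ret x)) \<in> coord_ring"
proof
  assume "regular_on (regular G) H f"
  then obtain g where g: "g \<in> regular G" "\<forall>x\<in>H. f x = g x" unfolding regular_on_def by blast
  then have "(\<lambda>x. f (ret x)) = (\<lambda>x. g (ret x))" using ret_mem by auto
  then show "(\<lambda>x. f (ret x)) \<in> coord_ring" using g(1) unfolding coord_ring_def by blast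
next
  assume "(\<lambda>x. f (ret x)) \<in> coord_ring"
  then obtain g where g: "g \<in> regular G" "(\<lambda>x. f (ret x)) = (\<lambda>x. g (ret x))"
    unfolding coord_ring_def by blast
  have "f x = g x" if "x \<in> H" for x using fun_cong[OF g(2), of x] that by (simp add: ret_id)
  then show "regular_on (regular G) H f" unfolding regular_on_def using g(1) by blast
qed

lemma coord_ring_presentation:
  obtains n \<phi> where "inj_on \<phi> (carrier G)" "algebraic_set n (\<phi> ` carrier G)"
    "regular G = {restrict (\<lambda>x. p (\<phi> x)) (carrier G) | p. p \<in> poly_funs n}"
    "coord_ring = poly_funs_at (\<lambda>x. \<phi> (ret x)) n"
proof -
  obtain n \<phi> where *: "inj_on \<phi> (carrier G)" "algebraic_set n (\<phi> ` carrier G)"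
    and R: "regular G = {restrict (\<lambda>x. p (\<phi> x)) (carrier G) | p. p \<in> poly_funs n}"
    using variety unfolding affine_variety_def by blast
  have eq: "(\<lambda>x. restrict (\<lambda>x. p (\<phi> x)) (carrier G) (ret x)) = (\<lambda>x. p (\<phi> (ret x)))" for p
    using ret_mem H_carrier by (auto simp: fun_eq_iff)
  have "coord_ring = {\<lambda>x. restrict (\<lambda>x. p (\<phi> x)) (carrier G) (ret x) | p. p \<in> poly_funs n}"
    unfolding coord_ring_def R by blast
  then have "coord_ring = poly_funs_at (\<lambda>x. \<phi> (ret x)) n"
    unfolding eq poly_funs_at_def .
  then show ?thesis using that * R by blast
qed

lemma coord_subring: "unital_subring coord_ring"
  by (rule coord_ring_presentation) (simp add: poly_funs_at_subring)

lemma coord_noetherian: "noetherian coord_ring"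
  by (rule coord_ring_presentation) (simp add: poly_funs_at_noetherian)

lemma coord_const: "(\<lambda>_. c) \<in> coord_ring"
  by (rule coord_ring_presentation) (simp add: poly_funs_at_intros)

text \<open>
  Maximal ideals with residue field \<open>'k\<close> are points: the residues of the coordinate functions are the
  coordinates of a point, which satisfies the equations of \<open>H\<close> since these hold in the coordinate
  ring.
\<close>

lemma residue_point:
  assumes m: "ideal_in coord_ring m" "1 \<notin> m" and res: "\<And>f. f \<in> coord_ring \<Longrightarrow> \<exists>c. f - (\<lambda>_. c) \<in> m"
  obtains a where "a \<in> H" "\<And>f. f \<in> coord_ring \<Longrightarrow> f - (\<lambda>_. f a) \<in> m"
proof -
  obtain n \<phi> where inj: "inj_on \<phi> (carrier G)" and alg: "algebraic_set n (\<phi> ` carrier G)"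
    and R: "regular G = {restrict (\<lambda>x. p (\<phi> x)) (carrier G) | p. p \<in> poly_funs n}"
    and T: "coord_ring = poly_funs_at (\<lambda>x. \<phi> (ret x)) n"
    by (rule coord_ring_presentation)
  note S = coord_subring
  have "\<forall>i. \<exists>c. i < n \<longrightarrow> (\<lambda>x. \<phi> (ret x) i) - (\<lambda>_. c) \<in> m"
    using res poly_funs_at_intros(2)[of _ n "\<lambda>x. \<phi> (ret x)"] unfolding T by blast
  then obtain c where c: "\<And>i. i < n \<Longrightarrow> (\<lambda>x. \<phi> (ret x) i) - (\<lambda>_. c i) \<in> m" by metis
  define v where "v = restrict c {..<n}"
  have v: "(\<lambda>x. p (\<phi> (ret x))) - (\<lambda>_. p v) \<in> m" if "p \<in> poly_funs n" for p
    using that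
  proof (induction rule: poly_funs.induct)
    case (const c)
    show ?case using ideal_zero[OF m(1)] by (simp only: diff_self)
  next
    case (coord i)
    then have "v i = c i" by (simp add: v_def)
    then show ?case using c[OF coord] by (simp only:)
  next
    case (add p r)
    have "((\<lambda>x. p (\<phi> (ret x))) - (\<lambda>_. p v)) + ((\<lambda>x. r (\<phi> (ret x))) - (\<lambda>_. r v)) \<in> m"
      by (rule ideal_add[OF m(1) add.IH])
    moreover have "((\<lambda>x. p (\<phi> (ret x))) - (\<lambda>_. p v)) + ((\<lambda>x. r (\<phi> (ret x))) - (\<lambda>_. r v)) =
        (\<lambda>x. p (\<phi> (ret x)) + r (\<phi> (ret x))) - (\<lambda>_. p v + r v)"
      by (auto simp: fun_eq_iff)
    ultimately show ?case by (simp only:)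
  next
    case (mult p r)
    let ?p = "\<lambda>x. p (\<phi> (ret x))" and ?r = "\<lambda>x. r (\<phi> (ret x))"
    have "?p \<in> coord_ring" unfolding T poly_funs_at_def using mult by blast
    then have "?p * (?r - (\<lambda>_. r v)) + (\<lambda>_. r v) * (?p - (\<lambda>_. p v)) \<in> m"
      by (intro ideal_add[OF m(1) ideal_mult[OF m(1) _ mult.IH(2)] ideal_mult[OF m(1) _ mult.IH(1)]]
          coord_const)
    moreover have "?p * (?r - (\<lambda>_. r v)) + (\<lambda>_. r v) * (?p - (\<lambda>_. p v)) =
        (\<lambda>x. p (\<phi> (ret x)) * r (\<phi> (ret x))) - (\<lambda>_. p v * r v)"
      by (auto simp: fun_eq_iff algebra_simps)
    ultimately show ?case by (simp only:)
  qed
  have vanish: "p v = 0" if p: "p \<in> poly_funs n" "\<And>x. x \<in> H \<Longrightarrow> p (\<phi> x) = 0" for p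
  proof -
    have "(\<lambda>x. p (\<phi> (ret x))) = 0" using p(2) ret_mem by (auto simp: fun_eq_iff)
    then have "0 - (\<lambda>_. p v) \<in> m" using v[OF p(1)] by (simp only:)
    then have "0 - (0 - (\<lambda>_. p v)) \<in> m"
      by (rule ideal_diff[OF S m(1) ideal_zero[OF m(1)]])
    then have "(\<lambda>_. p v) \<in> m" by (simp only: diff_0 minus_minus)
    moreover have "range (\<lambda>c _. c) \<subseteq> coord_ring" by (auto simp: coord_const)
    ultimately show ?thesis using scalar_mem_maximal_ideal[OF scalar_embedding_const m] by simp
  qed
  obtain P where P: "P \<subseteq> poly_funs n" "\<phi> ` carrier G = {v \<in> affine_space n. \<forall>p\<in>P. p v = 0}"
    using alg unfolding algebraic_set_def by (elim exE conjE) (rule that)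
  have "v \<in> affine_space n" unfolding v_def affine_space_def by auto
  moreover have "p v = 0" if "p \<in> P" for p
  proof (rule vanish)
    show "p \<in> poly_funs n" using P(1) that by blast
    fix x assume "x \<in> H"
    then have "\<phi> x \<in> \<phi> ` carrier G" using H_carrier by blast
    then show "p (\<phi> x) = 0" using that unfolding P(2) by simp
  qed
  ultimately have "v \<in> \<phi> ` carrier G" unfolding P(2) by simp
  then obtain a where a: "a \<in> carrier G" "\<phi> a = v" by blast
  obtain Z where Z: "Z \<subseteq> regular G" "H = {x \<in> carrier G. \<forall>f\<in>Z. f x = 0}"
    using closed unfolding closedin_zariski[OF variety] by (elim exE conjE) (rule that)
  have "f a = 0" if "f \<in> Z" for f
  proof -
    obtain p where p: "p \<in> poly_funs n" "f = restrict (\<lambda>x. p (\<phi> x)) (carrier G)"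
      using Z(1) \<open>f \<in> Z\<close> unfolding R by blast
    have "p (\<phi> x) = 0" if "x \<in> H" for x
    proof -
      have "f x = 0" "x \<in> carrier G" using that \<open>f \<in> Z\<close> unfolding Z(2) by auto
      then show ?thesis unfolding p(2) by simp
    qed
    then have "p v = 0" using vanish[OF p(1)] by blast
    then show ?thesis using a p(2) by simp
  qed
  then have aH: "a \<in> H" using a(1) unfolding Z(2) by simp
  have "f - (\<lambda>_. f a) \<in> m" if f: "f \<in> coord_ring" for f
  proof -
    obtain p where p: "p \<in> poly_funs n" "f = (\<lambda>x. p (\<phi> (ret x)))"
      using f unfolding T poly_funs_at_def by blast
    then have fa: "f a = p v" using a aH by (simp add: ret_id)
    show ?thesis unfolding fa unfolding p(2) by (rule v[OF p(1)])
  qed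
  then show ?thesis by (rule that[OF aH])
qed

lemma coord_compose:
  assumes "f \<in> coord_ring" "morph H \<beta>" "\<beta> ` H \<subseteq> H"
  shows "(\<lambda>x. f (\<beta> (ret x))) \<in> coord_ring"
proof -
  obtain g where g: "g \<in> regular G" "f = (\<lambda>x. g (ret x))"
    using assms(1) unfolding coord_ring_def by blast
  have "regular_on (regular G) H (\<lambda>x. g (\<beta> x))"
    using assms(2) g(1) unfolding morphism_on_def by (elim conjE bspec)
  then have "(\<lambda>x. g (\<beta> (ret x))) \<in> coord_ring" unfolding regular_on_coord_ring .
  moreover have "(\<lambda>x. f (\<beta> (ret x))) = (\<lambda>x. g (\<beta> (ret x)))"
    unfolding g(2) using ret_id ret_mem assms(3) by (metis image_subset_iff)
  ultimately show ?thesis by (simp only:)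
qed

end

section \<open>Connected closed subgroups are irreducible\<close>

context closed_subgroup
begin

definition nonvanishing :: "('g \<Rightarrow> 'k) \<Rightarrow> 'g set" where
  "nonvanishing f = {x \<in> H. f x \<noteq> 0}"

definition open_on :: "'g set \<Rightarrow> bool" where
  "open_on U \<longleftrightarrow> U \<subseteq> H \<and> (\<forall>x\<in>U. \<exists>f\<in>coord_ring. f x \<noteq> 0 \<and> nonvanishing f \<subseteq> U)"

definition irreducible_on :: "'g set \<Rightarrow> bool" where
  "irreducible_on U \<longleftrightarrow> (\<forall>f\<in>coord_ring. \<forall>g\<in>coord_ring.
     nonvanishing f \<inter> U \<noteq> {} \<longrightarrow> nonvanishing g \<inter> U \<noteq> {} \<longrightarrow> nonvanishing (f * g) \<inter> U \<noteq> {})"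

lemma open_on_Union:
  assumes "\<And>U. U \<in> \<U> \<Longrightarrow> open_on U"
  shows "open_on (\<Union>\<U>)"
  unfolding open_on_def
proof (intro conjI ballI)
  show "\<Union>\<U> \<subseteq> H" using assms unfolding open_on_def by blast
  fix x assume "x \<in> \<Union>\<U>"
  then obtain U where U: "U \<in> \<U>" "x \<in> U" by blast
  then obtain f where "f \<in> coord_ring" "f x \<noteq> 0" "nonvanishing f \<subseteq> U"
    using assms[OF U(1)] unfolding open_on_def by blast
  then show "\<exists>f\<in>coord_ring. f x \<noteq> 0 \<and> nonvanishing f \<subseteq> \<Union>\<U>" using U(1) by blast
qed

lemma open_on_zariski:
  assumes "open_on U"
  obtains E where "openin (group_zariski G) E" "E \<inter> H = U"
proof -
  define S where "S = {g \<in> regular G. \<forall>y\<in>H. g y \<noteq> 0 \<longrightarrow> y \<in> U}"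
  let ?E = "carrier G - {x \<in> carrier G. \<forall>f\<in>S. f x = 0}"
  have "S \<subseteq> regular G" by (auto simp: S_def)
  then have "openin (group_zariski G) ?E" unfolding openin_zariski[OF variety] by blast
  moreover have "?E \<inter> H = U"
  proof (intro Set.set_eqI iffI)
    fix x assume "x \<in> ?E \<inter> H"
    then show "x \<in> U" by (auto simp: S_def)
  next
    fix x assume x: "x \<in> U"
    then obtain f where f: "f \<in> coord_ring" "f x \<noteq> 0" "nonvanishing f \<subseteq> U"
      using assms unfolding open_on_def by blast
    obtain g where g: "g \<in> regular G" "f = (\<lambda>x. g (ret x))"
      using f(1) unfolding coord_ring_def by blast
    have xH: "x \<in> H" using x assms unfolding open_on_def by blast
    have "y \<in> U" if "y \<in> H" "g y \<noteq> 0" for y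
      using f(3) that unfolding nonvanishing_def g(2) by (auto simp: ret_id)
    then have "g \<in> S" using g(1) by (simp add: S_def)
    moreover have "g x \<noteq> 0" using f(2) xH unfolding g(2) by (simp add: ret_id)
    ultimately show "x \<in> ?E \<inter> H" using xH H_carrier by blast
  qed
  ultimately show ?thesis by (rule that)
qed

lemma connected_open_on:
  assumes "connectedin (group_zariski G) H" "open_on U" "open_on (H - U)" "U \<noteq> {}"
  shows "U = H"
proof (rule ccontr)
  assume "U \<noteq> H"
  then have ne: "H - U \<noteq> {}" using assms(2) unfolding open_on_def by blast
  obtain E where E: "openin (group_zariski G) E" "E \<inter> H = U"
    using assms(2) by (rule open_on_zariski)
  obtain E' where E': "openin (group_zariski G) E'" "E' \<inter> H = H - U"
    using assms(3) by (rule open_on_zariski)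
  have "H \<subseteq> E \<union> E'" "E \<inter> E' \<inter> H = {}" using E(2) E'(2) by blast+
  moreover have "E \<inter> H \<noteq> {}" "E' \<inter> H \<noteq> {}" using E(2) E'(2) ne assms(4) by simp_all
  ultimately show False
    using assms(1) E(1) E'(1) unfolding connectedin by blast
qed

text \<open>
  In the irreducible set \<open>U\<close>, the nonempty open subsets cut out by \<open>f\<close> and by a neighbourhood of \<open>x\<close>
  inside \<open>V\<close> have a common point.
\<close>

lemma irreducible_on_transfer:
  assumes "irreducible_on U" "open_on V" "x \<in> U" "x \<in> V"
    and f: "f \<in> coord_ring" "nonvanishing f \<inter> U \<noteq> {}"
  shows "nonvanishing f \<inter> V \<noteq> {}"
proof -
  obtain e where e: "e \<in> coord_ring" "e x \<noteq> 0" "nonvanishing e \<subseteq> V"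
    using assms(2,4) unfolding open_on_def by blast
  have "x \<in> H" using assms(2,4) unfolding open_on_def by blast
  then have "nonvanishing e \<inter> U \<noteq> {}" using e(2) assms(3) unfolding nonvanishing_def by blast
  then obtain y where "y \<in> nonvanishing (f * e)"
    using assms(1) f e(1) unfolding irreducible_on_def by blast
  then have "y \<in> nonvanishing f" "y \<in> nonvanishing e" unfolding nonvanishing_def by auto
  then show ?thesis using e(3) by blast
qed

text \<open>
  An annihilator that is a prime ideal belongs to a function whose nonvanishing set is irreducible;
  translations then move this open set to any point of the group.
\<close>

lemma irreducible_neighbourhood:
  assumes a: "a \<in> H"
  obtains U where "open_on U" "irreducible_on U" "a \<in> U"
proof -
  obtain f0 where f0: "f0 \<in> coord_ring" "f0 \<noteq> 0" and
    prime: "\<And>g h. g \<in> coord_ring \<Longrightarrow> h \<in> coord_ring \<Longrightarrow> f0 * g \<noteq> 0 \<Longrightarrow> f0 * h \<noteq> 0 \<Longrightarrow> f0 * (g * h) \<noteq> 0"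
    using exists_prime_annihilator[OF coord_subring coord_noetherian] by blast
  obtain u where u: "u \<in> H" "f0 u \<noteq> 0" using coord_ring_nonzero[OF f0] by blast
  define c where "c = inv a \<otimes> u"
  have c: "c \<in> H" "inv c \<in> H" and cG: "c \<in> carrier G"
    unfolding c_def using a u subgroup.m_closed[OF subgroup] subgroup.m_inv_closed[OF subgroup] H_carrier
    by auto
  have trans: "(\<lambda>x. f (ret x \<otimes> d)) \<in> coord_ring" if "f \<in> coord_ring" "d \<in> H" for f d
  proof (rule coord_compose[OF that(1)])
    show "morph H (\<lambda>x. x \<otimes> d)" using that H_carrier by (intro morph_intros) auto
    show "(\<lambda>x. x \<otimes> d) ` H \<subseteq> H" using that subgroup.m_closed[OF subgroup] by auto
  qed
  define U where "U = {x \<in> H. f0 (x \<otimes> c) \<noteq> 0}"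
  have Ueq: "nonvanishing (\<lambda>x. f0 (ret x \<otimes> c)) = U"
    unfolding U_def nonvanishing_def by (auto simp: ret_id)
  have "open_on U"
    unfolding open_on_def
  proof (intro conjI ballI)
    show "U \<subseteq> H" by (auto simp: U_def)
    fix x assume x: "x \<in> U"
    then have "f0 (ret x \<otimes> c) \<noteq> 0" unfolding U_def by (auto simp: ret_id)
    then show "\<exists>f\<in>coord_ring. f x \<noteq> 0 \<and> nonvanishing f \<subseteq> U"
      by (intro bexI[of _ "\<lambda>x. f0 (ret x \<otimes> c)"] conjI trans[OF f0(1) c(1)]) (simp_all add: Ueq)
  qed
  moreover have "irreducible_on U"
    unfolding irreducible_on_def
  proof (intro ballI impI)
    fix f g assume fg: "f \<in> coord_ring" "g \<in> coord_ring"
      and meet: "nonvanishing f \<inter> U \<noteq> {}" "nonvanishing g \<inter> U \<noteq> {}"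
    let ?s = "\<lambda>f x. f (ret x \<otimes> inv c) :: 'k"
    have ne: "f0 * ?s h \<noteq> 0" if hU: "nonvanishing h \<inter> U \<noteq> {}" for h
    proof -
      obtain x where x: "x \<in> H" "h x \<noteq> 0" "f0 (x \<otimes> c) \<noteq> 0"
        using hU unfolding nonvanishing_def U_def by blast
      have xc: "x \<otimes> c \<in> H" using x(1) c(1) by (rule subgroup.m_closed[OF subgroup])
      have "x \<otimes> c \<otimes> inv c = x" using x(1) cG H_carrier by (simp add: m_assoc subset_iff)
      then have "(f0 * ?s h) (x \<otimes> c) \<noteq> 0" using x xc by (simp add: ret_id)
      then show ?thesis by (rule contrapos_nn) (simp only: zero_fun_apply)
    qed
    have "f0 * (?s f * ?s g) \<noteq> 0"
      by (intro prime trans fg c ne meet)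
    moreover have "f0 * (?s f * ?s g) \<in> coord_ring"
      by (intro subring_mult[OF coord_subring] f0 trans fg c)
    ultimately obtain z where z: "z \<in> H" "(f0 * (?s f * ?s g)) z \<noteq> 0"
      using coord_ring_nonzero by blast
    have zc: "z \<otimes> inv c \<in> H" using z(1) c(2) by (rule subgroup.m_closed[OF subgroup])
    have "z \<otimes> inv c \<otimes> c = z" using z(1) cG H_carrier by (simp add: m_assoc subset_iff)
    then have "z \<otimes> inv c \<in> nonvanishing (f * g) \<inter> U"
      using z zc unfolding nonvanishing_def U_def by (simp add: ret_id)
    then show "nonvanishing (f * g) \<inter> U \<noteq> {}" by blast
  qed
  moreover have "a \<in> U"
  proof -
    have "a \<otimes> c = u" unfolding c_def using a u H_carrier by (simp add: m_assoc[symmetric] subset_iff)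
    then show ?thesis unfolding U_def using a u by simp
  qed
  ultimately show ?thesis by (rule that)
qed

text \<open>
  The union \<open>W\<close> of the irreducible open sets containing \<open>\<one>\<close> is irreducible. An irreducible open set that
  meets it is contained in it, since its union with a member of the family is again irreducible.
  So the complement of \<open>W\<close> is open too, and connectedness gives \<open>W = H\<close>. Irreducibility of \<open>H\<close> means
  that the coordinate ring is a domain.
\<close>

lemma coord_domain:
  assumes conn: "connectedin (group_zariski G) H"
    and fg: "f \<in> coord_ring" "g \<in> coord_ring" "f * g = 0"
  shows "f = 0 \<or> g = 0"
proof -
  define \<U> where "\<U> = {U. open_on U \<and> irreducible_on U \<and> \<one> \<in> U}"
  have oneH: "\<one> \<in> H" using subgroup.one_closed[OF subgroup] .
  have open1: "open_on (\<Union>\<U>)" by (rule open_on_Union) (simp add: \<U>_def)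
  define \<V> where "\<V> = {V. open_on V \<and> V \<inter> \<Union>\<U> = {}}"
  have "H - \<Union>\<U> = \<Union>\<V>"
  proof (rule subset_antisym)
    show "\<Union>\<V> \<subseteq> H - \<Union>\<U>" unfolding \<V>_def open_on_def by blast
    show "H - \<Union>\<U> \<subseteq> \<Union>\<V>"
    proof
      fix a assume a: "a \<in> H - \<Union>\<U>"
      then obtain V where V: "open_on V" "irreducible_on V" "a \<in> V"
        using irreducible_neighbourhood[of a] by blast
      have "V \<inter> \<Union>\<U> = {}"
      proof (rule ccontr)
        assume "V \<inter> \<Union>\<U> \<noteq> {}"
        then obtain z U where z: "z \<in> V" "z \<in> U" and U: "open_on U" "irreducible_on U" "\<one> \<in> U"
          unfolding \<U>_def by blast
        have "open_on (U \<union> V)" using open_on_Union[of "{U, V}"] U V by auto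
        moreover have "irreducible_on (U \<union> V)"
          unfolding irreducible_on_def
        proof (intro ballI impI)
          fix f g assume mem: "f \<in> coord_ring" "g \<in> coord_ring"
            and "nonvanishing f \<inter> (U \<union> V) \<noteq> {}" "nonvanishing g \<inter> (U \<union> V) \<noteq> {}"
          then have "nonvanishing f \<inter> U \<noteq> {}" "nonvanishing g \<inter> U \<noteq> {}"
            using irreducible_on_transfer[OF V(2) U(1) z] by blast+
          then show "nonvanishing (f * g) \<inter> (U \<union> V) \<noteq> {}"
            using U(2) mem unfolding irreducible_on_def by blast
        qed
        ultimately have "U \<union> V \<in> \<U>" using U(3) unfolding \<U>_def by blast
        then show False using a V(3) by blast
      qed
      then show "a \<in> \<Union>\<V>" using V unfolding \<V>_def by blast
    qed
  qed
  then have "open_on (H - \<Union>\<U>)" using open_on_Union[of \<V>] unfolding \<V>_def by simp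
  moreover have "\<one> \<in> \<Union>\<U>" using irreducible_neighbourhood[OF oneH] unfolding \<U>_def by blast
  ultimately have UH: "\<Union>\<U> = H" using connected_open_on[OF conn open1] by blast
  show ?thesis
  proof (rule ccontr)
    assume "\<not> ?thesis"
    then have nz: "f \<noteq> 0" "g \<noteq> 0" by blast+
    obtain x where x: "x \<in> H" "f x \<noteq> 0" using coord_ring_nonzero[OF fg(1) nz(1)] by blast
    obtain y where y: "y \<in> H" "g y \<noteq> 0" using coord_ring_nonzero[OF fg(2) nz(2)] by blast
    have "x \<in> \<Union>\<U>" "y \<in> \<Union>\<U>" using x(1) y(1) unfolding UH .
    then obtain U V where "U \<in> \<U>" "x \<in> U" "V \<in> \<U>" "y \<in> V" by blast
    then have U: "open_on U" "irreducible_on U" "\<one> \<in> U" "x \<in> U"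
      and V: "open_on V" "irreducible_on V" "\<one> \<in> V" "y \<in> V"
      unfolding \<U>_def by simp_all
    have "x \<in> nonvanishing f \<inter> U" "y \<in> nonvanishing g \<inter> V"
      using x y U(4) V(4) unfolding nonvanishing_def by simp_all
    then have "nonvanishing f \<inter> V \<noteq> {}" "nonvanishing g \<inter> V \<noteq> {}"
      using irreducible_on_transfer[OF U(2) V(1) U(3) V(3) fg(1)] by blast+
    then have "nonvanishing (f * g) \<noteq> {}"
      using V(2) fg unfolding irreducible_on_def by blast
    then show False unfolding nonvanishing_def fg(3) by simp
  qed
qed

end

section \<open>Finiteness from large powers of generators\<close>

definition monomials :: "'a::comm_ring_1 set \<Rightarrow> nat \<Rightarrow> 'a set" where
  "monomials B d = prod_list ` {l. set l \<subseteq> B \<and> length l \<le> d}"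

lemma finite_monomials: "finite B \<Longrightarrow> finite (monomials B d)"
  unfolding monomials_def by (intro finite_imageI finite_lists_length_le)

lemma monomials_mono: "d \<le> e \<Longrightarrow> monomials B d \<subseteq> monomials B e"
  unfolding monomials_def by (intro image_mono) auto

lemma monomials_mult: "a \<in> monomials B d \<Longrightarrow> b \<in> monomials B e \<Longrightarrow> a * b \<in> monomials B (d + e)"
proof -
  assume "a \<in> monomials B d" "b \<in> monomials B e"
  then obtain l l' where "set l \<subseteq> B" "length l \<le> d" "a = prod_list l"
    "set l' \<subseteq> B" "length l' \<le> e" "b = prod_list l'"
    unfolding monomials_def by blast
  then show ?thesis unfolding monomials_def
    by (intro image_eqI[of _ _ "l @ l'"]) auto
qed

lemma rspan_generator:
  assumes "1 \<in> S" "m \<in> M"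
  shows "m \<in> rspan S {0} M"
proof -
  have "1 * m + 0 \<in> rspan S {0} M" using assms by (intro rspan.intros) auto
  then show ?thesis by simp
qed

lemma rspan_mult_right:
  assumes S: "unital_subring S" and "v \<in> rspan S {0} M"
    and M: "\<And>m. m \<in> M \<Longrightarrow> m * b \<in> rspan S {0} M'"
  shows "v * b \<in> rspan S {0} M'"
  using assms(2)
proof (induction rule: rspan.induct)
  case (base p)
  then show ?case by (auto intro: rspan.base)
next
  case (step v s m)
  have "s * (m * b) \<in> rspan S {0} M'"
    by (rule rspan_scale[OF _ _ M[OF step(3)], of s "{0}" S])
      (use step in \<open>auto intro: subring_mult[OF S]\<close>)
  then have "s * (m * b) + v * b \<in> rspan S {0} M'"
    using step by (intro rspan_add) auto
  then show ?case by (simp add: algebra_simps)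
qed

lemma rspan_trans:
  assumes "unital_subring S" "v \<in> rspan S {0} M" "M \<subseteq> rspan S {0} M'"
  shows "v \<in> rspan S {0} M'"
  using rspan_mult_right[OF assms(1,2), of 1 M'] assms(3) by auto

lemma rspan_monomials_mult:
  assumes S: "unital_subring S" and "a \<in> rspan S {0} (monomials B d)" "b \<in> rspan S {0} (monomials B e)"
  shows "a * b \<in> rspan S {0} (monomials B (d + e))"
proof (rule rspan_mult_right[OF assms(1,2)])
  fix m assume m: "m \<in> monomials B d"
  have "b * m \<in> rspan S {0} (monomials B (d + e))"
    by (rule rspan_mult_right[OF assms(1,3)])
      (use m monomials_mult[OF m] in \<open>auto intro!: rspan_generator subring_one[OF S] simp: mult.commute\<close>)
  then show "m * b \<in> rspan S {0} (monomials B (d + e))" by (simp add: mult.commute)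
qed

lemma extract_power:
  fixes l :: "'a::comm_ring_1 list"
  assumes "Q \<le> count_list l t"
  shows "\<exists>l'. set l' \<subseteq> set l \<and> length l' + Q = length l \<and> prod_list l = t ^ Q * prod_list l'"
  using assms
proof (induction l arbitrary: Q)
  case Nil
  then show ?case by auto
next
  case (Cons x l)
  show ?case
  proof (cases "x = t \<and> Q > 0")
    case True
    then obtain Q' where Q: "Q = Suc Q'" using gr0_implies_Suc by blast
    then have "Q' \<le> count_list l t" using Cons.prems True by simp
    then obtain l' where "set l' \<subseteq> set l" "length l' + Q' = length l" "prod_list l = t ^ Q' * prod_list l'"
      using Cons.IH by blast
    then show ?thesis using True Q by (intro exI[of _ l']) (auto simp: mult.assoc)
  next
    case False
    then have "Q \<le> count_list l t" using Cons.prems by (auto split: if_splits)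
    then obtain l' where "set l' \<subseteq> set l" "length l' + Q = length l" "prod_list l = t ^ Q * prod_list l'"
      using Cons.IH by blast
    then show ?thesis by (intro exI[of _ "x # l'"]) (auto simp: mult.left_commute)
  qed
qed

text \<open>
  Long monomials contain the \<open>Q\<close>-th power of some generator, which can be traded for monomials of
  degree \<open>D < Q\<close>; so monomials of bounded degree suffice.
\<close>

lemma monomials_span_bounded:
  assumes S: "unital_subring S" and B: "finite B"
    and pow: "\<And>t. t \<in> B \<Longrightarrow> t ^ Q \<in> rspan S {0} (monomials B D)" and "D < Q"
  shows "monomials B e \<subseteq> rspan S {0} (monomials B (card B * Q))"
proof -
  have "prod_list l \<in> rspan S {0} (monomials B (card B * Q))" if "set l \<subseteq> B" for l
    using that
  proof (induction "length l" arbitrary: l rule: less_induct)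
    case less
    show ?case
    proof (cases "length l \<le> card B * Q")
      case True
      then have "prod_list l \<in> monomials B (card B * Q)" using less.prems unfolding monomials_def by blast
      then show ?thesis by (rule rspan_generator[OF subring_one[OF S]])
    next
      case False
      have "\<exists>t\<in>B. Q \<le> count_list l t"
      proof (rule ccontr)
        assume "\<not> ?thesis"
        then have "(\<Sum>t\<in>B. count_list l t) \<le> card B * Q"
          by (intro sum_bounded_above[of B "count_list l" Q, simplified]) auto
        then show False using False sum_count_set[OF less.prems B] by simp
      qed
      then obtain t where t: "t \<in> B" "Q \<le> count_list l t" by blast
      obtain l' where l': "set l' \<subseteq> set l" "length l' + Q = length l" "prod_list l = t ^ Q * prod_list l'"
        using extract_power[OF t(2)] by blast
      have "t ^ Q * prod_list l' \<in> rspan S {0} (monomials B (card B * Q))"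
      proof (rule rspan_mult_right[OF S pow[OF t(1)]])
        fix m assume "m \<in> monomials B D"
        then obtain l'' where l'': "set l'' \<subseteq> B" "length l'' \<le> D" "m = prod_list l''"
          unfolding monomials_def by blast
        have "prod_list (l'' @ l') \<in> rspan S {0} (monomials B (card B * Q))"
          using l' l'' less.prems assms(4) by (intro less.hyps) auto
        then show "m * prod_list l' \<in> rspan S {0} (monomials B (card B * Q))" using l'' by simp
      qed
      then show ?thesis using l'(3) by simp
    qed
  qed
  then show ?thesis unfolding monomials_def by blast
qed

lemma rspan_sum:
  assumes "\<And>i. i \<in> I \<Longrightarrow> f i \<in> rspan S {0} M"
  shows "(\<Sum>i\<in>I. f i) \<in> rspan S {0} M"
  using assms
proof (induction I rule: infinite_finite_induct)
  case (insert i I)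
  then show ?case by (auto intro!: rspan_add)
qed (auto intro: rspan.base)

abbreviation constants :: "('g \<Rightarrow> 'k::field) set" where
  "constants \<equiv> range (\<lambda>c _. c)"

lemma constants_subring: "unital_subring (constants :: ('g \<Rightarrow> 'k::field) set)"
  unfolding unital_subring_def
proof (intro conjI ballI)
  show "1 \<in> (constants :: ('g \<Rightarrow> 'k) set)" by (rule range_eqI[of _ _ 1]) (simp add: one_fun_def)
  fix a b :: "'g \<Rightarrow> 'k" assume "a \<in> constants" "b \<in> constants"
  then obtain c d where "a = (\<lambda>_. c)" "b = (\<lambda>_. d)" by blast
  then have "a - b = (\<lambda>_. c - d)" "a * b = (\<lambda>_. c * d)" by (auto simp: fun_eq_iff)
  then show "a - b \<in> constants" "a * b \<in> constants" by simp_all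
qed

lemma rspan_constants:
  assumes "g \<in> M"
  shows "(\<lambda>x. c * g x) \<in> rspan constants {0} M"
proof -
  have "(\<lambda>_. c) * g + 0 \<in> rspan constants {0} M" using assms by (intro rspan.intros) auto
  moreover have "(\<lambda>_. c) * g + 0 = (\<lambda>x. c * g x)" by (auto simp: fun_eq_iff)
  ultimately show ?thesis by (simp only:)
qed

lemma rspan_constants_sum:
  assumes "\<And>i. i \<in> I \<Longrightarrow> g i \<in> M"
  shows "(\<lambda>x. \<Sum>i\<in>I. c i * g i x) \<in> rspan constants {0} M"
proof -
  have "(\<Sum>i\<in>I. (\<lambda>x. c i * g i x)) \<in> rspan constants {0} M"
    by (intro rspan_sum rspan_constants assms)
  moreover have "(\<Sum>i\<in>I. (\<lambda>x. c i * g i x)) = (\<lambda>x. \<Sum>i\<in>I. c i * g i x)"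
    by (rule ext) (rule sum_fun_apply)
  ultimately show ?thesis by (simp only:)
qed

context closed_subgroup
begin

text \<open>
  The functions \<open>R0\<close> defined over the finite field span all regular functions over \<open>'k\<close>, so
  each of the finitely many coordinate functions is a combination of finitely many of them.
\<close>

lemma coord_generators:
  assumes "Fq_structure q (carrier G) (regular G) R0"
  obtains B where "finite B" "\<And>t. t \<in> B \<Longrightarrow> \<exists>f\<in>R0. t = (\<lambda>x. f (ret x))"
    "\<And>h. h \<in> coord_ring \<Longrightarrow> \<exists>d. h \<in> rspan constants {0} (monomials B d)"
proof -
  obtain n \<phi> where "inj_on \<phi> (carrier G)" "algebraic_set n (\<phi> ` carrier G)"
    and R: "regular G = {restrict (\<lambda>x. p (\<phi> x)) (carrier G) | p. p \<in> poly_funs n}"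
    and T: "coord_ring = poly_funs_at (\<lambda>x. \<phi> (ret x)) n"
    by (rule coord_ring_presentation)
  have retG: "ret x \<in> carrier G" for x using ret_mem H_carrier by blast
  have spanning: "\<forall>f\<in>regular G. \<exists>r a c. (\<forall>i<r. a i \<in> R0) \<and>
      (\<forall>x\<in>carrier G. f x = (\<Sum>i<(r::nat). c i * a i x))"
    using assms unfolding Fq_structure_def by (elim conjE)
  have "\<exists>B. finite B \<and> (\<forall>t\<in>B. \<exists>f\<in>R0. t = (\<lambda>x. f (ret x))) \<and>
      (\<lambda>x. \<phi> (ret x) i) \<in> rspan constants {0} B" if i: "i < n" for i
  proof -
    let ?x = "restrict (\<lambda>x. (\<lambda>v. v i) (\<phi> x)) (carrier G)"
    have xR: "?x \<in> regular G"
      unfolding R by (intro CollectI exI[of _ "\<lambda>v. v i"] conjI refl poly_funs.coord[OF i])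
    obtain r a c where a: "\<forall>j<(r::nat). a j \<in> R0"
      and x: "\<forall>x\<in>carrier G. ?x x = (\<Sum>j<r. c j * a j x)"
      using bspec[OF spanning xR] by (elim exE conjE) (rule that)
    let ?B = "(\<lambda>j x. a j (ret x)) ` {..<r}"
    have "(\<lambda>x. \<Sum>j<r. c j * a j (ret x)) \<in> rspan constants {0} ?B"
      by (rule rspan_constants_sum) simp
    moreover have "(\<lambda>x. \<Sum>j<r. c j * a j (ret x)) = (\<lambda>x. \<phi> (ret x) i)"
    proof
      fix x show "(\<Sum>j<r. c j * a j (ret x)) = \<phi> (ret x) i"
        using x[rule_format, OF retG[of x]] retG[of x] by simp
    qed
    ultimately have "(\<lambda>x. \<phi> (ret x) i) \<in> rspan constants {0} ?B" by (simp only:)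
    moreover have "\<forall>t\<in>?B. \<exists>f\<in>R0. t = (\<lambda>x. f (ret x))" using a by auto
    ultimately show ?thesis by (intro exI[of _ ?B] conjI) simp_all
  qed
  then have "\<forall>i. \<exists>B. i < n \<longrightarrow> finite B \<and> (\<forall>t\<in>B. \<exists>f\<in>R0. t = (\<lambda>x. f (ret x))) \<and>
      (\<lambda>x. \<phi> (ret x) i) \<in> rspan constants {0} B" by blast
  from choice[OF this] obtain b where b: "\<forall>i. i < n \<longrightarrow> finite (b i) \<and>
      (\<forall>t\<in>b i. \<exists>f\<in>R0. t = (\<lambda>x. f (ret x))) \<and> (\<lambda>x. \<phi> (ret x) i) \<in> rspan constants {0} (b i)"
    by (elim exE)
  define B where "B = (\<Union>i<n. b i)"
  have mono: "h \<in> rspan constants {0} (monomials B e)"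
    if "h \<in> rspan constants {0} (monomials B d)" "d \<le> e" for h d e
    by (rule rspan_mono[OF that(1) order_refl order_refl monomials_mono[OF that(2)]])
  have gen: "\<exists>d. h \<in> rspan constants {0} (monomials B d)" if "h \<in> coord_ring" for h
    using that unfolding T
  proof (induction rule: poly_funs_at_induct)
    case (const c)
    have "1 \<in> monomials B 0" unfolding monomials_def by (intro image_eqI[of _ _ "[]"]) auto
    then have "(\<lambda>x. c * 1 x) \<in> rspan constants {0} (monomials B 0)"
      by (rule rspan_constants)
    then show ?case by (intro exI[of _ 0]) (simp only: one_fun_apply mult_1_right)
  next
    case (coord i)
    have "b i \<subseteq> monomials B 1"
    proof
      fix t assume "t \<in> b i"
      then have "t \<in> B" using coord unfolding B_def by blast
      then show "t \<in> monomials B 1" unfolding monomials_def by (intro image_eqI[of _ _ "[t]"]) auto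
    qed
    then have "(\<lambda>x. \<phi> (ret x) i) \<in> rspan constants {0} (monomials B 1)"
      using b coord by (blast intro: rspan_mono[OF _ order_refl order_refl])
    then show ?case by blast
  next
    case (add f g)
    then obtain d e where "f \<in> rspan constants {0} (monomials B d)" "g \<in> rspan constants {0} (monomials B e)"
      by blast
    then have "f + g \<in> rspan constants {0} (monomials B (max d e))"
      using mono[of f d "max d e"] mono[of g e "max d e"] by (intro rspan_add) simp_all
    then show ?case by blast
  next
    case (mult f g)
    then obtain d e where "f \<in> rspan constants {0} (monomials B d)" "g \<in> rspan constants {0} (monomials B e)"
      by blast
    then have "f * g \<in> rspan constants {0} (monomials B (d + e))"
      by (rule rspan_monomials_mult[OF constants_subring])
    then show ?case by blast
  qed
  have fin: "finite B" unfolding B_def using b by simp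
  have rat: "\<exists>f\<in>R0. t = (\<lambda>x. f (ret x))" if tB: "t \<in> B" for t
  proof -
    obtain i where "i < n" "t \<in> b i" using tB unfolding B_def by blast
    then show ?thesis using b[rule_format, of i] by simp
  qed
  show ?thesis by (rule that[OF fin rat gen])
qed

text \<open>
  By comultiplication, the translates of a regular function lie in the span of finitely many
  functions, which are the same for all translates.
\<close>

lemma translates_finite_dimensional:
  assumes "f \<in> regular G"
  shows "\<exists>\<Gamma>. finite \<Gamma> \<and> \<Gamma> \<subseteq> coord_ring \<and>
    (\<forall>n\<in>carrier G. (\<lambda>x. f (n \<otimes> ret x)) \<in> rspan constants {0} \<Gamma>)"
proof -
  obtain r u v where uv: "\<forall>i<(r::nat). u i \<in> regular G" "\<forall>i<r. v i \<in> regular G"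
    and f: "\<forall>x\<in>carrier G. \<forall>y\<in>carrier G. f (x \<otimes> y) = (\<Sum>i<r. u i x * v i y)"
    using assms by (rule comultiplication)
  let ?\<Gamma> = "(\<lambda>i x. v i (ret x)) ` {..<r}"
  have "(\<lambda>x. f (n \<otimes> ret x)) \<in> rspan constants {0} ?\<Gamma>" if n: "n \<in> carrier G" for n
  proof -
    have "(\<lambda>x. \<Sum>i<r. u i n * v i (ret x)) \<in> rspan constants {0} ?\<Gamma>"
      by (rule rspan_constants_sum) simp
    moreover have "(\<lambda>x. f (n \<otimes> ret x)) = (\<lambda>x. \<Sum>i<r. u i n * v i (ret x))"
      using f n ret_mem H_carrier by (intro ext) auto
    ultimately show ?thesis by (simp only:)
  qed
  moreover have "?\<Gamma> \<subseteq> coord_ring" using uv(2) unfolding coord_ring_def by auto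
  ultimately show ?thesis by (intro exI[of _ ?\<Gamma>]) simp
qed

lemma pullback_endo:
  assumes \<beta>: "morph H \<beta>" "\<beta> ` H \<subseteq> H"
  shows "subring_endo coord_ring (\<lambda>f x. f (\<beta> (ret x)))"
  unfolding subring_endo_def
proof (intro conjI ballI funcsetI)
  show "(\<lambda>x. f (\<beta> (ret x))) \<in> coord_ring" if "f \<in> coord_ring" for f
    by (rule coord_compose[OF that \<beta>])
qed (auto simp: fun_eq_iff)

text \<open>
  Comultiplication writes \<open>f (n x b)\<close> as a sum of products of translates \<open>u (n x)\<close> and functions \<open>v (b)\<close>.
  When \<open>b\<close> is a function of \<open>\<beta> x\<close>, the second factors lie in the image of the pullback along \<open>\<beta>\<close>;
  the first ones stay in a finite-dimensional space, whatever \<open>n\<close> and \<open>b\<close> are.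
\<close>

lemma two_sided_translate_span:
  assumes \<beta>: "morph H \<beta>" "\<beta> ` H \<subseteq> H" and f: "f \<in> regular G"
  shows "\<exists>\<Gamma>. finite \<Gamma> \<and> \<Gamma> \<subseteq> coord_ring \<and> (\<forall>n\<in>carrier G. \<forall>b. morph H b \<longrightarrow>
    (\<lambda>x. f ((n \<otimes> ret x) \<otimes> b (\<beta> (ret x)))) \<in> rspan ((\<lambda>f x. f (\<beta> (ret x))) ` coord_ring) {0} \<Gamma>)"
proof -
  let ?\<theta> = "\<lambda>f x. f (\<beta> (ret x)) :: 'k"
  let ?S = "?\<theta> ` coord_ring"
  have S: "unital_subring ?S" by (rule subring_endo_image[OF coord_subring pullback_endo[OF \<beta>]])
  obtain r u v where uv: "\<forall>i<(r::nat). u i \<in> regular G" "\<forall>i<r. v i \<in> regular G"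
    and f: "\<forall>x\<in>carrier G. \<forall>y\<in>carrier G. f (x \<otimes> y) = (\<Sum>i<r. u i x * v i y)"
    using f by (rule comultiplication)
  have "\<forall>i. \<exists>\<Gamma>. i < r \<longrightarrow> finite \<Gamma> \<and> \<Gamma> \<subseteq> coord_ring \<and>
      (\<forall>n\<in>carrier G. (\<lambda>x. u i (n \<otimes> ret x)) \<in> rspan constants {0} \<Gamma>)"
  proof
    fix i show "\<exists>\<Gamma>. i < r \<longrightarrow> finite \<Gamma> \<and> \<Gamma> \<subseteq> coord_ring \<and>
      (\<forall>n\<in>carrier G. (\<lambda>x. u i (n \<otimes> ret x)) \<in> rspan constants {0} \<Gamma>)"
    proof (cases "i < r")
      case True
      then show ?thesis
        using translates_finite_dimensional[OF uv(1)[rule_format, OF True]]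
        by (elim exE) (rule exI, rule impI, assumption)
    qed simp
  qed
  from choice[OF this] obtain \<gamma> where \<gamma>: "\<forall>i. i < r \<longrightarrow> finite (\<gamma> i) \<and> \<gamma> i \<subseteq> coord_ring \<and>
      (\<forall>n\<in>carrier G. (\<lambda>x. u i (n \<otimes> ret x)) \<in> rspan constants {0} (\<gamma> i))"
    by (elim exE)
  define \<Gamma> where "\<Gamma> = (\<Union>i<r. \<gamma> i)"
  have constS: "constants \<subseteq> ?S"
  proof
    fix h :: "'g \<Rightarrow> 'k" assume "h \<in> constants"
    then obtain c where "h = (\<lambda>_. c)" by blast
    then show "h \<in> ?S" by (intro image_eqI[of _ _ "\<lambda>_. c"]) (simp_all add: coord_const)
  qed
  have "(\<lambda>x. f ((n \<otimes> ret x) \<otimes> b (\<beta> (ret x)))) \<in> rspan ?S {0} \<Gamma>"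
    if n: "n \<in> carrier G" and b: "morph H b" for n b
  proof -
    have "(\<lambda>x. v i (b (\<beta> (ret x)))) * (\<lambda>x. u i (n \<otimes> ret x)) \<in> rspan ?S {0} \<Gamma>"
      if i: "i < r" for i
    proof (rule rspan_scale)
      have "\<gamma> i \<subseteq> \<Gamma>" unfolding \<Gamma>_def using i by blast
      then show "(\<lambda>x. u i (n \<otimes> ret x)) \<in> rspan ?S {0} \<Gamma>"
        using \<gamma>[rule_format, OF i] n constS by (intro rspan_mono[OF _ constS order_refl]) simp_all
      have "regular_on (regular G) H (\<lambda>x. v i (b x))"
        using b uv(2) i unfolding morphism_on_def by simp
      then have "(\<lambda>x. v i (b (ret x))) \<in> coord_ring" unfolding regular_on_coord_ring .
      moreover have "?\<theta> (\<lambda>x. v i (b (ret x))) = (\<lambda>x. v i (b (\<beta> (ret x))))"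
        using \<beta>(2) ret_mem by (intro ext) (simp add: ret_id image_subset_iff)
      ultimately have "(\<lambda>x. v i (b (\<beta> (ret x)))) \<in> ?S" by (intro image_eqI[of _ ?\<theta>]) simp_all
      then show "(\<lambda>x. v i (b (\<beta> (ret x)))) * s \<in> ?S" if "s \<in> ?S" for s
        using that by (rule subring_mult[OF S])
    qed simp
    then have "(\<Sum>i<r. (\<lambda>x. v i (b (\<beta> (ret x)))) * (\<lambda>x. u i (n \<otimes> ret x))) \<in> rspan ?S {0} \<Gamma>"
      by (intro rspan_sum) simp
    moreover have "(\<Sum>i<r. (\<lambda>x. v i (b (\<beta> (ret x)))) * (\<lambda>x. u i (n \<otimes> ret x))) =
        (\<lambda>x. f ((n \<otimes> ret x) \<otimes> b (\<beta> (ret x))))"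
    proof
      fix x
      have "b (\<beta> (ret x)) \<in> carrier G" "n \<otimes> ret x \<in> carrier G"
        using b \<beta>(2) n ret_mem[of x] H_carrier unfolding morphism_on_def by blast+
      then show "(\<Sum>i<r. (\<lambda>x. v i (b (\<beta> (ret x)))) * (\<lambda>x. u i (n \<otimes> ret x))) x =
          f ((n \<otimes> ret x) \<otimes> b (\<beta> (ret x)))"
        using f by (simp add: sum_fun_apply mult.commute)
    qed
    ultimately show ?thesis by (simp only:)
  qed
  moreover have "finite \<Gamma>" "\<Gamma> \<subseteq> coord_ring" unfolding \<Gamma>_def using \<gamma> by auto
  ultimately show ?thesis by (intro exI[of _ \<Gamma>]) simp
qed

end

section \<open>The Lang-Steinberg theorem\<close>

lemma (in group) inv_cancel_left:
  assumes "x \<in> carrier G" "z \<in> carrier G"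
  shows "inv x \<otimes> (x \<otimes> z) = z" "x \<otimes> (inv x \<otimes> z) = z"
  using assms by (simp_all add: m_assoc[symmetric])

context closed_subgroup
begin

lemma finite_set_bounded_degree:
  assumes gen: "\<And>h. h \<in> coord_ring \<Longrightarrow> \<exists>d. h \<in> rspan constants {0} (monomials B d)"
    and "finite X" "X \<subseteq> coord_ring"
  shows "\<exists>D. X \<subseteq> rspan constants {0} (monomials B D)"
  using assms(2,3)
proof (induction X rule: finite_induct)
  case (insert h X)
  have "X \<subseteq> coord_ring" using insert.prems by blast
  from insert.IH[OF this] obtain D where D: "X \<subseteq> rspan constants {0} (monomials B D)" by (elim exE)
  obtain d where d: "h \<in> rspan constants {0} (monomials B d)" using gen insert.prems by blast
  have mono: "v \<in> rspan constants {0} (monomials B (max d D))"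
    if "v \<in> rspan constants {0} (monomials B e)" "e \<le> max d D" for v e
    by (rule rspan_mono[OF that(1) order_refl order_refl monomials_mono[OF that(2)]])
  have "insert h X \<subseteq> rspan constants {0} (monomials B (max d D))"
  proof
    fix v assume "v \<in> insert h X"
    then show "v \<in> rspan constants {0} (monomials B (max d D))"
      using mono[of v d, OF _ max.cobounded1] mono[of v D, OF _ max.cobounded2] d D by blast
  qed
  then show ?case by blast
qed simp

text \<open>
  Put \<open>\<sigma> x = w F(x) w\<inverse>\<close>, so that \<open>\<sigma> x = x \<beta>(x)\<close>. Iterating, \<open>\<sigma>\<^sup>j x = x c(\<beta> x)\<close> with a morphism
  \<open>c\<close>, while also \<open>\<sigma>\<^sup>j x = n F\<^sup>j(x) n\<inverse>\<close>. If \<open>j = m s\<close> and \<open>F\<^sup>m\<close> is a Frobenius morphism, then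
  \<open>f(x) ^ (q ^ s) = f(F\<^sup>j x) = f(n\<inverse> x c(\<beta> x) n)\<close> for rational \<open>f\<close>, which is a combination of
  translates of \<open>f\<close> with coefficients pulled back along \<open>\<beta>\<close>. For large \<open>s\<close>, these relations reduce
  monomials in the generators to bounded degree.
\<close>

lemma lang_map_finite:
  assumes char: "CHAR('k) > 0" and F: "steinberg_endomorphism G F" and w: "w \<in> carrier G"
    and stable: "\<And>x. x \<in> H \<Longrightarrow> w \<otimes> F x \<otimes> inv w \<in> H"
  defines "\<beta> \<equiv> \<lambda>x. inv x \<otimes> (w \<otimes> F x \<otimes> inv w)"
  shows "morph H \<beta>" "\<beta> ` H \<subseteq> H"
    "\<exists>M. finite M \<and> M \<subseteq> coord_ring \<and> coord_ring \<subseteq> rspan ((\<lambda>f x. f (\<beta> (ret x))) ` coord_ring) {0} M"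
proof -
  have hom: "F \<in> hom G G" and regF: "morph (carrier G) F"
    using F unfolding steinberg_endomorphism_def regular_map_iff_morphism_on[OF variety] by auto
  obtain m e R0 where m: "m \<ge> 1" "e \<ge> 1" and struct: "Fq_structure (CHAR('k) ^ e) (carrier G) (regular G) R0"
    and frob: "frobenius_morphism (CHAR('k) ^ e) (carrier G) (regular G) R0 (F ^^ m)"
    using F unfolding steinberg_endomorphism_def by blast
  define q where "q = CHAR('k) ^ e"
  have "CHAR('k) \<noteq> 1" by (metis of_nat_1 of_nat_CHAR zero_neq_one)
  then have "CHAR('k) \<ge> 2" using char by linarith
  then have q: "q \<ge> 2" 
    unfolding q_def using power_increasing[of 1 e "CHAR('k)"] m(2) by simp
  have Fc: "F x \<in> carrier G" if "x \<in> carrier G" for x using hom_in_carrier[OF hom that] .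
  have Fm: "F (x \<otimes> y) = F x \<otimes> F y" if "x \<in> carrier G" "y \<in> carrier G" for x y
    using hom_mult[OF hom that] .
  define \<sigma> where "\<sigma> x = w \<otimes> F x \<otimes> inv w" for x
  have \<sigma>c: "\<sigma> x \<in> carrier G" if "x \<in> carrier G" for x unfolding \<sigma>_def using that w Fc by simp
  have \<sigma>m: "\<sigma> (x \<otimes> y) = \<sigma> x \<otimes> \<sigma> y" if "x \<in> carrier G" "y \<in> carrier G" for x y
    unfolding \<sigma>_def using that w Fc by (simp add: Fm m_assoc inv_cancel_left)
  have \<sigma>H: "\<sigma> x \<in> H" if "x \<in> H" for x unfolding \<sigma>_def by (rule stable[OF that])
  have \<sigma>morph: "morph (carrier G) \<sigma>"
    unfolding \<sigma>_def by (intro morph_intros regF) (use w in auto)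
  have \<beta>: "\<beta> x = inv x \<otimes> \<sigma> x" for x unfolding \<beta>_def \<sigma>_def ..
  show \<beta>morph: "morph H \<beta>"
    unfolding \<beta> using H_carrier by (intro morph_intros morphism_on_subset[OF \<sigma>morph]) auto
  show \<beta>H: "\<beta> ` H \<subseteq> H"
    unfolding \<beta> using \<sigma>H subgroup.m_closed[OF subgroup] subgroup.m_inv_closed[OF subgroup] by blast
  have Hc: "x \<in> carrier G" if "x \<in> H" for x using that H_carrier by blast
  have Fpow: "(F ^^ j) x \<in> carrier G" if "x \<in> carrier G" for j x
    using that by (induction j) (auto intro: Fc)
  have twist: "\<exists>n\<in>carrier G. \<forall>x\<in>carrier G. (\<sigma> ^^ j) x = n \<otimes> (F ^^ j) x \<otimes> inv n" for j
  proof (induction j)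
    case 0
    then show ?case by (intro bexI[of _ \<one>]) auto
  next
    case (Suc j)
    then obtain n where n: "n \<in> carrier G" "\<forall>x\<in>carrier G. (\<sigma> ^^ j) x = n \<otimes> (F ^^ j) x \<otimes> inv n"
      by blast
    have Finv: "F (inv n) = inv (F n)"
      using group_hom.hom_inv[of G G F n] hom n(1) by (simp add: group_hom_def group_hom_axioms_def group_axioms)
    have "(\<sigma> ^^ Suc j) x = (w \<otimes> F n) \<otimes> (F ^^ Suc j) x \<otimes> inv (w \<otimes> F n)" if x: "x \<in> carrier G" for x
      using n x w Fpow[OF x, of j] Fc by (simp add: \<sigma>_def Fm Finv inv_mult_group m_assoc)
    then show ?case using w Fc[OF n(1)] by (intro bexI[of _ "w \<otimes> F n"]) auto
  qed
  have cocycle: "\<exists>c. morph H c \<and> c ` H \<subseteq> H \<and> (\<forall>x\<in>H. (\<sigma> ^^ j) x = x \<otimes> c (\<beta> x))" for j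
  proof (induction j)
    case 0
    have "morph H (\<lambda>_. \<one>)" using H_carrier by (intro morph_intros) auto
    then show ?case
      using subgroup.one_closed[OF subgroup] Hc by (intro exI[of _ "\<lambda>_. \<one>"]) auto
  next
    case (Suc j)
    then obtain c where c: "morph H c" "c ` H \<subseteq> H" "\<forall>x\<in>H. (\<sigma> ^^ j) x = x \<otimes> c (\<beta> x)" by blast
    have "morph H (\<lambda>x. x \<otimes> \<sigma> (c x))"
      using H_carrier c
      by (intro morph_intros morphism_on_compose[OF c(1) \<sigma>morph]) auto
    moreover have "(\<lambda>x. x \<otimes> \<sigma> (c x)) ` H \<subseteq> H"
      using c(2) \<sigma>H subgroup.m_closed[OF subgroup] by blast
    moreover have "(\<sigma> ^^ Suc j) x = x \<otimes> (\<beta> x \<otimes> \<sigma> (c (\<beta> x)))" if x: "x \<in> H" for x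
    proof -
      have "\<beta> x \<in> H" using \<beta>H x by blast
      then have "c (\<beta> x) \<in> H" using c(2) by blast
      then have mem: "x \<in> carrier G" "c (\<beta> x) \<in> carrier G" "\<sigma> x \<in> carrier G" "\<sigma> (c (\<beta> x)) \<in> carrier G"
        using x Hc \<sigma>c by auto
      have "(\<sigma> ^^ Suc j) x = \<sigma> x \<otimes> \<sigma> (c (\<beta> x))" using c(3) x mem \<sigma>m by simp
      also have "\<sigma> x = x \<otimes> \<beta> x" unfolding \<beta> using mem by (simp add: m_assoc[symmetric])
      finally show ?thesis using mem unfolding \<beta> by (simp add: m_assoc)
    qed
    ultimately show ?case by (intro exI[of _ "\<lambda>x. x \<otimes> \<sigma> (c x)"]) simp
  qed
  have power: "f ((F ^^ (m * s)) x) = f x ^ (q ^ s)" if f: "f \<in> R0" and x: "x \<in> carrier G" for f s x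
  proof (induction s)
    case (Suc s)
    have "(F ^^ (m * Suc s)) x = (F ^^ m) ((F ^^ (m * s)) x)" by (simp add: funpow_add)
    then have "f ((F ^^ (m * Suc s)) x) = f ((F ^^ (m * s)) x) ^ q"
      using frob f Fpow[OF x] unfolding frobenius_morphism_def q_def by simp
    then show ?case using Suc by (simp add: power_mult[symmetric] mult.commute)
  qed simp
  let ?\<theta> = "\<lambda>f x. f (\<beta> (ret x)) :: 'k"
  let ?S = "?\<theta> ` coord_ring"
  have S: "unital_subring ?S" by (rule subring_endo_image[OF coord_subring pullback_endo[OF \<beta>morph \<beta>H]])
  have constS: "constants \<subseteq> ?S"
  proof
    fix h :: "'g \<Rightarrow> 'k" assume "h \<in> constants"
    then obtain c where "h = (\<lambda>_. c)" by blast
    then show "h \<in> ?S" by (intro image_eqI[of _ _ "\<lambda>_. c"]) (simp_all add: coord_const)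
  qed
  obtain B where B: "finite B" "\<And>t. t \<in> B \<Longrightarrow> \<exists>f\<in>R0. t = (\<lambda>x. f (ret x))"
    and gen: "\<And>h. h \<in> coord_ring \<Longrightarrow> \<exists>d. h \<in> rspan constants {0} (monomials B d)"
    by (rule coord_generators[OF struct]) blast
  have R0: "R0 \<subseteq> regular G" using struct unfolding Fq_structure_def by (elim conjE)
  have BT: "B \<subseteq> coord_ring"
  proof
    fix t assume "t \<in> B"
    then obtain f where "f \<in> R0" "t = (\<lambda>x. f (ret x))" using B(2) by blast
    then show "t \<in> coord_ring" using R0 unfolding coord_ring_def by auto
  qed
  \<comment> \<open>The span of \<open>\<Gamma> t\<close> contains the powers of \<open>t\<close> by all \<open>q ^ s\<close>: its choice does not depend
     on \<open>s\<close>, so that \<open>q ^ s\<close> can be taken beyond the degrees that occur in it.\<close>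
  have "\<forall>t. \<exists>\<Gamma>. t \<in> B \<longrightarrow> finite \<Gamma> \<and> \<Gamma> \<subseteq> coord_ring \<and> (\<forall>s. t ^ (q ^ s) \<in> rspan ?S {0} \<Gamma>)"
  proof
    fix t show "\<exists>\<Gamma>. t \<in> B \<longrightarrow> finite \<Gamma> \<and> \<Gamma> \<subseteq> coord_ring \<and> (\<forall>s. t ^ (q ^ s) \<in> rspan ?S {0} \<Gamma>)"
    proof (cases "t \<in> B")
      case True
      then obtain f where f: "f \<in> R0" "t = (\<lambda>x. f (ret x))" using B(2) by blast
      have fR: "f \<in> regular G" using f(1) R0 by blast
      obtain \<Gamma> where \<Gamma>: "finite \<Gamma>" "\<Gamma> \<subseteq> coord_ring"
        "\<forall>n\<in>carrier G. \<forall>b. morph H b \<longrightarrow> (\<lambda>x. f ((n \<otimes> ret x) \<otimes> b (\<beta> (ret x)))) \<in> rspan ?S {0} \<Gamma>"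
        using two_sided_translate_span[OF \<beta>morph \<beta>H fR] by (elim exE conjE) (rule that)
      have "t ^ (q ^ s) \<in> rspan ?S {0} \<Gamma>" for s
      proof -
        obtain n where n: "n \<in> carrier G"
          "\<forall>x\<in>carrier G. (\<sigma> ^^ (m * s)) x = n \<otimes> (F ^^ (m * s)) x \<otimes> inv n"
          using twist[of "m * s"] by blast
        obtain c where c: "morph H c" "c ` H \<subseteq> H" "\<forall>x\<in>H. (\<sigma> ^^ (m * s)) x = x \<otimes> c (\<beta> x)"
          using cocycle[of "m * s"] by blast
        have "morph H (\<lambda>y. c y \<otimes> n)" using H_carrier n(1) by (intro morph_intros c) auto
        then have "(\<lambda>x. f ((inv n \<otimes> ret x) \<otimes> (c (\<beta> (ret x)) \<otimes> n))) \<in> rspan ?S {0} \<Gamma>"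
          using \<Gamma>(3)[rule_format, of "inv n" "\<lambda>y. c y \<otimes> n"] n(1) by simp
        moreover have "(\<lambda>x. f ((inv n \<otimes> ret x) \<otimes> (c (\<beta> (ret x)) \<otimes> n))) = t ^ (q ^ s)"
        proof
          fix x
          let ?y = "(F ^^ (m * s)) (ret x)"
          have r: "ret x \<in> H" "ret x \<in> carrier G" using ret_mem Hc by auto
          then have "c (\<beta> (ret x)) \<in> H" using \<beta>H c(2) by blast
          then have cc: "c (\<beta> (ret x)) \<in> carrier G" by (rule Hc)
          have y: "?y \<in> carrier G" by (rule Fpow[OF r(2)])
          have eq: "n \<otimes> ?y \<otimes> inv n = ret x \<otimes> c (\<beta> (ret x))"
            using n(2) c(3) r by metis
          have "?y = inv n \<otimes> (n \<otimes> ?y \<otimes> inv n) \<otimes> n"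
            using n(1) y by (simp add: m_assoc) (simp add: m_assoc[symmetric])
          also have "\<dots> = (inv n \<otimes> ret x) \<otimes> (c (\<beta> (ret x)) \<otimes> n)"
            unfolding eq using n(1) r(2) cc by (simp add: m_assoc)
          finally have "f ((inv n \<otimes> ret x) \<otimes> (c (\<beta> (ret x)) \<otimes> n)) = f ?y" by (simp only:)
          also have "\<dots> = f (ret x) ^ (q ^ s)" by (rule power[OF f(1) r(2)])
          also have "\<dots> = (t ^ (q ^ s)) x" unfolding f(2) power_fun_apply ..
          finally show "f ((inv n \<otimes> ret x) \<otimes> (c (\<beta> (ret x)) \<otimes> n)) = (t ^ (q ^ s)) x" .
        qed
        ultimately show ?thesis by (simp only:)
      qed
      then show ?thesis using \<Gamma> by (intro exI[of _ \<Gamma>]) simp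
    qed simp
  qed
  from choice[OF this] obtain \<gamma> where \<gamma>: "\<forall>t. t \<in> B \<longrightarrow> finite (\<gamma> t) \<and> \<gamma> t \<subseteq> coord_ring \<and>
      (\<forall>s. t ^ (q ^ s) \<in> rspan ?S {0} (\<gamma> t))"
    by (elim exE)
  have "\<exists>D. (\<Union>t\<in>B. \<gamma> t) \<subseteq> rspan constants {0} (monomials B D)"
    by (rule finite_set_bounded_degree[OF gen]) (use B(1) \<gamma> in auto)
  then obtain D where D: "(\<Union>t\<in>B. \<gamma> t) \<subseteq> rspan constants {0} (monomials B D)" by blast
  have "D < 2 ^ D" by (rule less_exp)
  also have "2 ^ D \<le> q ^ D" using q by (intro power_mono) auto
  finally have DQ: "D < q ^ D" .
  have DS: "h \<in> rspan ?S {0} (monomials B e)" if "h \<in> rspan constants {0} (monomials B e)" for h e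
    by (rule rspan_mono[OF that constS order_refl order_refl])
  have "monomials B e \<subseteq> rspan ?S {0} (monomials B (card B * q ^ D))" for e
  proof (rule monomials_span_bounded[OF S B(1) _ DQ])
    fix t assume t: "t \<in> B"
    show "t ^ (q ^ D) \<in> rspan ?S {0} (monomials B D)"
    proof (rule rspan_trans[OF S])
      show "t ^ (q ^ D) \<in> rspan ?S {0} (\<gamma> t)" using \<gamma> t by simp
      show "\<gamma> t \<subseteq> rspan ?S {0} (monomials B D)" using D t DS by blast
    qed
  qed
  then have "coord_ring \<subseteq> rspan ?S {0} (monomials B (card B * q ^ D))"
    using gen DS rspan_trans[OF S] by blast
  moreover have "finite (monomials B (card B * q ^ D))" by (rule finite_monomials[OF B(1)])
  moreover have "monomials B d \<subseteq> coord_ring" for d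
    unfolding monomials_def using BT by (auto intro!: subring_prod_list[OF coord_subring])
  ultimately show "\<exists>M. finite M \<and> M \<subseteq> coord_ring \<and> coord_ring \<subseteq> rspan ?S {0} M" by blast
qed

end

text \<open>
  The pullback \<open>\<theta>\<close> along \<open>\<beta>\<close> is a finite endomorphism of a noetherian domain, so injective. The character
  \<open>f \<mapsto> f b\<close> therefore extends through \<open>\<theta>\<close> to a character of the coordinate ring. The latter is the
  evaluation at a point \<open>a\<close>, and \<open>f (\<beta> a) = f b\<close> for all \<open>f\<close> means \<open>\<beta> a = b\<close>.
\<close>

theorem lang_steinberg:
  fixes G :: "('g, 'k::alg_closed_field) alg_group" (structure)
  assumes "closed_subgroup G H" and conn: "connectedin (group_zariski G) H"
    and "CHAR('k) > 0" "steinberg_endomorphism G F" "w \<in> carrier G"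
    and "\<And>x. x \<in> H \<Longrightarrow> w \<otimes> F x \<otimes> inv w \<in> H" and b: "b \<in> H"
  obtains a where "a \<in> H" "inv a \<otimes> (w \<otimes> F a \<otimes> inv w) = b"
proof -
  interpret closed_subgroup G H by fact
  define \<beta> where "\<beta> x = inv x \<otimes> (w \<otimes> F x \<otimes> inv w)" for x
  have \<beta>: "morph H \<beta>" "\<beta> ` H \<subseteq> H"
    and fin: "\<exists>M. finite M \<and> M \<subseteq> coord_ring \<and>
      coord_ring \<subseteq> rspan ((\<lambda>f x. f (\<beta> (ret x))) ` coord_ring) {0} M"
    unfolding \<beta>_def by (rule lang_map_finite[OF assms(3-5)], erule assms(6))+
  define \<theta> :: "('g \<Rightarrow> 'k) \<Rightarrow> 'g \<Rightarrow> 'k" where "\<theta> = (\<lambda>f x. f (\<beta> (ret x)))"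
  have endo: "subring_endo coord_ring \<theta>" unfolding \<theta>_def by (rule pullback_endo[OF \<beta>])
  obtain M where M: "finite M" "M \<subseteq> coord_ring" "coord_ring \<subseteq> rspan (\<theta> ` coord_ring) {0} M"
    using fin[folded \<theta>_def] by (elim exE conjE) (rule that)
  have inj: "f = 0" if "f \<in> coord_ring" "\<theta> f = 0" for f
    by (rule finite_endo_injective[OF coord_subring coord_noetherian _ endo M that])
      (rule coord_domain[OF conn])
  have scalars: "constants \<subseteq> coord_ring" using coord_const by auto
  obtain m where m: "ideal_in coord_ring m" "1 \<notin> m"
    and res: "\<And>f. f \<in> coord_ring \<Longrightarrow> \<exists>c. f - (\<lambda>_. c) \<in> m"
    and lift: "\<And>f. f \<in> coord_ring \<Longrightarrow> \<theta> f - (\<lambda>_. f b) \<in> m"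
  proof (rule extend_character[where \<kappa> = "\<lambda>f. f b", OF coord_subring scalar_embedding_const scalars endo _ inj M])
    show "\<theta> (\<lambda>_. c) = (\<lambda>_. c)" for c by (simp add: \<theta>_def)
  qed (simp_all add: that)
  obtain a where a: "a \<in> H" and eval: "\<And>f. f \<in> coord_ring \<Longrightarrow> f - (\<lambda>_. f a) \<in> m"
    using residue_point[OF m res] by blast
  have agree: "f (\<beta> a) = f b" if f: "f \<in> coord_ring" for f
  proof -
    have "\<theta> f \<in> coord_ring" by (rule subring_endoD(1)[OF endo f])
    then have "\<theta> f - (\<lambda>_. \<theta> f a) \<in> m" by (rule eval)
    then have "(\<theta> f - (\<lambda>_. f b)) - (\<theta> f - (\<lambda>_. \<theta> f a)) \<in> m"
      by (rule ideal_diff[OF coord_subring m(1) lift[OF f]])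
    moreover have "(\<theta> f - (\<lambda>_. f b)) - (\<theta> f - (\<lambda>_. \<theta> f a)) = (\<lambda>_. \<theta> f a - f b)"
      by (auto simp: fun_eq_iff)
    ultimately have "(\<lambda>_. \<theta> f a - f b) \<in> m" by (simp only:)
    then have "\<theta> f a - f b = 0"
      by (rule scalar_mem_maximal_ideal[OF scalar_embedding_const m scalars])
    then show ?thesis using a by (simp add: \<theta>_def ret_id)
  qed
  have "\<beta> a = b"
  proof (rule affine_variety_separates[OF variety])
    have \<beta>a: "\<beta> a \<in> H" using \<beta>(2) a by blast
    then show "\<beta> a \<in> carrier G" "b \<in> carrier G" using H_carrier b by auto
    fix f assume "f \<in> regular G"
    then have "(\<lambda>x. f (ret x)) \<in> coord_ring" unfolding coord_ring_def by blast
    from agree[OF this] show "f (\<beta> a) = f b" using \<beta>a b by (simp add: ret_id)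
  qed
  then show ?thesis using that a unfolding \<beta>_def by blast
qed

section \<open>Fixed points of twisted Steinberg endomorphisms\<close>

context linear_algebraic_group
begin

lemma conjugate_closed: "g \<in> carrier G \<Longrightarrow> x \<in> carrier G \<Longrightarrow> conjugate G g x \<in> carrier G"
  by (simp add: conjugate_def)

lemma conjugate_mult:
  "g \<in> carrier G \<Longrightarrow> x \<in> carrier G \<Longrightarrow> y \<in> carrier G \<Longrightarrow>
    conjugate G g (x \<otimes> y) = conjugate G g x \<otimes> conjugate G g y"
  by (simp add: conjugate_def m_assoc inv_cancel_left)

lemma conjugate_conjugate:
  "g \<in> carrier G \<Longrightarrow> h \<in> carrier G \<Longrightarrow> x \<in> carrier G \<Longrightarrow>
    conjugate G g (conjugate G h x) = conjugate G (g \<otimes> h) x"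
  by (simp add: conjugate_def m_assoc inv_mult_group)

lemma conjugate_one: "x \<in> carrier G \<Longrightarrow> conjugate G \<one> x = x"
  by (simp add: conjugate_def)

lemma conjugate_inverse:
  "g \<in> carrier G \<Longrightarrow> x \<in> carrier G \<Longrightarrow> conjugate G (inv g) (conjugate G g x) = x"
  "g \<in> carrier G \<Longrightarrow> x \<in> carrier G \<Longrightarrow> conjugate G g (conjugate G (inv g) x) = x"
  by (simp_all add: conjugate_conjugate conjugate_one)

lemma conjugate_iso:
  assumes "g \<in> carrier G" "X \<subseteq> carrier G" "conjugate G g ` X = Y"
  shows "G\<lparr>carrier := X\<rparr> \<cong> G\<lparr>carrier := Y\<rparr>"
proof (rule is_isoI)
  have "inj_on (conjugate G g) X"
    using assms(1,2) conjugate_inverse(1) by (intro inj_on_inverseI[of _ "conjugate G (inv g)"]) auto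
  then show "conjugate G g \<in> iso (G\<lparr>carrier := X\<rparr>) (G\<lparr>carrier := Y\<rparr>)"
    using assms conjugate_mult by (auto simp: iso_def hom_def bij_betw_def subset_iff)
qed

lemma conjugate_iso_sym:
  assumes "g \<in> carrier G" "X \<subseteq> carrier G" "conjugate G g ` X = Y"
  shows "G\<lparr>carrier := Y\<rparr> \<cong> G\<lparr>carrier := X\<rparr>"
proof (rule conjugate_iso[of "inv g"])
  show "Y \<subseteq> carrier G" using assms conjugate_closed by auto
  show "conjugate G (inv g) ` Y = X"
    unfolding assms(3)[symmetric] image_image
    using assms(1,2) conjugate_inverse(1) by (simp add: subset_iff cong: image_cong_simp)
qed (use assms in simp)

lemma conjugate_fixed_points:
  assumes "conjugate G g ` X = Y"
    and "\<And>x. x \<in> X \<Longrightarrow> \<sigma> x = x \<longleftrightarrow> \<tau> (conjugate G g x) = conjugate G g x"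
  shows "conjugate G g ` fixed_points X \<sigma> = fixed_points Y \<tau>"
  using assms unfolding fixed_points_def by auto

lemma conjugate_component_subset:
  assumes "g \<in> carrier G" "A \<subseteq> carrier G"
  shows "conjugate G g ` centralizer_component G A \<subseteq> centralizer_component G (conjugate G g ` A)"
proof (rule identity_component_image)
  have A': "conjugate G g ` A \<subseteq> carrier G" using assms conjugate_closed by blast
  show C: "centralizer G A \<subseteq> carrier G" "centralizer G (conjugate G g ` A) \<subseteq> carrier G"
    unfolding centralizer_def by auto
  show "morph (carrier G) (conjugate G g)" using assms(1) by (intro morph_conjugate) auto
  show "conjugate G g ` centralizer G A \<subseteq> centralizer G (conjugate G g ` A)"
  proof clarify
    fix x assume x: "x \<in> centralizer G A"
    have "conjugate G g x \<otimes> conjugate G g a = conjugate G g a \<otimes> conjugate G g x" if a: "a \<in> A" for a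
    proof -
      have "x \<in> carrier G" "a \<in> carrier G" "x \<otimes> a = a \<otimes> x"
        using x a assms(2) unfolding centralizer_def by auto
      then show ?thesis using assms(1) by (metis conjugate_mult)
    qed
    then show "conjugate G g x \<in> centralizer G (conjugate G g ` A)"
      using x assms(1) conjugate_closed unfolding centralizer_def by auto
  qed
  show "\<one> \<in> centralizer_component G A"
    using one_identity_component[OF C(1)] subgroup.one_closed[OF centralizer_subgroup[OF assms(2)]] .
  have "conjugate G g \<one> = \<one>" using assms(1) by (simp add: conjugate_def)
  then show "conjugate G g \<one> \<in> centralizer_component G (conjugate G g ` A)"
    using one_identity_component[OF C(2)] subgroup.one_closed[OF centralizer_subgroup[OF A']] by simp
qed

lemma conjugate_component:
  assumes "g \<in> carrier G" "A \<subseteq> carrier G"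
  shows "conjugate G g ` centralizer_component G A = centralizer_component G (conjugate G g ` A)"
proof (rule subset_antisym[OF conjugate_component_subset[OF assms]])
  let ?A = "conjugate G g ` A"
  have A': "?A \<subseteq> carrier G" using assms conjugate_closed by blast
  have undo: "conjugate G (inv g) ` ?A = A"
    unfolding image_image using assms conjugate_inverse(1) by (simp add: subset_iff cong: image_cong_simp)
  show "centralizer_component G ?A \<subseteq> conjugate G g ` centralizer_component G A"
  proof
    fix y assume y: "y \<in> centralizer_component G ?A"
    have "centralizer G ?A \<subseteq> carrier G" unfolding centralizer_def by auto
    then have yG: "y \<in> carrier G" using y identity_component_subset by blast
    have "conjugate G (inv g) y \<in> centralizer_component G A"
      using conjugate_component_subset[of "inv g" ?A] A' assms(1) y unfolding undo by auto
    then show "y \<in> conjugate G g ` centralizer_component G A"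
      using conjugate_inverse(2)[OF assms(1) yG] by (metis imageI)
  qed
qed

end

text \<open>
  Since \<open>F\<close> fixes \<open>A\<close> pointwise, it maps \<open>C\<^sub>G(A)\<close> to itself; so does conjugation by \<open>w\<close>.
\<close>

lemma twisted_endo_stabilizes_component:
  fixes G :: "('g, 'k::field) alg_group" (structure)
  assumes G: "linear_algebraic_group G" and F: "steinberg_endomorphism G F"
    and A: "A \<subseteq> carrier G" "\<forall>a\<in>A. F a = a"
    and w: "w \<in> centralizer G A" and x: "x \<in> centralizer_component G A"
  shows "conjugate G w (F x) \<in> centralizer_component G A"
proof -
  interpret linear_algebraic_group G by fact
  let ?C = "centralizer G A"
  note C = centralizer_subgroup[OF A(1)]
  have CG: "?C \<subseteq> carrier G" by (rule subgroup.subset[OF C])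
  have oneH: "\<one> \<in> identity_component G ?C"
    by (rule one_identity_component[OF CG subgroup.one_closed[OF C]])
  have wG: "w \<in> carrier G" using w CG by blast
  have hom: "F \<in> hom G G" and regF: "morph (carrier G) F"
    using F unfolding steinberg_endomorphism_def regular_map_iff_morphism_on[OF variety] by auto
  have Fc: "F y \<in> carrier G" if "y \<in> carrier G" for y using hom_in_carrier[OF hom that] .
  have FC: "F y \<in> ?C" if "y \<in> ?C" for y
  proof -
    have "F y \<otimes> a = a \<otimes> F y" if a: "a \<in> A" for a
    proof -
      have "y \<in> carrier G" "a \<in> carrier G" "y \<otimes> a = a \<otimes> y"
        using \<open>y \<in> ?C\<close> a A(1) unfolding centralizer_def by auto
      then show ?thesis using hom_mult[OF hom] A(2)[rule_format, OF a] by metis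
    qed
    then show ?thesis using that Fc unfolding centralizer_def by auto
  qed
  have "(\<lambda>x. conjugate G w (F x)) ` identity_component G ?C \<subseteq> identity_component G ?C"
  proof (rule identity_component_image[OF CG CG _ _ oneH])
    show "morph (carrier G) (\<lambda>x. conjugate G w (F x))"
      using wG Fc by (intro morphism_on_compose[OF regF morph_conjugate[OF wG order_refl]]) auto
    show "(\<lambda>x. conjugate G w (F x)) ` ?C \<subseteq> ?C"
      unfolding conjugate_def
      by (intro image_subsetI subgroup.m_closed[OF C] subgroup.m_inv_closed[OF C] FC w)
    show "conjugate G w (F \<one>) \<in> identity_component G ?C"
      using oneH wG unfolding hom_one[OF hom is_group is_group] by (simp add: conjugate_def)
  qed
  then show ?thesis using x by blast
qed

text \<open>
  If \<open>h = a\<inverse> \<sigma>(a)\<close> with \<open>\<sigma> = wF\<close>, then conjugation by \<open>a\<close> carries the fixed points of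
  \<open>hwF\<close> to those of \<open>wF\<close>. Such an \<open>a\<close> exists by the Lang-Steinberg theorem for the connected
  group \<open>C\<^sub>G(A)\<degree>\<close>.
\<close>

lemma twist_by_component_iso:
  fixes G :: "('g, 'k::alg_closed_field) alg_group" (structure)
  assumes G: "linear_algebraic_group G" and "CHAR('k) > 0" and F: "steinberg_endomorphism G F"
    and A: "A \<subseteq> carrier G" "\<forall>a\<in>A. F a = a"
    and w: "w \<in> centralizer G A" and h: "h \<in> centralizer_component G A"
  shows "fixed_group G A (\<lambda>x. conjugate G (h \<otimes> w) (F x)) \<cong> fixed_group G A (\<lambda>x. conjugate G w (F x))"
proof -
  interpret linear_algebraic_group G by fact
  let ?C = "centralizer G A"
  define H where "H = centralizer_component G A"
  note C = centralizer_subgroup[OF A(1)]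
  have CG: "?C \<subseteq> carrier G" by (rule subgroup.subset[OF C])
  have HC: "H \<subseteq> ?C" unfolding H_def by (rule identity_component_subset[OF CG])
  have wG: "w \<in> carrier G" and hG: "h \<in> carrier G" using w h CG HC unfolding H_def by auto
  have hom: "F \<in> hom G G" and regF: "morph (carrier G) F"
    using F unfolding steinberg_endomorphism_def regular_map_iff_morphism_on[OF variety] by auto
  have Fc: "F x \<in> carrier G" if "x \<in> carrier G" for x using hom_in_carrier[OF hom that] .
  have Fm: "F (x \<otimes> y) = F x \<otimes> F y" if "x \<in> carrier G" "y \<in> carrier G" for x y
    using hom_mult[OF hom that] .
  have F1: "F \<one> = \<one>" by (rule hom_one[OF hom is_group is_group])
  define \<sigma> where "\<sigma> x = conjugate G w (F x)" for x
  have stable: "w \<otimes> F x \<otimes> inv w \<in> H" if "x \<in> H" for x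
    using twisted_endo_stabilizes_component[OF G F A w] that unfolding H_def conjugate_def .
  have sub: "closed_subgroup G H"
    unfolding H_def closed_subgroup_def closed_subgroup_axioms_def
    by (intro conjI G identity_component_subgroup C identity_component_closed centralizer_closed A(1))
  interpret H: closed_subgroup G H by (rule sub)
  have "connectedin (group_zariski G) H"
    unfolding H_def by (rule identity_component_connected[OF CG])
  then obtain a where a: "a \<in> H" "inv a \<otimes> (w \<otimes> F a \<otimes> inv w) = h"
    using lang_steinberg[OF sub _ assms(2) F wG stable] h unfolding H_def by blast
  have aG: "a \<in> carrier G" using a(1) H.H_carrier by blast
  have \<sigma>c: "\<sigma> x \<in> carrier G" if "x \<in> carrier G" for x
    unfolding \<sigma>_def using that wG Fc by (simp add: conjugate_closed)
  have \<sigma>a: "\<sigma> a = a \<otimes> h"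
    unfolding \<sigma>_def conjugate_def a(2)[symmetric] using aG wG Fc by (simp add: inv_cancel_left)
  have \<sigma>m: "\<sigma> (x \<otimes> y) = \<sigma> x \<otimes> \<sigma> y" if "x \<in> carrier G" "y \<in> carrier G" for x y
    unfolding \<sigma>_def using that wG Fc by (simp add: Fm conjugate_mult)
  have \<sigma>inv: "\<sigma> (inv a) = inv (a \<otimes> h)"
  proof -
    have "\<sigma> a \<otimes> \<sigma> (inv a) = \<sigma> \<one>" using aG by (simp flip: \<sigma>m)
    also have "\<sigma> \<one> = \<one>" unfolding \<sigma>_def F1 using wG by (simp add: conjugate_def)
    finally show ?thesis using aG hG \<sigma>c unfolding \<sigma>a by (metis inv_closed inv_equality inv_inv m_closed)
  qed
  have aH: "conjugate G a ` H = H"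
  proof
    show "conjugate G a ` H \<subseteq> H"
      unfolding conjugate_def
      by (intro image_subsetI subgroup.m_closed[OF H.subgroup] subgroup.m_inv_closed[OF H.subgroup] a(1))
    show "H \<subseteq> conjugate G a ` H"
    proof
      fix x assume x: "x \<in> H"
      have "conjugate G (inv a) x \<in> H"
        using a(1) x aG subgroup.m_closed[OF H.subgroup] subgroup.m_inv_closed[OF H.subgroup]
        unfolding conjugate_def by simp
      then show "x \<in> conjugate G a ` H"
        using conjugate_inverse(2)[OF aG, of x] x H.H_carrier by (metis imageI subsetD)
    qed
  qed
  have "conjugate G a ` fixed_points H (\<lambda>x. conjugate G (h \<otimes> w) (F x)) = fixed_points H \<sigma>"
  proof (rule conjugate_fixed_points[OF aH])
    fix x assume "x \<in> H"
    then have xG: "x \<in> carrier G" using H.H_carrier by blast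
    have "\<sigma> (conjugate G a x) = (a \<otimes> h) \<otimes> \<sigma> x \<otimes> inv (a \<otimes> h)"
      unfolding conjugate_def using aG hG xG by (simp add: \<sigma>m \<sigma>inv \<sigma>a)
    also have "\<dots> = conjugate G a (conjugate G h (\<sigma> x))"
      using aG hG \<sigma>c[OF xG] by (simp add: conjugate_conjugate) (simp add: conjugate_def)
    also have "conjugate G h (\<sigma> x) = conjugate G (h \<otimes> w) (F x)"
      unfolding \<sigma>_def using hG wG Fc[OF xG] by (simp add: conjugate_conjugate)
    finally have eq: "\<sigma> (conjugate G a x) = conjugate G a (conjugate G (h \<otimes> w) (F x))" .
    have "conjugate G (h \<otimes> w) (F x) \<in> carrier G" using hG wG Fc[OF xG] by (simp add: conjugate_closed)
    then show "conjugate G (h \<otimes> w) (F x) = x \<longleftrightarrow> \<sigma> (conjugate G a x) = conjugate G a x"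
      unfolding eq using conjugate_inverse(1)[OF aG] xG by metis
  qed
  moreover have "fixed_points H (\<lambda>x. conjugate G (h \<otimes> w) (F x)) \<subseteq> carrier G"
    using H.H_carrier unfolding fixed_points_def by blast
  ultimately have "G\<lparr>carrier := fixed_points H (\<lambda>x. conjugate G (h \<otimes> w) (F x))\<rparr> \<cong>
      G\<lparr>carrier := fixed_points H \<sigma>\<rparr>"
    using conjugate_iso[OF aG] by blast
  then show ?thesis unfolding fixed_group_def H_def \<sigma>_def[abs_def] .
qed

theorem proposition4p3:
  fixes G :: "('g, 'k::alg_closed_field) alg_group" (structure)
    and F :: "'g \<Rightarrow> 'g" and A w :: "'g set"
  assumes "CHAR('k) > 0"
    and "connected_reductive_group G"
    and "steinberg_endomorphism G F"
    and "subgroup A (G\<lparr>carrier := fixed_points (carrier G) F\<rparr>)"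
    and "finite A"
    and "w \<in> carrier (component_group G A)"
  shows "(\<forall>g \<in> carrier G. (inv g \<otimes> F g) <# centralizer_component G A = w \<longrightarrow>
            (\<forall>wd \<in> w. fixed_group G (conjugate G g ` A) F
                         \<cong> fixed_group G A (\<lambda>x. conjugate G wd (F x)))) \<and>
         (\<forall>wd1 \<in> w. \<forall>wd2 \<in> w.
            fixed_group G A (\<lambda>x. conjugate G wd1 (F x))
              \<cong> fixed_group G A (\<lambda>x. conjugate G wd2 (F x))) \<and>
         (acts_as_inner G A w \<longrightarrow>
            (\<forall>g \<in> carrier G. (inv g \<otimes> F g) <# centralizer_component G A = w \<longrightarrow>
               fixed_group G (conjugate G g ` A) F \<cong> fixed_group G A F))"
proof -
  have G: "linear_algebraic_group G" using assms(2) unfolding connected_reductive_group_def by blast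
  interpret linear_algebraic_group G by (rule G)
  have "A \<subseteq> fixed_points (carrier G) F" using subgroup.subset[OF assms(4)] by simp
  then have A: "A \<subseteq> carrier G" "\<forall>a\<in>A. F a = a" unfolding fixed_points_def by auto
  let ?C = "centralizer G A" and ?H = "centralizer_component G A"
  note C = centralizer_subgroup[OF A(1)]
  note H = identity_component_subgroup[OF C]
  have CG: "?C \<subseteq> carrier G" by (rule subgroup.subset[OF C])
  have HC: "?H \<subseteq> ?C" by (rule identity_component_subset[OF CG])
  have hom: "F \<in> hom G G" using assms(3) unfolding steinberg_endomorphism_def by blast
  have Fc: "F x \<in> carrier G" if "x \<in> carrier G" for x using hom_in_carrier[OF hom that] .
  note twist = twist_by_component_iso[OF G assms(1,3) A]
  obtain x where x: "x \<in> ?C" "w = {h \<otimes> x | h. h \<in> ?H}"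
    using assms(6) unfolding component_group_def FactGroup_def RCOSETS_def r_coset_def by auto
  have wC: "w \<subseteq> ?C" using x HC subgroup.m_closed[OF C] by blast
  have lifts: "fixed_group G A (\<lambda>y. conjugate G wd1 (F y)) \<cong> fixed_group G A (\<lambda>y. conjugate G wd2 (F y))"
    if wd: "wd1 \<in> w" "wd2 \<in> w" for wd1 wd2
  proof -
    obtain h1 h2 where h: "h1 \<in> ?H" "h2 \<in> ?H" "wd1 = h1 \<otimes> x" "wd2 = h2 \<otimes> x" using wd x(2) by blast
    have mem: "x \<in> carrier G" "h1 \<in> carrier G" "h2 \<in> carrier G" using x h HC CG by auto
    have "h1 \<otimes> inv h2 \<in> ?H"
      using h subgroup.m_closed[OF H] subgroup.m_inv_closed[OF H] by blast
    moreover have "(h1 \<otimes> inv h2) \<otimes> wd2 = wd1"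
      unfolding h(3,4) using mem by (simp add: m_assoc inv_cancel_left)
    moreover have "wd2 \<in> ?C" using wC wd by blast
    ultimately show ?thesis using twist by metis
  qed
  have conj: "fixed_group G (conjugate G g ` A) F \<cong> fixed_group G A (\<lambda>y. conjugate G wd (F y))"
    if g: "g \<in> carrier G" "(inv g \<otimes> F g) <# ?H = w" and wd: "wd \<in> w" for g wd
  proof -
    let ?n = "inv g \<otimes> F g"
    have n: "?n \<in> carrier G" using g Fc by simp
    have "?n \<otimes> \<one> \<in> w" unfolding g(2)[symmetric] l_coset_def using subgroup.one_closed[OF H] by blast
    then have nw: "?n \<in> w" using n by simp
    have "conjugate G g ` fixed_points ?H (\<lambda>y. conjugate G ?n (F y)) =
        fixed_points (centralizer_component G (conjugate G g ` A)) F"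
    proof (rule conjugate_fixed_points[OF conjugate_component[OF g(1) A(1)]])
      fix y assume "y \<in> ?H"
      then have y: "y \<in> carrier G" using HC CG by blast
      have Finv: "F (inv g) = inv (F g)"
        using group_hom.hom_inv[of G G F g] hom g(1) by (simp add: group_hom_def group_hom_axioms_def group_axioms)
      have "F (conjugate G g y) = conjugate G (F g) (F y)"
        unfolding conjugate_def using g(1) y Fc by (simp add: hom_mult[OF hom] Finv)
      also have "\<dots> = conjugate G g (conjugate G ?n (F y))"
        using g(1) y Fc by (simp add: conjugate_conjugate inv_cancel_left)
      finally have eq: "F (conjugate G g y) = conjugate G g (conjugate G ?n (F y))" .
      have "conjugate G ?n (F y) \<in> carrier G" using n y Fc by (simp add: conjugate_closed)
      then show "conjugate G ?n (F y) = y \<longleftrightarrow> F (conjugate G g y) = conjugate G g y"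
        unfolding eq using conjugate_inverse(1)[OF g(1)] y by metis
    qed
    moreover have "fixed_points ?H (\<lambda>y. conjugate G ?n (F y)) \<subseteq> carrier G"
      using HC CG unfolding fixed_points_def by blast
    ultimately have "fixed_group G (conjugate G g ` A) F \<cong> fixed_group G A (\<lambda>y. conjugate G ?n (F y))"
      unfolding fixed_group_def using conjugate_iso_sym[OF g(1)] by blast
    then show ?thesis using lifts[OF nw wd] by (rule iso_trans)
  qed
  have inner: "fixed_group G (conjugate G g ` A) F \<cong> fixed_group G A F"
    if act: "acts_as_inner G A w" and g: "g \<in> carrier G" "(inv g \<otimes> F g) <# ?H = w" for g
  proof -
    obtain wd c where wd: "wd \<in> w" and c: "c \<in> ?H"
      and eq: "\<forall>y\<in>?H. conjugate G wd y = conjugate G c y"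
      using act unfolding acts_as_inner_def by blast
    have oneC: "\<one> \<in> ?C" by (rule subgroup.one_closed[OF C])
    have FH: "F y \<in> ?H" if y: "y \<in> ?H" for y
    proof -
      have "F y \<in> carrier G" using y HC CG Fc by blast
      then show ?thesis
        using twisted_endo_stabilizes_component[OF G assms(3) A oneC y] by (simp add: conjugate_one)
    qed
    have "fixed_points ?H (\<lambda>y. conjugate G wd (F y)) = fixed_points ?H (\<lambda>y. conjugate G (c \<otimes> \<one>) (F y))"
      using eq FH c HC CG unfolding fixed_points_def by auto
    then have "fixed_group G A (\<lambda>y. conjugate G wd (F y)) \<cong> fixed_group G A (\<lambda>y. conjugate G \<one> (F y))"
      using twist[OF oneC c] unfolding fixed_group_def by simp
    moreover have "fixed_points ?H (\<lambda>y. conjugate G \<one> (F y)) = fixed_points ?H F"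
      using HC CG Fc unfolding fixed_points_def by (auto simp: conjugate_one subset_iff)
    ultimately have "fixed_group G A (\<lambda>y. conjugate G wd (F y)) \<cong> fixed_group G A F"
      unfolding fixed_group_def by simp
    with conj[OF g wd] show ?thesis by (rule iso_trans)
  qed
  show ?thesis using conj lifts inner by blast
qed

end
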